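(* Let $\Gamma\subseteq G$ be an almost normal subgroup of a countable discrete group, let $\pi$ be a unitary representation of $G$ on $H=\ell^2(\Gamma)\otimes L$ with $\pi|_\Gamma=\lambda_\Gamma\otimes\mathrm{Id}_L$, let $P_L$ be the projection onto $L\cong\delta_e\otimes L$, and let $H_0=pH$, where $p$ is an orthogonal projection with $[p,\pi(g)]=0$ for all $g\in G$. Let $\pi_0(g)=\pi(g)|_{H_0}$, $g\in G$, and assume that $pP_L$ is trace class. Let $S$ be the representation of $\mathcal{H}_0$ (and of $\mathcal{K}_0^*\mathcal{K}_0$) associated with $(\pi,L)$. Then: (a) $p$ commutes with $S(\Gamma\sigma\Gamma)$ for all $\sigma\in G$. The explicit expression for $p$ is $$p=\sum_{\gamma\in\Gamma}\rho(\gamma)\otimes P_L\pi_0(\gamma^{-1})P_L=E_{\pi_0(\Gamma)'}(pP_L)=E_{\pi_0(\Gamma)'}(pP_Lp),$$ and this expression belongs to $R(\Gamma)\otimes B(L)$. (b) For all $\sigma\in G$, $$pS(\Gamma\sigma)=\sum_{\theta\in\Gamma\sigma}\rho(\theta^{-1})\otimes P_L\pi_0(\theta)P_L\in p(R(G)\otimes B(L)),$$ $$pS(\Gamma\sigma\Gamma)=S(\Gamma\sigma\Gamma)p=\sum_{\theta\in\Gamma\sigma\Gamma}\rho(\theta^{-1})\otimes P_L\pi_0(\theta)P_L .$$ (c) Hence $S_p(\Gamma\sigma\Gamma)=pS(\Gamma\sigma\Gamma)p=pS(\Gamma\sigma\Gamma)$ determines a representation $S_p$ of $\mathcal{H}_0$,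 while $\Gamma\sigma\mapsto pS(\Gamma\sigma)$ determines a representation of $\mathcal{K}^*\mathcal{K}$, with $$S(\sigma_1\Gamma)\,p\,S(\Gamma\sigma_2)=\sum_{\theta\in\sigma_1\Gamma\sigma_2}\rho(\theta^{-1})\otimes P_L\pi_0(\theta)P_L,\qquad\sigma_1,\sigma_2\in G.$$
   Context: $\Gamma$ and $G$ have infinite nontrivial conjugacy classes; almost normal means $[\Gamma:\sigma\Gamma\sigma^{-1}\cap\Gamma]<\infty$ for all $\sigma\in G$. $\rho$ is the right regular representation with the convention $\rho(g)\delta_h=\delta_{hg}$, so $\rho(a)\rho(b)=\rho(ba)$; $R(G)$, $R(\Gamma)$ are the von Neumann algebras it generates on $\ell^2(G)$, $\ell^2(\Gamma)$, with $R(\Gamma)\subseteq R(G)$. The commutant $\pi(\Gamma)'\subseteq B(H)$ is $R(\Gamma)\otimes B(L)$, an element $A$ of it being written $\sum_{\gamma}\rho(\gamma^{-1})\otimes P_L\pi(\gamma)AP_L$; in particular $p\in\pi(\Gamma)'$ is regarded as an element of $R(\Gamma)\otimes B(L)\subseteq R(G)\otimes B(L)$. In expressions such as $P_L\pi_0(\theta)P_L$, $\pi_0(\theta)$ is viewed as the operator $\pi(\theta)p$ on $H$. $E_{\pi_0(\Gamma)'}(A)=\sum_{\gamma\in\Gamma}\pi(\gamma)A\pi(\gamma)^{-1}$, when this sum is strong-operator convergent. For a coset $A$ of the form $\sigma_1\Gamma$, $\Gamma\sigma_2$, $\sigma_1\Gamma\sigma_2$, or a double coset, $S(A)=\sum_{\theta\in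 A}\rho(\theta^{-1})\otimes P_L\pi(\theta)P_L$, an element of the space $\widehat{R(G)\otimes B(L)}$ of formal series $\sum_g\rho(g)\otimes A_g$, $A_g\in B(L)$, with $\sum_g\rho(g)\langle A_gl_1,l_2\rangle\in R(G)$ for all $l_1,l_2\in L$, multiplied formally. $\mathcal{H}_0=\mathbb{C}(\Gamma\backslash G/\Gamma)$ is the Hecke algebra of double cosets. $\mathcal{K}_0=\mathbb{C}(\Gamma\backslash G)$, $\mathcal{K}_0^*=\mathbb{C}(G/\Gamma)$, and $\mathcal{K}_0^*\mathcal{K}_0=\mathbb{C}(G/\Gamma)\otimes_{\mathcal{H}_0}\mathbb{C}(\Gamma\backslash G)$ is identified with the linear span of the cosets $\sigma_1\Gamma\sigma_2$, with $[\sigma_1\Gamma]\otimes[\Gamma\sigma_2]\mapsto\sigma_1\Gamma\sigma_2$ and $(\sigma_1\Gamma\sigma_2)^*=\sigma_2^{-1}\Gamma\sigma_1^{-1}$. $\mathcal{K}^*\mathcal{K}=\ell^2(G/\Gamma)\otimes_{\mathcal{H}}\ell^2(\Gamma\backslash G)$ is its completion, $\mathcal{H}$ being the weak closure of $\mathcal{H}_0$ on $\ell^2(\Gamma\backslash G)$. A representation of this operator system is a linear map $V$ with $V(k_1)^*V(k_2)=V(k_1^*k_2)$ for $k_1,k_2\in\mathcal{K}_0$; here $V(\Gamma\sigma)=pS(\Gamma\sigma)$ and $V(\Gamma\sigma)^*=S(\sigma^{-1}\Gamma)p$. *)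

theory Defs
  imports
    "HOL-Analysis.Analysis"
    "HOL-Algebra.Coset"
    "HOL-Algebra.Left_Coset"
begin

section \<open>Complex Hilbert spaces\<close>

text \<open>The inner product is linear in the first variable. The norm and the topology are
  those of the underlying real inner product space.\<close>

class complex_inner = real_inner +
  fixes scaleC :: "complex \<Rightarrow> 'a \<Rightarrow> 'a"  (infixr \<open>*\<^sub>C\<close> 75)
    and cinner :: "'a \<Rightarrow> 'a \<Rightarrow> complex"
  assumes scaleC_add_right: "c *\<^sub>C (x + y) = c *\<^sub>C x + c *\<^sub>C y"
    and scaleC_add_left: "(c + d) *\<^sub>C x = c *\<^sub>C x + d *\<^sub>C x"
    and scaleC_scaleC: "c *\<^sub>C d *\<^sub>C x = (c * d) *\<^sub>C x"
    and scaleR_scaleC: "r *\<^sub>R x = complex_of_real r *\<^sub>C x"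
    and cinner_commute: "cinner x y = cnj (cinner y x)"
    and cinner_add_left: "cinner (x + y) z = cinner x z + cinner y z"
    and cinner_scaleC_left: "cinner (c *\<^sub>C x) y = c * cinner x y"
    and Re_cinner: "Re (cinner x y) = inner x y"

class chilbert_space = complex_inner + complete_space

lemma scaleC_one [simp]: "1 *\<^sub>C (x :: 'a::complex_inner) = x"
  using scaleR_scaleC[of 1 x] by simp

lemma scaleC_zero_left [simp]: "0 *\<^sub>C (x :: 'a::complex_inner) = 0"
  using scaleR_scaleC[of 0 x] by simp

lemma cinner_self: "cinner (x :: 'a::complex_inner) x = complex_of_real ((norm x)\<^sup>2)"
proof -
  have "Im (cinner x x) = 0"
    using arg_cong[OF cinner_commute[of x x], of Im] by simp
  thus ?thesis
    by (simp add: complex_eq_iff Re_cinner power2_norm_eq_inner)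
qed

lemma cinner_zero_left [simp]: "cinner 0 (y :: 'a::complex_inner) = 0"
  using cinner_scaleC_left[of 0 0 y] by simp

lemma cinner_zero_right [simp]: "cinner (y :: 'a::complex_inner) 0 = 0"
  using cinner_commute[of y 0] by simp

lemma scaleC_zero_right [simp]: "c *\<^sub>C (0 :: 'a::complex_inner) = 0"
  using scaleC_add_right[of c 0 0] by simp

lemma cinner_scaleC_right: "cinner x (c *\<^sub>C y) = cnj c * cinner x (y :: 'a::complex_inner)"
  by (metis cinner_commute cinner_scaleC_left complex_cnj_cnj complex_cnj_mult)

lemma norm_scaleC [simp]: "norm (c *\<^sub>C x) = cmod c * norm (x :: 'a::complex_inner)"
proof -
  have "complex_of_real ((norm (c *\<^sub>C x))\<^sup>2) = c * cnj c * complex_of_real ((norm x)\<^sup>2)"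
    by (simp only: cinner_self[symmetric] cinner_scaleC_left cinner_scaleC_right) simp
  also have "\<dots> = complex_of_real ((cmod c * norm x)\<^sup>2)"
    by (simp add: complex_norm_square[symmetric] power_mult_distrib)
  finally have "(norm (c *\<^sub>C x))\<^sup>2 = (cmod c * norm x)\<^sup>2"
    using of_real_eq_iff by blast
  thus ?thesis by simp
qed

lemma cinner_inner:
  "cinner x y = Complex (inner x y) (inner x (\<i> *\<^sub>C y))" for x y :: "'a::complex_inner"
  using Re_cinner[of x y] Re_cinner[of x "\<i> *\<^sub>C y"]
  by (simp add: cinner_scaleC_right complex_eq_iff)

instantiation complex :: chilbert_space
begin

definition scaleC_complex :: "complex \<Rightarrow> complex \<Rightarrow> complex" where
  "scaleC_complex c x = c * x"

definition cinner_complex :: "complex \<Rightarrow> complex \<Rightarrow> complex" where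
  "cinner_complex x y = x * cnj y"

instance
  by standard (auto simp: scaleC_complex_def cinner_complex_def algebra_simps
      scaleR_conv_of_real inner_complex_def)

end


section \<open>Square-summable families\<close>

lemma summable_on_norm_add_square:
  fixes f g :: "'i \<Rightarrow> 'a::real_inner"
  assumes "(\<lambda>i. (norm (f i))\<^sup>2) summable_on A" "(\<lambda>i. (norm (g i))\<^sup>2) summable_on A"
  shows "(\<lambda>i. (norm (f i + g i))\<^sup>2) summable_on A"
proof (rule summable_on_comparison_test)
  show "(\<lambda>i. 2 * (norm (f i))\<^sup>2 + 2 * (norm (g i))\<^sup>2) summable_on A"
    by (intro summable_on_add summable_on_cmult_right assms)
  fix i
  have "(norm (f i + g i))\<^sup>2 \<le> (norm (f i) + norm (g i))\<^sup>2"
    by (intro power_mono norm_triangle_ineq) auto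
  also have "\<dots> \<le> 2 * (norm (f i))\<^sup>2 + 2 * (norm (g i))\<^sup>2"
    using sum_squares_bound[of "norm (f i)" "norm (g i)"] by (simp add: power2_sum)
  finally show "(norm (f i + g i))\<^sup>2 \<le> 2 * (norm (f i))\<^sup>2 + 2 * (norm (g i))\<^sup>2" .
qed auto

lemma summable_on_inner_square:
  fixes f g :: "'i \<Rightarrow> 'a::real_inner"
  assumes "(\<lambda>i. (norm (f i))\<^sup>2) summable_on A" "(\<lambda>i. (norm (g i))\<^sup>2) summable_on A"
  shows "(\<lambda>i. inner (f i) (g i)) summable_on A"
proof -
  have "(\<lambda>i. (1/2) * ((norm (f i + g i))\<^sup>2 + ((-1) * (norm (f i))\<^sup>2 + (-1) * (norm (g i))\<^sup>2))) summable_on A"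
    using assms by (intro summable_on_add summable_on_cmult_right summable_on_norm_add_square
        assms)
  thus ?thesis
    by (rule summable_on_cong[THEN iffD1, rotated])
      (simp add: power2_norm_eq_inner inner_add_left inner_add_right inner_commute)
qed

typedef (overloaded) ('i, 'a) ell2 =
  "{f :: 'i \<Rightarrow> 'a::complex_inner. (\<lambda>i. (norm (f i))\<^sup>2) summable_on UNIV}"
  morphisms ell2_apply Abs_ell2
  by (rule exI[of _ "\<lambda>_. 0"]) simp

lemma ell2_summable: "(\<lambda>i. (norm (ell2_apply f i))\<^sup>2) summable_on UNIV"
  using ell2_apply[of f] by simp

lemma ell2_eqI: "(\<And>i. ell2_apply f i = ell2_apply g i) \<Longrightarrow> f = g"
  by (metis ell2_apply_inject ext)

lemma Abs_ell2_apply: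
  "(\<lambda>i. (norm (f i))\<^sup>2) summable_on UNIV \<Longrightarrow> ell2_apply (Abs_ell2 f) = f"
  by (simp add: Abs_ell2_inverse)

instantiation ell2 :: (type, complex_inner) complex_inner
begin

definition zero_ell2 :: "('a, 'b) ell2" where
  "0 = Abs_ell2 (\<lambda>_. 0)"
definition plus_ell2 :: "('a, 'b) ell2 \<Rightarrow> ('a, 'b) ell2 \<Rightarrow> ('a, 'b) ell2" where
  "f + g = Abs_ell2 (\<lambda>i. ell2_apply f i + ell2_apply g i)"
definition uminus_ell2 :: "('a, 'b) ell2 \<Rightarrow> ('a, 'b) ell2" where
  "- f = Abs_ell2 (\<lambda>i. - ell2_apply f i)"
definition minus_ell2 :: "('a, 'b) ell2 \<Rightarrow> ('a, 'b) ell2 \<Rightarrow> ('a, 'b) ell2" where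
  "f - g = f + - (g :: ('a, 'b) ell2)"
definition scaleC_ell2 :: "complex \<Rightarrow> ('a, 'b) ell2 \<Rightarrow> ('a, 'b) ell2" where
  "c *\<^sub>C f = Abs_ell2 (\<lambda>i. c *\<^sub>C ell2_apply f i)"
definition scaleR_ell2 :: "real \<Rightarrow> ('a, 'b) ell2 \<Rightarrow> ('a, 'b) ell2" where
  "r *\<^sub>R f = complex_of_real r *\<^sub>C (f :: ('a, 'b) ell2)"
definition inner_ell2 :: "('a, 'b) ell2 \<Rightarrow> ('a, 'b) ell2 \<Rightarrow> real" where
  "inner f g = (\<Sum>\<^sub>\<infinity>i. inner (ell2_apply f i) (ell2_apply g i))"
definition cinner_ell2 :: "('a, 'b) ell2 \<Rightarrow> ('a, 'b) ell2 \<Rightarrow> complex" where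
  "cinner f g = (\<Sum>\<^sub>\<infinity>i. cinner (ell2_apply f i) (ell2_apply g i))"
definition norm_ell2 :: "('a, 'b) ell2 \<Rightarrow> real" where
  "norm f = sqrt (inner f (f :: ('a, 'b) ell2))"
definition dist_ell2 :: "('a, 'b) ell2 \<Rightarrow> ('a, 'b) ell2 \<Rightarrow> real" where
  "dist f g = norm (f - (g :: ('a, 'b) ell2))"
definition sgn_ell2 :: "('a, 'b) ell2 \<Rightarrow> ('a, 'b) ell2" where
  "sgn f = inverse (norm f) *\<^sub>R (f :: ('a, 'b) ell2)"
definition uniformity_ell2 :: "(('a, 'b) ell2 \<times> ('a, 'b) ell2) filter" where
  "uniformity_ell2 = (INF e\<in>{0<..}. principal {(x, y). dist x y < e})"
definition open_ell2 :: "('a, 'b) ell2 set \<Rightarrow> bool" where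
  "open_ell2 U = (\<forall>x\<in>U. \<forall>\<^sub>F (x', y) in uniformity. x' = x \<longrightarrow> y \<in> U)"

lemma ell2_apply_zero [simp]: "ell2_apply (0 :: ('a, 'b) ell2) i = 0"
  by (simp add: zero_ell2_def Abs_ell2_apply)

lemma ell2_apply_add [simp]:
  "ell2_apply (f + g :: ('a, 'b) ell2) i = ell2_apply f i + ell2_apply g i"
  by (simp add: plus_ell2_def Abs_ell2_apply summable_on_norm_add_square ell2_summable)

lemma ell2_apply_uminus [simp]: "ell2_apply (- f :: ('a, 'b) ell2) i = - ell2_apply f i"
  by (simp add: uminus_ell2_def Abs_ell2_apply ell2_summable)

lemma ell2_apply_diff [simp]:
  "ell2_apply (f - g :: ('a, 'b) ell2) i = ell2_apply f i - ell2_apply g i"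
  by (simp add: minus_ell2_def)

lemma ell2_apply_scaleC [simp]: "ell2_apply (c *\<^sub>C f :: ('a, 'b) ell2) i = c *\<^sub>C ell2_apply f i"
  by (simp add: scaleC_ell2_def Abs_ell2_apply power_mult_distrib summable_on_cmult_right
      ell2_summable)

lemma ell2_apply_scaleR [simp]: "ell2_apply (r *\<^sub>R f :: ('a, 'b) ell2) i = r *\<^sub>R ell2_apply f i"
  by (simp add: scaleR_ell2_def scaleR_scaleC)

lemma ell2_summable_inner:
  "(\<lambda>i. inner (ell2_apply f i) (ell2_apply (g :: ('a, 'b) ell2) i)) summable_on UNIV"
  by (intro summable_on_inner_square ell2_summable)

lemma ell2_summable_cinner:
  "(\<lambda>i. cinner (ell2_apply f i) (ell2_apply (g :: ('a, 'b) ell2) i)) summable_on UNIV"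
proof -
  have "(\<lambda>i. complex_of_real (inner (ell2_apply f i) (ell2_apply g i))
        + \<i> * complex_of_real (inner (ell2_apply f i) (ell2_apply (\<i> *\<^sub>C g) i))) summable_on UNIV"
    by (intro summable_on_add summable_on_cmult_right
        summable_on_bounded_linear[OF bounded_linear_of_real] ell2_summable_inner)
  thus ?thesis
    by (simp add: cinner_inner[of "ell2_apply f _"] Complex_eq)
qed

instance
proof
  fix x y z :: "('a, 'b) ell2" and a b :: real and c d :: complex
  show "x + y + z = x + (y + z)" by (rule ell2_eqI) (simp add: algebra_simps)
  show "x + y = y + x" by (rule ell2_eqI) (simp add: algebra_simps)
  show "0 + x = x" by (rule ell2_eqI) simp
  show "- x + x = 0" by (rule ell2_eqI) simp
  show "x - y = x + - y" by (simp add: minus_ell2_def)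
  show "a *\<^sub>R (x + y) = a *\<^sub>R x + a *\<^sub>R y" by (rule ell2_eqI) (simp add: algebra_simps)
  show "(a + b) *\<^sub>R x = a *\<^sub>R x + b *\<^sub>R x" by (rule ell2_eqI) (simp add: algebra_simps)
  show "a *\<^sub>R b *\<^sub>R x = (a * b) *\<^sub>R x" by (rule ell2_eqI) simp
  show "1 *\<^sub>R x = x" by (rule ell2_eqI) simp
  show "dist x y = norm (x - y)" by (simp add: dist_ell2_def)
  show "sgn x = inverse (norm x) *\<^sub>R x" by (simp add: sgn_ell2_def)
  show "uniformity = (INF e\<in>{0<..}. principal {(x, y :: ('a, 'b) ell2). dist x y < e})"
    by (simp add: uniformity_ell2_def)
  show "open U = (\<forall>x\<in>U. \<forall>\<^sub>F (x', y) in uniformity. x' = x \<longrightarrow> y \<in> U)"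
    for U :: "('a, 'b) ell2 set" by (simp add: open_ell2_def)
  show "inner x y = inner y x" by (simp add: inner_ell2_def inner_commute)
  show "inner (x + y) z = inner x z + inner y z"
    by (simp add: inner_ell2_def inner_add_left infsum_add ell2_summable_inner)
  show "inner (a *\<^sub>R x) y = a * inner x y"
    by (simp add: inner_ell2_def infsum_cmult_right')
  show "0 \<le> inner x x" by (simp add: inner_ell2_def infsum_nonneg)
  show "inner x x = 0 \<longleftrightarrow> x = 0"
  proof
    assume "inner x x = 0"
    hence "inner (ell2_apply x i) (ell2_apply x i) = 0" for i
      by (intro nonneg_infsum_le_0D[of "\<lambda>i. inner (ell2_apply x i) (ell2_apply x i)" UNIV])
        (auto simp: inner_ell2_def intro: ell2_summable_inner)
    thus "x = 0" by (intro ell2_eqI) simp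
  qed (simp add: inner_ell2_def)
  show "norm x = sqrt (inner x x)" by (simp add: norm_ell2_def)
  show "c *\<^sub>C (x + y) = c *\<^sub>C x + c *\<^sub>C y" by (rule ell2_eqI) (simp add: scaleC_add_right)
  show "(c + d) *\<^sub>C x = c *\<^sub>C x + d *\<^sub>C x" by (rule ell2_eqI) (simp add: scaleC_add_left)
  show "c *\<^sub>C d *\<^sub>C x = (c * d) *\<^sub>C x" by (rule ell2_eqI) (simp add: scaleC_scaleC)
  show "a *\<^sub>R x = complex_of_real a *\<^sub>C x" by (simp add: scaleR_ell2_def)
  show "cinner x y = cnj (cinner y x)"
    unfolding cinner_ell2_def infsum_cnj[symmetric] by (rule infsum_cong) (rule cinner_commute)
  show "cinner (x + y) z = cinner x z + cinner y z"
    by (simp add: cinner_ell2_def cinner_add_left infsum_add ell2_summable_cinner)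
  show "cinner (c *\<^sub>C x) y = c * cinner x y"
    by (simp add: cinner_ell2_def cinner_scaleC_left infsum_cmult_right')
  show "Re (cinner x y) = inner x y"
    by (simp add: cinner_ell2_def inner_ell2_def infsum_Re[symmetric] ell2_summable_cinner
        Re_cinner)
qed

end

lemma ell2_norm_square: "(norm f)\<^sup>2 = (\<Sum>\<^sub>\<infinity>i. (norm (ell2_apply f i))\<^sup>2)"
  by (simp add: power2_norm_eq_inner inner_ell2_def)

lemma ell2_sum_le: "finite F \<Longrightarrow> (\<Sum>i\<in>F. (norm (ell2_apply f i))\<^sup>2) \<le> (norm f)\<^sup>2"
  unfolding ell2_norm_square by (rule finite_sum_le_infsum) (auto intro: ell2_summable)

lemma ell2_apply_le: "norm (ell2_apply f i) \<le> norm f"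
  using ell2_sum_le[of "{i}" f] by (simp add: power2_le_iff_abs_le)

instance ell2 :: (type, chilbert_space) chilbert_space
proof
  fix X :: "nat \<Rightarrow> ('a, 'b) ell2"
  assume X: "Cauchy X"
  have "Cauchy (\<lambda>n. ell2_apply (X n) i)" for i
    unfolding Cauchy_def dist_norm
    by (metis X Cauchy_def dist_norm ell2_apply_diff ell2_apply_le order_le_less_trans)
  hence "\<exists>l. (\<lambda>n. ell2_apply (X n) i) \<longlonglongrightarrow> l" for i
    using Cauchy_convergent_iff convergent_def by blast
  then obtain l where l: "\<And>i. (\<lambda>n. ell2_apply (X n) i) \<longlonglongrightarrow> l i" by metis
  have tail: "\<exists>N. \<forall>n\<ge>N. \<forall>F. finite F \<longrightarrow> (\<Sum>i\<in>F. (norm (l i - ell2_apply (X n) i))\<^sup>2) \<le> e\<^sup>2"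
    if e: "e > 0" for e
  proof -
    obtain N where N: "\<And>m n. m \<ge> N \<Longrightarrow> n \<ge> N \<Longrightarrow> norm (X m - X n) < e"
      using X e unfolding Cauchy_def dist_norm by metis
    have "(\<Sum>i\<in>F. (norm (l i - ell2_apply (X n) i))\<^sup>2) \<le> e\<^sup>2" if "n \<ge> N" "finite F" for n F
    proof (rule tendsto_upperbound)
      show "(\<lambda>m. \<Sum>i\<in>F. (norm (ell2_apply (X m) i - ell2_apply (X n) i))\<^sup>2)
              \<longlonglongrightarrow> (\<Sum>i\<in>F. (norm (l i - ell2_apply (X n) i))\<^sup>2)"
        by (intro tendsto_intros l)
      show "\<forall>\<^sub>F m in sequentially.
              (\<Sum>i\<in>F. (norm (ell2_apply (X m) i - ell2_apply (X n) i))\<^sup>2) \<le> e\<^sup>2"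
      proof (rule eventually_sequentiallyI[of N])
        fix m assume "m \<ge> N"
        hence "(norm (X m - X n))\<^sup>2 \<le> e\<^sup>2"
          using N[of m n] \<open>n \<ge> N\<close> by (intro power_mono) auto
        thus "(\<Sum>i\<in>F. (norm (ell2_apply (X m) i - ell2_apply (X n) i))\<^sup>2) \<le> e\<^sup>2"
          using ell2_sum_le[OF \<open>finite F\<close>, of "X m - X n"] by simp
      qed
    qed simp
    thus ?thesis by blast
  qed
  have summ: "(\<lambda>i. (norm (l i - ell2_apply (X n) i))\<^sup>2) summable_on UNIV"
    if "\<And>F. finite F \<Longrightarrow> (\<Sum>i\<in>F. (norm (l i - ell2_apply (X n) i))\<^sup>2) \<le> e\<^sup>2" for n e
    using that by (intro nonneg_bdd_above_summable_on) (auto simp: bdd_above_def)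
  obtain N where "\<And>F. finite F \<Longrightarrow> (\<Sum>i\<in>F. (norm (l i - ell2_apply (X N) i))\<^sup>2) \<le> 1\<^sup>2"
    using tail[of 1] by auto
  from summable_on_norm_add_square[OF summ[OF this] ell2_summable[of "X N"]]
  have "(\<lambda>i. (norm (l i))\<^sup>2) summable_on UNIV" by simp
  then have L: "ell2_apply (Abs_ell2 l) i = l i" for i
    by (simp add: Abs_ell2_apply)
  have "X \<longlonglongrightarrow> Abs_ell2 l"
  proof (rule metric_LIMSEQ_I)
    fix r :: real assume "r > 0"
    obtain N where N: "\<And>n F. n \<ge> N \<Longrightarrow> finite F \<Longrightarrow>
        (\<Sum>i\<in>F. (norm (l i - ell2_apply (X n) i))\<^sup>2) \<le> (r / 2)\<^sup>2"
      using tail[of "r / 2"] \<open>r > 0\<close> by auto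
    have "dist (X n) (Abs_ell2 l) < r" if "n \<ge> N" for n
    proof -
      have "(norm (Abs_ell2 l - X n))\<^sup>2 \<le> (r / 2)\<^sup>2"
        unfolding ell2_norm_square
        using N[OF that] by (intro infsum_le_finite_sums) (auto simp: L intro: summ)
      hence "norm (Abs_ell2 l - X n) \<le> r / 2"
        using \<open>r > 0\<close> by (simp add: power2_le_iff_abs_le)
      thus ?thesis using \<open>r > 0\<close> by (simp add: dist_norm norm_minus_commute)
    qed
    thus "\<exists>N. \<forall>n\<ge>N. dist (X n) (Abs_ell2 l) < r" by blast
  qed
  thus "convergent X" by (auto simp: convergent_def)
qed


text \<open>For an index set \<open>X\<close> and a Hilbert space \<open>'l\<close>, the space \<open>ell2_on X\<close> of families supported
  on \<open>X\<close> is \<open>\<ell>\<^sup>2(X) \<otimes> 'l\<close>, with \<open>\<delta>\<^sub>x \<otimes> l\<close> equal to \<open>single x l\<close>; for \<open>'l = complex\<close> it is \<open>\<ell>\<^sup>2(X)\<close>.\<close>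

definition ell2_on :: "'i set \<Rightarrow> ('i, 'l::complex_inner) ell2 set" where
  "ell2_on X = {f. \<forall>x. x \<notin> X \<longrightarrow> ell2_apply f x = 0}"

definition single :: "'i \<Rightarrow> 'l::complex_inner \<Rightarrow> ('i, 'l) ell2" where
  "single x l = Abs_ell2 (\<lambda>y. if y = x then l else 0)"

definition tensor :: "('i, complex) ell2 \<Rightarrow> 'l::complex_inner \<Rightarrow> ('i, 'l) ell2"  (infixl \<open>\<otimes>\<^sub>h\<close> 70) where
  "\<xi> \<otimes>\<^sub>h l = Abs_ell2 (\<lambda>x. ell2_apply \<xi> x *\<^sub>C l)"

lemma ell2_apply_single: "ell2_apply (single x l) y = (if y = x then l else 0)"
proof -
  have "(\<lambda>y. (norm (if y = x then l else 0))\<^sup>2) summable_on {x}" by simp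
  hence "(\<lambda>y. (norm (if y = x then l else 0))\<^sup>2) summable_on UNIV"
    by (rule summable_on_cong_neutral[THEN iffD1, rotated -1]) auto
  thus ?thesis by (simp add: single_def Abs_ell2_apply)
qed

lemma ell2_apply_tensor: "ell2_apply (\<xi> \<otimes>\<^sub>h l) x = ell2_apply \<xi> x *\<^sub>C l"
  by (simp add: tensor_def Abs_ell2_apply power_mult_distrib summable_on_cmult_left ell2_summable)

lemma single_tensor: "single x 1 \<otimes>\<^sub>h l = single x l"
  by (rule ell2_eqI) (simp add: ell2_apply_tensor ell2_apply_single)

text \<open>A family which is not square-summable is replaced by an irrelevant vector; all uses below
  (translations of square-summable families) are square-summable.\<close>

definition left_reg :: "('g, 'm) monoid_scheme \<Rightarrow> 'g set \<Rightarrow> 'g \<Rightarrow> ('g, 'l::complex_inner) ell2 \<Rightarrow> ('g, 'l) ell2" where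
  "left_reg G X g f = Abs_ell2 (\<lambda>x. if x \<in> X then ell2_apply f (inv\<^bsub>G\<^esub> g \<otimes>\<^bsub>G\<^esub> x) else 0)"

definition right_reg :: "('g, 'm) monoid_scheme \<Rightarrow> 'g set \<Rightarrow> 'g \<Rightarrow> ('g, 'l::complex_inner) ell2 \<Rightarrow> ('g, 'l) ell2" where
  "right_reg G X g f = Abs_ell2 (\<lambda>x. if x \<in> X then ell2_apply f (x \<otimes>\<^bsub>G\<^esub> inv\<^bsub>G\<^esub> g) else 0)"

lemma summable_on_restrict_translate:
  assumes "inj_on t X"
  shows "(\<lambda>x. (norm (if x \<in> X then ell2_apply f (t x) else 0))\<^sup>2) summable_on UNIV"
proof -
  have "(\<lambda>y. (norm (ell2_apply f y))\<^sup>2) summable_on (t ` X)"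
    by (rule summable_on_subset_banach[OF ell2_summable]) simp
  hence "(\<lambda>x. (norm (ell2_apply f (t x)))\<^sup>2) summable_on X"
    using summable_on_reindex[OF assms, of "\<lambda>y. (norm (ell2_apply f y))\<^sup>2"] by (simp add: o_def)
  thus ?thesis
    by (rule summable_on_cong_neutral[THEN iffD1, rotated -1]) auto
qed

lemma ell2_apply_left_reg:
  assumes "group G" "X \<subseteq> carrier G" "g \<in> carrier G"
  shows "ell2_apply (left_reg G X g f) x = (if x \<in> X then ell2_apply f (inv\<^bsub>G\<^esub> g \<otimes>\<^bsub>G\<^esub> x) else 0)"
proof -
  interpret group G by fact
  have "inj_on (\<lambda>x. inv\<^bsub>G\<^esub> g \<otimes>\<^bsub>G\<^esub> x) X"
    using assms by (intro inj_onI) (auto simp: subset_iff)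
  thus ?thesis
    unfolding left_reg_def by (subst Abs_ell2_apply) (rule summable_on_restrict_translate, auto)
qed

lemma ell2_apply_right_reg:
  assumes "group G" "X \<subseteq> carrier G" "g \<in> carrier G"
  shows "ell2_apply (right_reg G X g f) x = (if x \<in> X then ell2_apply f (x \<otimes>\<^bsub>G\<^esub> inv\<^bsub>G\<^esub> g) else 0)"
proof -
  interpret group G by fact
  have "inj_on (\<lambda>x. x \<otimes>\<^bsub>G\<^esub> inv\<^bsub>G\<^esub> g) X"
    using assms by (intro inj_onI) (auto simp: subset_iff)
  thus ?thesis
    unfolding right_reg_def by (subst Abs_ell2_apply) (rule summable_on_restrict_translate, auto)
qed

lemma right_reg_single:
  assumes "group G" "subgroup X G" "g \<in> X" "h \<in> X"
  shows "right_reg G X g (single h l) = single (h \<otimes>\<^bsub>G\<^esub> g) l"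
proof (rule ell2_eqI)
  fix x
  interpret group G by fact
  interpret subgroup X G by fact
  have "x = h \<otimes>\<^bsub>G\<^esub> g \<longleftrightarrow> x \<in> X \<and> x \<otimes>\<^bsub>G\<^esub> inv\<^bsub>G\<^esub> g = h"
    using assms(3,4) by (metis inv_solve_right' m_closed mem_carrier)
  thus "ell2_apply (right_reg G X g (single h l)) x = ell2_apply (single (h \<otimes>\<^bsub>G\<^esub> g) l) x"
    using assms by (simp add: ell2_apply_right_reg ell2_apply_single subset)
qed

lemma left_reg_single:
  assumes "group G" "subgroup X G" "g \<in> X" "h \<in> X"
  shows "left_reg G X g (single h l) = single (g \<otimes>\<^bsub>G\<^esub> h) l"
proof (rule ell2_eqI)
  fix x
  interpret group G by fact
  interpret subgroup X G by fact
  have "x = g \<otimes>\<^bsub>G\<^esub> h \<longleftrightarrow> x \<in> X \<and> inv\<^bsub>G\<^esub> g \<otimes>\<^bsub>G\<^esub> x = h"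
    using assms(3,4) by (metis inv_solve_left' m_closed mem_carrier)
  thus "ell2_apply (left_reg G X g (single h l)) x = ell2_apply (single (g \<otimes>\<^bsub>G\<^esub> h) l) x"
    using assms by (simp add: ell2_apply_left_reg ell2_apply_single subset)
qed


section \<open>Bounded operators on a closed subspace\<close>

text \<open>An operator on a closed subspace \<open>K\<close> is a function on the ambient type of which only the
  values on \<open>K\<close> matter; equality of operators on \<open>K\<close> is equality on the vectors of \<open>K\<close>.\<close>

definition bop :: "'h::complex_inner set \<Rightarrow> ('h \<Rightarrow> 'h) set" where
  "bop K = {T. (\<forall>f\<in>K. T f \<in> K) \<and> (\<forall>f\<in>K. \<forall>g\<in>K. T (f + g) = T f + T g) \<and>
     (\<forall>c. \<forall>f\<in>K. T (c *\<^sub>C f) = c *\<^sub>C T f) \<and> (\<exists>C. \<forall>f\<in>K. norm (T f) \<le> C * norm f)}"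

definition is_adjoint :: "'h::complex_inner set \<Rightarrow> ('h \<Rightarrow> 'h) \<Rightarrow> ('h \<Rightarrow> 'h) \<Rightarrow> bool" where
  "is_adjoint K T S \<longleftrightarrow> T \<in> bop K \<and> S \<in> bop K \<and> (\<forall>f\<in>K. \<forall>g\<in>K. cinner (T f) g = cinner f (S g))"

definition unitary_op :: "'h::complex_inner set \<Rightarrow> ('h \<Rightarrow> 'h) \<Rightarrow> bool" where
  "unitary_op K U \<longleftrightarrow> U \<in> bop K \<and> U ` K = K \<and> (\<forall>f\<in>K. \<forall>g\<in>K. cinner (U f) (U g) = cinner f g)"

definition orth_projection :: "'h::complex_inner set \<Rightarrow> ('h \<Rightarrow> 'h) \<Rightarrow> bool" where
  "orth_projection K p \<longleftrightarrow> is_adjoint K p p \<and> (\<forall>f\<in>K. p (p f) = p f)"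

definition positive_op :: "'h::complex_inner set \<Rightarrow> ('h \<Rightarrow> 'h) \<Rightarrow> bool" where
  "positive_op K A \<longleftrightarrow> A \<in> bop K \<and> (\<forall>f\<in>K. Im (cinner (A f) f) = 0 \<and> 0 \<le> Re (cinner (A f) f))"

definition onb :: "'h::complex_inner set \<Rightarrow> 'h set \<Rightarrow> bool" where
  "onb K E \<longleftrightarrow> E \<subseteq> K \<and> (\<forall>e\<in>E. norm e = 1) \<and> (\<forall>e\<in>E. \<forall>e'\<in>E. e \<noteq> e' \<longrightarrow> cinner e e' = 0) \<and>
     (\<forall>f\<in>K. (\<forall>e\<in>E. cinner f e = 0) \<longrightarrow> f = 0)"

text \<open>\<open>A\<close> is the absolute value \<open>|T|\<close>, the positive square root of \<open>T\<^sup>* T\<close>; the trace of a positive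
  operator does not depend on the orthonormal basis.\<close>

definition trace_class :: "'h::complex_inner set \<Rightarrow> ('h \<Rightarrow> 'h) \<Rightarrow> bool" where
  "trace_class K T \<longleftrightarrow> (\<exists>S A E. is_adjoint K T S \<and> positive_op K A \<and> (\<forall>f\<in>K. A (A f) = S (T f)) \<and>
     onb K E \<and> (\<lambda>e. Re (cinner (A e) e)) summable_on E)"

definition commutant :: "'h::complex_inner set \<Rightarrow> ('h \<Rightarrow> 'h) set \<Rightarrow> ('h \<Rightarrow> 'h) set" where
  "commutant K M = {T \<in> bop K. \<forall>S\<in>M. \<forall>f\<in>K. T (S f) = S (T f)}"

text \<open>The von Neumann algebra generated by \<open>M\<close>, for a set \<open>M\<close> closed under adjoints.\<close>

definition vN_generated :: "'h::complex_inner set \<Rightarrow> ('h \<Rightarrow> 'h) set \<Rightarrow> ('h \<Rightarrow> 'h) set" where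
  "vN_generated K M = commutant K (commutant K M)"

definition is_tensor_op :: "'i set \<Rightarrow> (('i, complex) ell2 \<Rightarrow> ('i, complex) ell2) \<Rightarrow>
    ('l::complex_inner \<Rightarrow> 'l) \<Rightarrow> (('i, 'l) ell2 \<Rightarrow> ('i, 'l) ell2) \<Rightarrow> bool" where
  "is_tensor_op X A B C \<longleftrightarrow> C \<in> bop (ell2_on X) \<and> (\<forall>\<xi>\<in>ell2_on X. \<forall>l. C (\<xi> \<otimes>\<^sub>h l) = A \<xi> \<otimes>\<^sub>h B l)"

definition R_vN :: "('g, 'm) monoid_scheme \<Rightarrow> 'g set \<Rightarrow> (('g, complex) ell2 \<Rightarrow> ('g, complex) ell2) set" where
  "R_vN G X = vN_generated (ell2_on X) (right_reg G X ` X)"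

text \<open>The von Neumann tensor product \<open>R(X) \<otimes> B('l)\<close>, on \<open>\<ell>\<^sup>2(X) \<otimes> 'l\<close>.\<close>

definition R_vN_tensor :: "('g, 'm) monoid_scheme \<Rightarrow> 'g set \<Rightarrow>
    (('g, 'l::complex_inner) ell2 \<Rightarrow> ('g, 'l) ell2) set" where
  "R_vN_tensor G X = vN_generated (ell2_on X) {C. \<exists>A\<in>R_vN G X. \<exists>B\<in>bop UNIV. is_tensor_op X A B C}"


section \<open>The representation and the groups\<close>

definition icc :: "('g, 'm) monoid_scheme \<Rightarrow> bool" where
  "icc G \<longleftrightarrow> (\<forall>g\<in>carrier G. g \<noteq> \<one>\<^bsub>G\<^esub> \<longrightarrow>
     infinite {h \<otimes>\<^bsub>G\<^esub> g \<otimes>\<^bsub>G\<^esub> inv\<^bsub>G\<^esub> h | h. h \<in> carrier G})"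

definition almost_normal :: "('g, 'm) monoid_scheme \<Rightarrow> 'g set \<Rightarrow> bool" where
  "almost_normal G \<Gamma> \<longleftrightarrow> (\<forall>\<sigma>\<in>carrier G.
     finite (rcosets\<^bsub>G\<lparr>carrier := \<Gamma>\<rparr>\<^esub> ((\<sigma> <#\<^bsub>G\<^esub> \<Gamma> #>\<^bsub>G\<^esub> inv\<^bsub>G\<^esub> \<sigma>) \<inter> \<Gamma>)))"

definition unitary_rep :: "('g, 'm) monoid_scheme \<Rightarrow> 'h::complex_inner set \<Rightarrow> ('g \<Rightarrow> 'h \<Rightarrow> 'h) \<Rightarrow> bool" where
  "unitary_rep G K \<pi> \<longleftrightarrow> (\<forall>g\<in>carrier G. unitary_op K (\<pi> g)) \<and> (\<forall>f\<in>K. \<pi> \<one>\<^bsub>G\<^esub> f = f) \<and>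
     (\<forall>g\<in>carrier G. \<forall>h\<in>carrier G. \<forall>f\<in>K. \<pi> (g \<otimes>\<^bsub>G\<^esub> h) f = \<pi> g (\<pi> h f))"

text \<open>\<open>P_L\<close> is the projection of \<open>\<ell>\<^sup>2 \<otimes> L\<close> onto \<open>\<delta>\<^sub>e \<otimes> L\<close>; \<open>compress G T\<close> is the operator \<open>P\<^sub>L T P\<^sub>L\<close>
  viewed as an operator on \<open>L\<close> through \<open>L \<cong> \<delta>\<^sub>e \<otimes> L\<close>.\<close>

definition P_L :: "('g, 'm) monoid_scheme \<Rightarrow> ('g, 'l::complex_inner) ell2 \<Rightarrow> ('g, 'l) ell2" where
  "P_L G f = single \<one>\<^bsub>G\<^esub> (ell2_apply f \<one>\<^bsub>G\<^esub>)"

definition compress :: "('g, 'm) monoid_scheme \<Rightarrow> (('g, 'l::complex_inner) ell2 \<Rightarrow> ('g, 'l) ell2) \<Rightarrow> 'l \<Rightarrow> 'l" where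
  "compress G T l = ell2_apply (T (single \<one>\<^bsub>G\<^esub> l)) \<one>\<^bsub>G\<^esub>"

text \<open>\<open>B = E(A)\<close>, the sum \<open>\<Sum>\<^bsub>\<gamma>\<in>\<Gamma>\<^esub> \<pi>(\<gamma>) A \<pi>(\<gamma>)\<inverse>\<close> converging strongly to \<open>B\<close> on \<open>K\<close>.\<close>

definition has_E :: "('g, 'm) monoid_scheme \<Rightarrow> 'g set \<Rightarrow> 'h::complex_inner set \<Rightarrow> ('g \<Rightarrow> 'h \<Rightarrow> 'h) \<Rightarrow>
    ('h \<Rightarrow> 'h) \<Rightarrow> ('h \<Rightarrow> 'h) \<Rightarrow> bool" where
  "has_E G \<Gamma> K \<pi> A B \<longleftrightarrow> (\<forall>f\<in>K. ((\<lambda>\<gamma>. \<pi> \<gamma> (A (\<pi> (inv\<^bsub>G\<^esub> \<gamma>) f))) has_sum B f) \<Gamma>)"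


section \<open>Series with coefficients in \<open>B(L)\<close>\<close>

text \<open>A formal series \<open>\<Sum>\<^sub>g \<rho>(g) \<otimes> A\<^sub>g\<close> is the function \<open>g \<mapsto> A\<^sub>g\<close>, zero off the group. The
  coefficients of an operator \<open>T\<close> are read off from \<open>T (\<delta>\<^sub>e \<otimes> l) = \<Sum>\<^sub>g \<delta>\<^sub>g \<otimes> A\<^sub>g l\<close>. In particular,
  an element of \<open>R(\<Gamma>) \<otimes> B(L)\<close> and its image in \<open>R(G) \<otimes> B(L)\<close> have the same coefficients.\<close>

type_synonym ('g, 'l) series = "'g \<Rightarrow> 'l \<Rightarrow> 'l"

definition op_coeffs :: "('g, 'm) monoid_scheme \<Rightarrow> (('g, 'l::complex_inner) ell2 \<Rightarrow> ('g, 'l) ell2) \<Rightarrow>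
    ('g, 'l) series" where
  "op_coeffs G T = (\<lambda>g l. ell2_apply (T (single \<one>\<^bsub>G\<^esub> l)) g)"

definition formal_space :: "('g, 'm) monoid_scheme \<Rightarrow> ('g, 'l::complex_inner) series set" where
  "formal_space G = {A. (\<forall>g\<in>carrier G. A g \<in> bop UNIV) \<and> (\<forall>g. g \<notin> carrier G \<longrightarrow> A g = (\<lambda>l. 0)) \<and>
     (\<forall>l\<^sub>1 l\<^sub>2. \<exists>T\<in>R_vN G (carrier G). \<forall>g\<in>carrier G.
        ell2_apply (T (single \<one>\<^bsub>G\<^esub> 1)) g = cinner (A g l\<^sub>1) l\<^sub>2)}"

text \<open>\<open>C\<close> is the product \<open>A B\<close>: since \<open>\<rho>(g) \<rho>(h) = \<rho>(h g)\<close>, the coefficient of \<open>\<rho>(k)\<close> is the sum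
  of \<open>A\<^sub>g B\<^sub>h\<close> over \<open>h g = k\<close>. The sum is taken in the strong operator topology, and its
  convergence is part of the assertion.\<close>

definition is_product :: "('g, 'm) monoid_scheme \<Rightarrow> ('g, 'l::complex_inner) series \<Rightarrow>
    ('g, 'l) series \<Rightarrow> ('g, 'l) series \<Rightarrow> bool" where
  "is_product G A B C \<longleftrightarrow> A \<in> formal_space G \<and> B \<in> formal_space G \<and> C \<in> formal_space G \<and>
     (\<forall>k\<in>carrier G. \<forall>l. ((\<lambda>h. A (inv\<^bsub>G\<^esub> h \<otimes>\<^bsub>G\<^esub> k) (B h l)) has_sum C k l) (carrier G))"

definition is_product3 :: "('g, 'm) monoid_scheme \<Rightarrow> ('g, 'l::complex_inner) series \<Rightarrow>
    ('g, 'l) series \<Rightarrow> ('g, 'l) series \<Rightarrow> ('g, 'l) series \<Rightarrow> bool" where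
  "is_product3 G A B C D \<longleftrightarrow>
     (\<exists>E. is_product G A B E \<and> is_product G E C D) \<and> (\<exists>F. is_product G B C F \<and> is_product G A F D)"

text \<open>\<open>T = \<Sum>\<^bsub>\<gamma>\<in>X\<^esub> \<rho>(\<gamma>) \<otimes> A\<^sub>\<gamma>\<close> as operators on \<open>\<ell>\<^sup>2(X) \<otimes> 'l\<close>, the sum being taken coordinatewise.\<close>

definition has_expansion :: "('g, 'm) monoid_scheme \<Rightarrow> 'g set \<Rightarrow>
    (('g, 'l::complex_inner) ell2 \<Rightarrow> ('g, 'l) ell2) \<Rightarrow> ('g, 'l) series \<Rightarrow> bool" where
  "has_expansion G X T A \<longleftrightarrow> (\<forall>f\<in>ell2_on X. \<forall>x\<in>X.
     ((\<lambda>\<gamma>. A \<gamma> (ell2_apply (right_reg G X \<gamma> f) x)) has_sum ell2_apply (T f) x) X)"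

text \<open>\<open>\<Sum>\<^bsub>\<theta>\<in>A\<^esub> \<rho>(\<theta>\<inverse>) \<otimes> P\<^sub>L \<pi>(\<theta>) P\<^sub>L\<close>; this is \<open>S(A)\<close> for the given representation \<open>\<pi>\<close>.\<close>

definition coset_series :: "('g, 'm) monoid_scheme \<Rightarrow>
    ('g \<Rightarrow> ('g, 'l::complex_inner) ell2 \<Rightarrow> ('g, 'l) ell2) \<Rightarrow> 'g set \<Rightarrow> ('g, 'l) series" where
  "coset_series G \<pi> A = (\<lambda>g. if g \<in> carrier G \<and> inv\<^bsub>G\<^esub> g \<in> A then compress G (\<pi> (inv\<^bsub>G\<^esub> g)) else (\<lambda>l. 0))"


section \<open>The Hecke algebra and the operator system\<close>

definition double_coset :: "('g, 'm) monoid_scheme \<Rightarrow> 'g set \<Rightarrow> 'g \<Rightarrow> 'g set" where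
  "double_coset G \<Gamma> \<sigma> = (\<Gamma> #>\<^bsub>G\<^esub> \<sigma>) <#>\<^bsub>G\<^esub> \<Gamma>"

text \<open>A formal combination of cosets is identified with the corresponding combination of
  indicator functions on the group.\<close>

definition cspan :: "('g \<Rightarrow> complex) set \<Rightarrow> ('g \<Rightarrow> complex) set" where
  "cspan B = {f. \<exists>F c. finite F \<and> F \<subseteq> B \<and> f = (\<lambda>x. \<Sum>b\<in>F. c b * b x)}"

definition Hecke :: "('g, 'm) monoid_scheme \<Rightarrow> 'g set \<Rightarrow> ('g \<Rightarrow> complex) set" where
  "Hecke G \<Gamma> = cspan {indicator (double_coset G \<Gamma> \<sigma>) | \<sigma>. \<sigma> \<in> carrier G}"

definition K0 :: "('g, 'm) monoid_scheme \<Rightarrow> 'g set \<Rightarrow> ('g \<Rightarrow> complex) set" where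
  "K0 G \<Gamma> = cspan {indicator (\<Gamma> #>\<^bsub>G\<^esub> \<sigma>) | \<sigma>. \<sigma> \<in> carrier G}"

definition K0K0 :: "('g, 'm) monoid_scheme \<Rightarrow> 'g set \<Rightarrow> ('g \<Rightarrow> complex) set" where
  "K0K0 G \<Gamma> = cspan {indicator (\<sigma>\<^sub>1 <#\<^bsub>G\<^esub> \<Gamma> #>\<^bsub>G\<^esub> \<sigma>\<^sub>2) | \<sigma>\<^sub>1 \<sigma>\<^sub>2. \<sigma>\<^sub>1 \<in> carrier G \<and> \<sigma>\<^sub>2 \<in> carrier G}"

text \<open>For \<open>a\<close> right invariant and \<open>b\<close> left invariant under \<open>\<Gamma>\<close>, \<open>(a b)(\<theta>)\<close> is the sum of
  \<open>a(x) b(x\<inverse> \<theta>)\<close> over the cosets \<open>x\<Gamma>\<close>; the summand depends only on the coset and has finite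
  support. On the Hecke algebra this is the usual product of double cosets, and it sends
  \<open>[\<sigma>\<^sub>1\<Gamma>] \<otimes> [\<Gamma>\<sigma>\<^sub>2]\<close> to \<open>\<sigma>\<^sub>1\<Gamma>\<sigma>\<^sub>2\<close>.\<close>

definition coset_mult :: "('g, 'm) monoid_scheme \<Rightarrow> 'g set \<Rightarrow> ('g \<Rightarrow> complex) \<Rightarrow> ('g \<Rightarrow> complex) \<Rightarrow>
    'g \<Rightarrow> complex" where
  "coset_mult G \<Gamma> a b \<theta> = (if \<theta> \<in> carrier G
     then (\<Sum>\<^sub>\<infinity>C\<in>lcosets\<^bsub>G\<^esub> \<Gamma>. let x = (SOME x. x \<in> C) in a x * b (inv\<^bsub>G\<^esub> x \<otimes>\<^bsub>G\<^esub> \<theta>)) else 0)"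

lemma coset_mult_indicator:
  assumes "group G" "subgroup \<Gamma> G" "\<sigma>\<^sub>1 \<in> carrier G" "\<sigma>\<^sub>2 \<in> carrier G"
  shows "coset_mult G \<Gamma> (indicator (\<sigma>\<^sub>1 <#\<^bsub>G\<^esub> \<Gamma>)) (indicator (\<Gamma> #>\<^bsub>G\<^esub> \<sigma>\<^sub>2))
       = indicator (\<sigma>\<^sub>1 <#\<^bsub>G\<^esub> \<Gamma> #>\<^bsub>G\<^esub> \<sigma>\<^sub>2)"
proof
  fix \<theta>
  interpret group G by fact
  interpret \<Gamma>: subgroup \<Gamma> G by fact
  let ?C0 = "\<sigma>\<^sub>1 <#\<^bsub>G\<^esub> \<Gamma>"
  let ?f = "\<lambda>C. let x = (SOME x. x \<in> C) in
      indicator ?C0 x * (indicator (\<Gamma> #>\<^bsub>G\<^esub> \<sigma>\<^sub>2) (inv\<^bsub>G\<^esub> x \<otimes>\<^bsub>G\<^esub> \<theta>) :: complex)"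
  have in_l: "x \<in> a <#\<^bsub>G\<^esub> \<Gamma> \<longleftrightarrow> x \<in> carrier G \<and> inv\<^bsub>G\<^esub> a \<otimes>\<^bsub>G\<^esub> x \<in> \<Gamma>" if "a \<in> carrier G" for a x
  proof
    assume "x \<in> a <#\<^bsub>G\<^esub> \<Gamma>"
    then obtain h where "h \<in> \<Gamma>" "x = a \<otimes>\<^bsub>G\<^esub> h" by (auto simp: l_coset_def)
    thus "x \<in> carrier G \<and> inv\<^bsub>G\<^esub> a \<otimes>\<^bsub>G\<^esub> x \<in> \<Gamma>"
      using that by (simp add: m_assoc[symmetric])
  next
    assume x: "x \<in> carrier G \<and> inv\<^bsub>G\<^esub> a \<otimes>\<^bsub>G\<^esub> x \<in> \<Gamma>"
    hence "x = a \<otimes>\<^bsub>G\<^esub> (inv\<^bsub>G\<^esub> a \<otimes>\<^bsub>G\<^esub> x)" using that by (simp add: m_assoc[symmetric])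
    thus "x \<in> a <#\<^bsub>G\<^esub> \<Gamma>" using x by (force simp: l_coset_def)
  qed
  have ne: "(SOME x. x \<in> C) \<in> C" if "C \<in> lcosets\<^bsub>G\<^esub> \<Gamma>" for C
  proof -
    have "\<exists>x. x \<in> C" using that \<Gamma>.one_closed unfolding LCOSETS_def l_coset_def by blast
    thus ?thesis by (rule someI_ex)
  qed
  have C0: "?C0 \<in> lcosets\<^bsub>G\<^esub> \<Gamma>" using assms by (auto simp: LCOSETS_def)
  have other: "?f C = 0" if C: "C \<in> lcosets\<^bsub>G\<^esub> \<Gamma>" "C \<noteq> ?C0" for C
  proof -
    obtain a where a: "a \<in> carrier G" "C = a <#\<^bsub>G\<^esub> \<Gamma>" using C(1) by (auto simp: LCOSETS_def)
    have "(SOME x. x \<in> C) \<notin> ?C0"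
      using ne[OF C(1)] C(2) a assms l_repr_independence by metis
    thus ?thesis by (simp add: Let_def)
  qed
  have "(\<Sum>\<^sub>\<infinity>C\<in>lcosets\<^bsub>G\<^esub> \<Gamma>. ?f C) = (\<Sum>\<^sub>\<infinity>C\<in>{?C0}. ?f C)"
    by (rule infsum_cong_neutral) (use C0 other in auto)
  also have "\<dots> = ?f ?C0" by simp
  finally have sum: "(\<Sum>\<^sub>\<infinity>C\<in>lcosets\<^bsub>G\<^esub> \<Gamma>. ?f C) = ?f ?C0" .
  define x where "x = (SOME x. x \<in> ?C0)"
  have x: "x \<in> ?C0" unfolding x_def by (rule ne[OF C0])
  then obtain h where h: "h \<in> \<Gamma>" "x = \<sigma>\<^sub>1 \<otimes>\<^bsub>G\<^esub> h" by (auto simp: l_coset_def)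
  have sub: "\<sigma>\<^sub>1 <#\<^bsub>G\<^esub> \<Gamma> #>\<^bsub>G\<^esub> \<sigma>\<^sub>2 \<subseteq> carrier G"
    using assms by (auto simp: l_coset_def r_coset_def)
  have "inv\<^bsub>G\<^esub> x \<otimes>\<^bsub>G\<^esub> \<theta> \<in> \<Gamma> #>\<^bsub>G\<^esub> \<sigma>\<^sub>2 \<longleftrightarrow> \<theta> \<in> \<sigma>\<^sub>1 <#\<^bsub>G\<^esub> \<Gamma> #>\<^bsub>G\<^esub> \<sigma>\<^sub>2" if \<theta>: "\<theta> \<in> carrier G"
  proof
    assume "inv\<^bsub>G\<^esub> x \<otimes>\<^bsub>G\<^esub> \<theta> \<in> \<Gamma> #>\<^bsub>G\<^esub> \<sigma>\<^sub>2"
    then obtain k where k: "k \<in> \<Gamma>" "inv\<^bsub>G\<^esub> x \<otimes>\<^bsub>G\<^esub> \<theta> = k \<otimes>\<^bsub>G\<^esub> \<sigma>\<^sub>2" by (auto simp: r_coset_def)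
    hence "\<theta> = x \<otimes>\<^bsub>G\<^esub> (k \<otimes>\<^bsub>G\<^esub> \<sigma>\<^sub>2)"
      using h assms \<theta> by (metis \<Gamma>.mem_carrier inv_solve_left m_closed)
    hence "\<theta> = (\<sigma>\<^sub>1 \<otimes>\<^bsub>G\<^esub> (h \<otimes>\<^bsub>G\<^esub> k)) \<otimes>\<^bsub>G\<^esub> \<sigma>\<^sub>2"
      using h k assms by (simp add: m_assoc)
    thus "\<theta> \<in> \<sigma>\<^sub>1 <#\<^bsub>G\<^esub> \<Gamma> #>\<^bsub>G\<^esub> \<sigma>\<^sub>2"
      using h k \<Gamma>.m_closed by (fastforce simp: l_coset_def r_coset_def)
  next
    assume "\<theta> \<in> \<sigma>\<^sub>1 <#\<^bsub>G\<^esub> \<Gamma> #>\<^bsub>G\<^esub> \<sigma>\<^sub>2"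
    then obtain k where k: "k \<in> \<Gamma>" "\<theta> = (\<sigma>\<^sub>1 \<otimes>\<^bsub>G\<^esub> k) \<otimes>\<^bsub>G\<^esub> \<sigma>\<^sub>2"
      by (auto simp: l_coset_def r_coset_def)
    have "\<theta> = x \<otimes>\<^bsub>G\<^esub> ((inv\<^bsub>G\<^esub> h \<otimes>\<^bsub>G\<^esub> k) \<otimes>\<^bsub>G\<^esub> \<sigma>\<^sub>2)"
      using h k assms by (simp add: m_assoc inv_solve_left' flip: m_assoc[of h "inv\<^bsub>G\<^esub> h"])
    hence "inv\<^bsub>G\<^esub> x \<otimes>\<^bsub>G\<^esub> \<theta> = (inv\<^bsub>G\<^esub> h \<otimes>\<^bsub>G\<^esub> k) \<otimes>\<^bsub>G\<^esub> \<sigma>\<^sub>2"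
      using h k assms by (subst inv_solve_left') auto
    thus "inv\<^bsub>G\<^esub> x \<otimes>\<^bsub>G\<^esub> \<theta> \<in> \<Gamma> #>\<^bsub>G\<^esub> \<sigma>\<^sub>2"
      using h k by (auto simp: r_coset_def)
  qed
  thus "coset_mult G \<Gamma> (indicator ?C0) (indicator (\<Gamma> #>\<^bsub>G\<^esub> \<sigma>\<^sub>2)) \<theta>
       = indicator (\<sigma>\<^sub>1 <#\<^bsub>G\<^esub> \<Gamma> #>\<^bsub>G\<^esub> \<sigma>\<^sub>2) \<theta>"
    using x sub unfolding coset_mult_def sum by (auto simp: Let_def x_def indicator_def)
qed

definition coset_star :: "('g, 'm) monoid_scheme \<Rightarrow> ('g \<Rightarrow> complex) \<Rightarrow> 'g \<Rightarrow> complex" where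
  "coset_star G a = (\<lambda>\<theta>. if \<theta> \<in> carrier G then cnj (a (inv\<^bsub>G\<^esub> \<theta>)) else 0)"

definition linear_op_valued :: "'h::complex_inner set \<Rightarrow> ('g \<Rightarrow> complex) set \<Rightarrow>
    (('g \<Rightarrow> complex) \<Rightarrow> 'h \<Rightarrow> 'h) \<Rightarrow> bool" where
  "linear_op_valued K D V \<longleftrightarrow>
     (\<forall>a\<in>D. \<forall>b\<in>D. \<forall>f\<in>K. V (\<lambda>x. a x + b x) f = V a f + V b f) \<and>
     (\<forall>c. \<forall>a\<in>D. \<forall>f\<in>K. V (\<lambda>x. c * a x) f = c *\<^sub>C V a f)"

definition Hecke_rep :: "('g, 'm) monoid_scheme \<Rightarrow> 'g set \<Rightarrow>
    (('g \<Rightarrow> complex) \<Rightarrow> ('g, 'l::complex_inner) ell2 \<Rightarrow> ('g, 'l) ell2) \<Rightarrow> bool" where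
  "Hecke_rep G \<Gamma> V \<longleftrightarrow>
     (\<forall>a\<in>Hecke G \<Gamma>. V a \<in> R_vN_tensor G (carrier G)) \<and>
     linear_op_valued (ell2_on (carrier G)) (Hecke G \<Gamma>) V \<and>
     (\<forall>a\<in>Hecke G \<Gamma>. \<forall>b\<in>Hecke G \<Gamma>. \<forall>f\<in>ell2_on (carrier G). V (coset_mult G \<Gamma> a b) f = V a (V b f)) \<and>
     (\<forall>a\<in>Hecke G \<Gamma>. is_adjoint (ell2_on (carrier G)) (V a) (V (coset_star G a)))"

text \<open>\<open>V(k\<^sub>1)\<^sup>* V(k\<^sub>2) = V(k\<^sub>1\<^sup>* k\<^sub>2)\<close> for \<open>k\<^sub>1, k\<^sub>2 \<in> \<K>\<^sub>0\<close>.\<close>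

definition op_system_rep :: "('g, 'm) monoid_scheme \<Rightarrow> 'g set \<Rightarrow>
    (('g \<Rightarrow> complex) \<Rightarrow> ('g, 'l::complex_inner) ell2 \<Rightarrow> ('g, 'l) ell2) \<Rightarrow> bool" where
  "op_system_rep G \<Gamma> V \<longleftrightarrow>
     (\<forall>a\<in>K0K0 G \<Gamma>. V a \<in> R_vN_tensor G (carrier G)) \<and>
     linear_op_valued (ell2_on (carrier G)) (K0K0 G \<Gamma>) V \<and>
     (\<forall>k\<^sub>1\<in>K0 G \<Gamma>. \<forall>k\<^sub>2\<in>K0 G \<Gamma>. \<exists>W. is_adjoint (ell2_on (carrier G)) (V k\<^sub>1) W \<and>
        (\<forall>f\<in>ell2_on (carrier G). V (coset_mult G \<Gamma> (coset_star G k\<^sub>1) k\<^sub>2) f = W (V k\<^sub>2 f)))"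

end

theory Submission
  imports Defs
begin

text \<open>Write \<open>t\<^sub>\<theta>(q) = P\<^sub>L \<pi>(\<theta>) q P\<^sub>L\<close> for a bounded \<open>q\<close> commuting with \<open>\<pi>(G)\<close>; \<open>q = 1\<close> gives the coefficients of
  \<open>S\<close>, and \<open>q = p\<close> those of the compressed series. Since \<open>\<pi>(\<gamma>)\<close> translates \<open>\<ell>\<^sup>2(\<Gamma>) \<otimes> L\<close>, the sum
  \<open>\<Sum>\<^sub>h \<pi>(h) P\<^sub>L \<pi>(h)\<inverse>\<close> over any coset \<open>w\<Gamma>\<close> is \<open>1\<close>. This gives the formulas for \<open>p\<close>, and also
  \<open>\<Sum>\<^sub>\<theta> \<rho>(\<theta>\<inverse>) \<otimes> t\<^sub>\<theta>(q)\<close> over \<open>\<sigma>\<^sub>1\<Gamma>\<close> times \<open>\<Sum>\<^sub>\<theta> \<rho>(\<theta>\<inverse>) \<otimes> t\<^sub>\<theta>(r)\<close> over \<open>\<Gamma>\<sigma>\<^sub>2\<close> equals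
  \<open>\<Sum>\<^sub>\<theta> \<rho>(\<theta>\<inverse>) \<otimes> t\<^sub>\<theta>(q r)\<close> over \<open>\<sigma>\<^sub>1\<Gamma>\<sigma>\<^sub>2\<close>, from which every product follows by bilinearity.

  All these series are bounded operators: on a piece \<open>z\<Gamma> \<inter> \<Gamma>z\<close> the series is a direct sum of copies of a
  compression of \<open>\<pi>(z) q\<close>, by almost normality \<open>\<sigma>\<Gamma>\<close> and \<open>\<Gamma>\<sigma>\<close> are finite unions of pieces, and
  \<open>\<sigma>\<^sub>1\<Gamma>\<sigma>\<^sub>2\<close> is covered by the product formula. They commute with left translations, hence lie in
  \<open>R(G) \<otimes> B(L)\<close> by the commutation theorem.\<close>

section \<open>Square-summable families and bounded operators\<close>

text \<open>The obstacle is that \<open>\<pi>\<close> acts only on the square-summable families over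
  \<Gamma>, while the series act over all of G, and a formal product requires factors and result to
  lie in \<open>formal_space\<close> with convergent coefficient sums. So boundedness has to precede
  algebra. Once a series is realised by a left-equivariant operator, composition supplies the
  convergence, and since coefficients determine the operator, each algebraic law becomes a
  comparison of coefficients. That comparison is one computation: the coefficient at k of a product
  is the sum over h of P_L \<pi>(k^-1 h) q P_L \<pi>(h^-1) r P_L. Moving q past \<pi>(h) leaves P_L
  \<pi>(k^-1) q, then the sum of \<pi>(h) P_L \<pi>(h)^-1, then r P_L. Two independent intertwiners
  q and r treat S and its compression together. Finally p is itself the series of the coset \<Gamma>
  with q = p, because \<pi>(\<Gamma>) consists of left translations. As \<Gamma> is the unit of
  coset multiplication, the products of p with S on either side are instances of the same
  formula.\<close>

lemma cinner_diff_left: "cinner (x - y) z = cinner x z - cinner y (z :: 'a::complex_inner)"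
  by (metis add_diff_cancel_right' cinner_add_left diff_add_cancel)

lemma bounded_linear_scaleC: "bounded_linear (\<lambda>x :: 'a::complex_inner. c *\<^sub>C x)"
proof (rule bounded_linear_intro[where K = "cmod c"])
  fix r x
  show "c *\<^sub>C (r *\<^sub>R x) = r *\<^sub>R (c *\<^sub>C (x :: 'a))"
    by (simp add: scaleR_scaleC scaleC_scaleC mult.commute)
qed (auto simp: scaleC_add_right mult.commute)

lemma bounded_linear_cinner_left: "bounded_linear (\<lambda>x. cinner x (y :: 'a::complex_inner))"
proof -
  have eq: "(\<lambda>x. cinner x y) = (\<lambda>x. of_real (inner x y) + \<i> * of_real (inner x (\<i> *\<^sub>C y)))"
    by (rule ext) (simp add: cinner_inner[of _ y] Complex_eq)
  show ?thesis
    unfolding eq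
    by (intro bounded_linear_add bounded_linear_compose[OF bounded_linear_mult_right]
        bounded_linear_compose[OF bounded_linear_of_real] bounded_linear_inner_left)
qed

lemma bounded_linear_cinner_right: "bounded_linear (cinner (x :: 'a::complex_inner))"
proof -
  have eq: "cinner x = (\<lambda>y. cnj (cinner y x))"
    by (rule ext) (rule cinner_commute)
  show ?thesis
    unfolding eq by (intro bounded_linear_compose[OF bounded_linear_cnj] bounded_linear_cinner_left)
qed

lemma bounded_linear_ell2_apply: "bounded_linear (\<lambda>f. ell2_apply f x)"
  by (rule bounded_linear_intro[where K = 1]) (auto intro: ell2_apply_le)

lemma cinner_single_right: "cinner f (single x l) = cinner (ell2_apply f x) l"
proof -
  have "cinner f (single x l) = (\<Sum>\<^sub>\<infinity>i\<in>{x}. cinner (ell2_apply f i) l)"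
    unfolding cinner_ell2_def by (rule infsum_cong_neutral) (auto simp: ell2_apply_single)
  thus ?thesis by simp
qed

lemma single_in_ell2_on [simp]: "x \<in> X \<Longrightarrow> single x l \<in> ell2_on X"
  by (auto simp: ell2_on_def ell2_apply_single)

lemma ell2_on_add [simp]: "f \<in> ell2_on X \<Longrightarrow> g \<in> ell2_on X \<Longrightarrow> f + g \<in> ell2_on X"
  and ell2_on_scaleC [simp]: "f \<in> ell2_on X \<Longrightarrow> c *\<^sub>C f \<in> ell2_on X"
  and ell2_on_zero [simp]: "0 \<in> ell2_on X"
  by (auto simp: ell2_on_def)

lemma single_add: "single x (l + l') = single x l + single x l'"
  and single_scaleC: "single x (c *\<^sub>C l) = c *\<^sub>C single x l"
  and single_zero [simp]: "single x 0 = 0"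
  by (rule ell2_eqI, simp add: ell2_apply_single)+

text \<open>Change of variable along the injection \<open>t\<close>. The exact value matters besides
  the bound: in \<open>piece_operator\<close> the images of the various \<open>t\<close> are
  disjoint cosets, and their contributions add up to at most the squared norm of
  \<open>f\<close>.\<close>

lemma norm_ell2_square_translate:
  assumes "inj_on t X"
    and "\<And>x. ell2_apply g x = (if x \<in> X then ell2_apply f (t x) else 0)"
  shows "(norm g)\<^sup>2 = (\<Sum>\<^sub>\<infinity>y\<in>t ` X. (norm (ell2_apply f y))\<^sup>2)"
proof -
  have "(norm g)\<^sup>2 = (\<Sum>\<^sub>\<infinity>x\<in>X. (norm (ell2_apply f (t x)))\<^sup>2)"
    unfolding ell2_norm_square by (rule infsum_cong_neutral) (auto simp: assms(2))
  also have "\<dots> = (\<Sum>\<^sub>\<infinity>y\<in>t ` X. (norm (ell2_apply f y))\<^sup>2)"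
    using infsum_reindex[OF assms(1), of "\<lambda>y. (norm (ell2_apply f y))\<^sup>2"] by (simp add: o_def)
  finally show ?thesis .
qed

lemma ell2_summable_on: "(\<lambda>x. (norm (ell2_apply f x))\<^sup>2) summable_on A"
  by (rule summable_on_subset_banach[OF ell2_summable]) simp

lemma infsum_ell2_le_norm: "(\<Sum>\<^sub>\<infinity>x\<in>A. (norm (ell2_apply f x))\<^sup>2) \<le> (norm f)\<^sup>2"
  unfolding ell2_norm_square
  by (rule infsum_mono_neutral) (auto intro: ell2_summable_on)

lemma norm_ell2_translate_le:
  assumes "inj_on t X"
    and "\<And>x. ell2_apply g x = (if x \<in> X then ell2_apply f (t x) else 0)"
  shows "norm g \<le> norm f"
proof (rule power2_le_imp_le)
  show "(norm g)\<^sup>2 \<le> (norm f)\<^sup>2"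
    unfolding norm_ell2_square_translate[OF assms] by (rule infsum_ell2_le_norm)
qed simp

lemma norm_single [simp]: "norm (single x l) = norm l"
proof -
  have "(norm (single x l))\<^sup>2 = (\<Sum>\<^sub>\<infinity>i\<in>{x}. (norm l)\<^sup>2)"
    unfolding ell2_norm_square by (rule infsum_cong_neutral) (auto simp: ell2_apply_single)
  thus ?thesis by simp
qed

text \<open>By Pythagoras the squared distance from \<open>f\<close> to a finite partial sum is the
  remaining part of its squared norm, which tends to 0. Convergence is in norm, so bounded operators
  may be applied termwise.\<close>

lemma has_sum_single:
  assumes f: "f \<in> ell2_on X"
  shows "((\<lambda>x. single x (ell2_apply f x)) has_sum f) X"
proof -
  let ?n = "\<lambda>x. (norm (ell2_apply f x))\<^sup>2"
  have n: "(?n has_sum (norm f)\<^sup>2) X"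
  proof -
    have "(?n has_sum (norm f)\<^sup>2) UNIV"
      unfolding ell2_norm_square by (intro has_sum_infsum ell2_summable)
    thus ?thesis
      using f by (elim has_sum_cong_neutral[THEN iffD1, rotated -1]) (auto simp: ell2_on_def)
  qed
  have dist: "(norm ((\<Sum>x\<in>F. single x (ell2_apply f x)) - f))\<^sup>2 = (norm f)\<^sup>2 - sum ?n F"
    if F: "finite F" for F
  proof -
    define s where "s = (\<Sum>x\<in>F. single x (ell2_apply f x))"
    have s: "ell2_apply s i = (if i \<in> F then ell2_apply f i else 0)" for i
    proof -
      have "ell2_apply s i = (\<Sum>x\<in>F. ell2_apply (single x (ell2_apply f x)) i)"
        unfolding s_def by (rule linear_sum[OF bounded_linear.linear[OF bounded_linear_ell2_apply]])
      thus ?thesis using F by (simp add: ell2_apply_single)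
    qed
    have "((\<lambda>i. if i \<in> F then - ?n i else 0) has_sum (\<Sum>i\<in>F. - ?n i)) UNIV"
      using F by (intro has_sum_finite_neutralI) auto
    moreover have "(?n has_sum (norm f)\<^sup>2) UNIV"
      unfolding ell2_norm_square by (intro has_sum_infsum ell2_summable)
    ultimately have "((\<lambda>i. ?n i + (if i \<in> F then - ?n i else 0)) has_sum
        ((norm f)\<^sup>2 + (\<Sum>i\<in>F. - ?n i))) UNIV"
      by (intro has_sum_add)
    moreover have "(\<lambda>i. ?n i + (if i \<in> F then - ?n i else 0)) = (\<lambda>i. (norm (ell2_apply (s - f) i))\<^sup>2)"
      by (auto simp: s)
    ultimately show ?thesis
      unfolding s_def[symmetric] ell2_norm_square[of "s - f"] by (simp add: infsumI sum_negf)
  qed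
  have "((\<lambda>F. (norm f)\<^sup>2 - sum ?n F) \<longlongrightarrow> (norm f)\<^sup>2 - (norm f)\<^sup>2) (finite_subsets_at_top X)"
    using n unfolding has_sum_def by (intro tendsto_intros)
  hence "((\<lambda>F. sqrt ((norm f)\<^sup>2 - sum ?n F)) \<longlongrightarrow> 0) (finite_subsets_at_top X)"
    using tendsto_real_sqrt by fastforce
  moreover have "\<forall>\<^sub>F F in finite_subsets_at_top X. sqrt ((norm f)\<^sup>2 - sum ?n F) =
      norm ((\<Sum>x\<in>F. single x (ell2_apply f x)) - f)"
    by (rule eventually_finite_subsets_at_top_weakI) (simp add: dist[symmetric])
  ultimately have "((\<lambda>F. norm ((\<Sum>x\<in>F. single x (ell2_apply f x)) - f)) \<longlongrightarrow> 0)
      (finite_subsets_at_top X)"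
    by (rule Lim_transform_eventually)
  thus ?thesis
    unfolding has_sum_def by (subst Lim_null) (rule tendsto_norm_zero_cancel)
qed

lemma has_sum_cinner:
  assumes "f \<in> ell2_on X" "g \<in> ell2_on X"
  shows "((\<lambda>x. cinner (ell2_apply f x) (ell2_apply g x)) has_sum cinner f g) X"
proof -
  have "((\<lambda>x. cinner f (single x (ell2_apply g x))) has_sum cinner f g) X"
    by (intro has_sum_bounded_linear[OF bounded_linear_cinner_right] has_sum_single assms)
  thus ?thesis by (simp add: cinner_single_right)
qed

text \<open>The projection of the whole type onto \<open>ell2_on X\<close>. An operator in
  \<open>bop (ell2_on X)\<close> has arbitrary values elsewhere; composing it with this projection
  gives a globally bounded linear map.\<close>

definition ell2_restrict :: "'i set \<Rightarrow> ('i, 'l::complex_inner) ell2 \<Rightarrow> ('i, 'l) ell2" where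
  "ell2_restrict X f = Abs_ell2 (\<lambda>x. if x \<in> X then ell2_apply f x else 0)"

lemma ell2_apply_restrict:
  "ell2_apply (ell2_restrict X f) x = (if x \<in> X then ell2_apply f x else 0)"
  unfolding ell2_restrict_def
  by (subst Abs_ell2_apply) (use summable_on_restrict_translate[of "\<lambda>x. x" X f] in auto)

lemma ell2_restrict_in [simp]: "ell2_restrict X f \<in> ell2_on X"
  by (simp add: ell2_on_def ell2_apply_restrict)

lemma ell2_restrict_id: "f \<in> ell2_on X \<Longrightarrow> ell2_restrict X f = f"
  by (rule ell2_eqI) (auto simp: ell2_on_def ell2_apply_restrict)

lemma norm_ell2_restrict: "norm (ell2_restrict X f) \<le> norm f"
  by (rule norm_ell2_translate_le[where t = "\<lambda>x. x" and X = X]) (auto simp: ell2_apply_restrict)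

section \<open>Bounded operators on \<open>ell2_on X\<close>, determined by their values on the
  vectors \<open>single x l\<close>\<close>

lemma bopI:
  assumes "\<And>f. f \<in> K \<Longrightarrow> T f \<in> K"
    and "\<And>f g. f \<in> K \<Longrightarrow> g \<in> K \<Longrightarrow> T (f + g) = T f + T g"
    and "\<And>c f. f \<in> K \<Longrightarrow> T (c *\<^sub>C f) = c *\<^sub>C T f"
    and "\<And>f. f \<in> K \<Longrightarrow> norm (T f) \<le> C * norm f"
  shows "T \<in> bop K"
  using assms unfolding bop_def by blast

lemma bop_in: "T \<in> bop K \<Longrightarrow> f \<in> K \<Longrightarrow> T f \<in> K"
  and bop_add: "T \<in> bop K \<Longrightarrow> f \<in> K \<Longrightarrow> g \<in> K \<Longrightarrow> T (f + g) = T f + T g"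
  and bop_scaleC: "T \<in> bop K \<Longrightarrow> f \<in> K \<Longrightarrow> T (c *\<^sub>C f) = c *\<^sub>C T f"
  by (auto simp: bop_def)

lemma bop_zero: "T \<in> bop K \<Longrightarrow> 0 \<in> K \<Longrightarrow> T 0 = 0"
  using bop_scaleC[of T K 0 0] by simp

lemma bop_bound:
  assumes "T \<in> bop K"
  obtains C where "C \<ge> 0" "\<And>f. f \<in> K \<Longrightarrow> norm (T f) \<le> C * norm f"
proof -
  obtain C where C: "\<forall>f\<in>K. norm (T f) \<le> C * norm f" using assms by (auto simp: bop_def)
  \<comment> \<open>The constant in \<open>bop\<close> may be negative when \<open>K\<close>
    contains only 0, hence the absolute value.\<close>
  have "norm (T f) \<le> \<bar>C\<bar> * norm f" if "f \<in> K" for f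
    using C that by (smt (verit) mult_right_mono norm_ge_zero)
  thus ?thesis using that[of "\<bar>C\<bar>"] by auto
qed

lemma bop_id: "id \<in> bop K"
  by (rule bopI[where C = 1]) auto

lemma bop_comp:
  assumes "T \<in> bop K" "S \<in> bop K"
  shows "(\<lambda>f. T (S f)) \<in> bop K"
proof -
  obtain C where C: "C \<ge> 0" "\<And>f. f \<in> K \<Longrightarrow> norm (T f) \<le> C * norm f" using assms(1) bop_bound by blast
  obtain D where D: "D \<ge> 0" "\<And>f. f \<in> K \<Longrightarrow> norm (S f) \<le> D * norm f" using assms(2) bop_bound by blast
  show ?thesis
  proof (rule bopI)
    fix f assume "f \<in> K"
    hence "norm (T (S f)) \<le> C * (D * norm f)"
      using C D assms by (meson bop_in mult_left_mono order_trans)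
    thus "norm (T (S f)) \<le> (C * D) * norm f" by (simp add: mult.assoc)
  next
    fix f assume "f \<in> K"
    thus "T (S (f + g)) = T (S f) + T (S g)" if "g \<in> K" for g
      using that by (simp add: bop_in[OF assms(2)] bop_add[OF assms(1)] bop_add[OF assms(2)])
    show "T (S (c *\<^sub>C f)) = c *\<^sub>C T (S f)" for c using \<open>f \<in> K\<close>
      by (simp add: bop_in[OF assms(2)] bop_scaleC[OF assms(1)] bop_scaleC[OF assms(2)])
  qed (intro bop_in[OF assms(1)] bop_in[OF assms(2)])
qed

lemma bop_plus:
  assumes "T \<in> bop K" "S \<in> bop K" "\<And>f g. f \<in> K \<Longrightarrow> g \<in> K \<Longrightarrow> f + g \<in> K"
  shows "(\<lambda>f. T f + S f) \<in> bop K"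
proof -
  obtain C where C: "C \<ge> 0" "\<And>f. f \<in> K \<Longrightarrow> norm (T f) \<le> C * norm f" using assms(1) bop_bound by blast
  obtain D where D: "D \<ge> 0" "\<And>f. f \<in> K \<Longrightarrow> norm (S f) \<le> D * norm f" using assms(2) bop_bound by blast
  show ?thesis
  proof (rule bopI)
    fix f assume "f \<in> K"
    thus "norm (T f + S f) \<le> (C + D) * norm f"
      using C D norm_triangle_ineq[of "T f" "S f"] by (smt (verit) distrib_right)
  next
    fix f assume "f \<in> K"
    thus "T (f + g) + S (f + g) = T f + S f + (T g + S g)" if "g \<in> K" for g
      using that by (simp add: bop_add[OF assms(1)] bop_add[OF assms(2)])
    show "T (c *\<^sub>C f) + S (c *\<^sub>C f) = c *\<^sub>C (T f + S f)" for c using \<open>f \<in> K\<close>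
      by (simp add: scaleC_add_right bop_scaleC[OF assms(1)] bop_scaleC[OF assms(2)])
  qed (intro assms(3) bop_in[OF assms(1)] bop_in[OF assms(2)])
qed

lemma bop_scale:
  assumes "T \<in> bop K" "\<And>c f. f \<in> K \<Longrightarrow> c *\<^sub>C f \<in> K"
  shows "(\<lambda>f. c *\<^sub>C T f) \<in> bop K"
proof -
  obtain C where C: "C \<ge> 0" "\<And>f. f \<in> K \<Longrightarrow> norm (T f) \<le> C * norm f" using assms(1) bop_bound by blast
  show ?thesis
  proof (rule bopI)
    fix f assume "f \<in> K"
    thus "norm (c *\<^sub>C T f) \<le> (cmod c * C) * norm f"
      using C by (simp add: mult.assoc mult_left_mono)
  next
    fix f assume "f \<in> K"
    thus "c *\<^sub>C T (f + g) = c *\<^sub>C T f + c *\<^sub>C T g" if "g \<in> K" for g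
      using that by (simp add: bop_add[OF assms(1)] scaleC_add_right)
    show "c *\<^sub>C T (d *\<^sub>C f) = d *\<^sub>C c *\<^sub>C T f" for d using \<open>f \<in> K\<close>
      by (simp add: bop_scaleC[OF assms(1)]
          scaleC_scaleC mult.commute)
  qed (intro assms(2) bop_in[OF assms(1)])
qed

lemma bop_bounded_linear:
  fixes T :: "('i, 'l::complex_inner) ell2 \<Rightarrow> ('i, 'l) ell2"
  assumes "T \<in> bop (ell2_on X)"
  shows "bounded_linear (\<lambda>f. T (ell2_restrict X f))"
proof -
  obtain C where C: "C \<ge> 0" "\<And>f. f \<in> ell2_on X \<Longrightarrow> norm (T f) \<le> C * norm f"
    using assms bop_bound by blast
  have add: "ell2_restrict X (f + g) = ell2_restrict X f + ell2_restrict X g" for f g :: "('i, 'l) ell2"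
    by (rule ell2_eqI) (simp add: ell2_apply_restrict)
  have scale: "ell2_restrict X (c *\<^sub>C f) = c *\<^sub>C ell2_restrict X f" for c and f :: "('i, 'l) ell2"
    by (rule ell2_eqI) (simp add: ell2_apply_restrict)
  show ?thesis
  proof (rule bounded_linear_intro[where K = C])
    fix f :: "('i, 'l) ell2"
    have "norm (T (ell2_restrict X f)) \<le> C * norm (ell2_restrict X f)" using C by simp
    also have "\<dots> \<le> C * norm f" using C norm_ell2_restrict mult_left_mono by blast
    finally show "norm (T (ell2_restrict X f)) \<le> norm f * C" by (simp add: mult.commute)
  next
    fix f g :: "('i, 'l) ell2"
    show "T (ell2_restrict X (f + g)) = T (ell2_restrict X f) + T (ell2_restrict X g)"
      by (simp only: add bop_add[OF assms] ell2_restrict_in)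
  next
    fix f :: "('i, 'l) ell2" and r
    show "T (ell2_restrict X (r *\<^sub>R f)) = r *\<^sub>R T (ell2_restrict X f)"
      by (simp only: scaleR_scaleC scale bop_scaleC[OF assms] ell2_restrict_in)
  qed
qed

lemma bop_has_sum:
  assumes "T \<in> bop (ell2_on X)" "\<And>i. i \<in> A \<Longrightarrow> u i \<in> ell2_on X" "s \<in> ell2_on X" "(u has_sum s) A"
  shows "((\<lambda>i. T (u i)) has_sum T s) A"
proof -
  have "((\<lambda>i. T (ell2_restrict X (u i))) has_sum T (ell2_restrict X s)) A"
    using has_sum_bounded_linear[OF bop_bounded_linear[OF assms(1)] assms(4)] .
  moreover have "((\<lambda>i. T (ell2_restrict X (u i))) has_sum T s) A \<longleftrightarrow> ((\<lambda>i. T (u i)) has_sum T s) A"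
    by (rule has_sum_cong) (simp add: assms(2) ell2_restrict_id)
  ultimately show ?thesis
    by (simp add: assms(3) ell2_restrict_id)
qed

lemma bop_expand:
  assumes "T \<in> bop (ell2_on X)" "f \<in> ell2_on X"
  shows "((\<lambda>x. T (single x (ell2_apply f x))) has_sum T f) X"
  by (rule bop_has_sum[OF assms(1)]) (use assms has_sum_single in auto)

lemma bop_expand_coord:
  assumes "T \<in> bop (ell2_on X)" "f \<in> ell2_on X"
  shows "((\<lambda>x. ell2_apply (T (single x (ell2_apply f x))) y) has_sum ell2_apply (T f) y) X"
  by (rule has_sum_bounded_linear[OF bounded_linear_ell2_apply bop_expand[OF assms]])

lemma bop_eqI:
  assumes "S \<in> bop (ell2_on X)" "T \<in> bop (ell2_on X)"
    and "\<And>x l. x \<in> X \<Longrightarrow> S (single x l) = T (single x l)" and "f \<in> ell2_on X"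
  shows "S f = T f"
proof -
  have "((\<lambda>x. T (single x (ell2_apply f x))) has_sum S f) X"
    using bop_expand[OF assms(1,4)] by (rule has_sum_cong[THEN iffD1, rotated]) (rule assms(3))
  thus ?thesis using bop_expand[OF assms(2,4)] has_sum_unique by blast
qed

text \<open>The amplification of \<open>B\<close> to families. Source and target types may differ so
  that vectors of L can be exchanged for scalars.\<close>

definition ell2_map :: "('a::complex_inner \<Rightarrow> 'b::complex_inner) \<Rightarrow> ('i, 'a) ell2 \<Rightarrow> ('i, 'b) ell2" where
  "ell2_map B f = Abs_ell2 (\<lambda>x. B (ell2_apply f x))"

lemma ell2_map_apply_norm:
  fixes B :: "'a::complex_inner \<Rightarrow> 'b::complex_inner"
  assumes "\<And>v. norm (B v) \<le> C * norm v"
  shows "ell2_apply (ell2_map B f) x = B (ell2_apply f x)"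
    and "norm (ell2_map B f) \<le> C * norm f"
proof -
  \<comment> \<open>A negative \<open>C\<close> satisfies the hypothesis only if the space is zero;
    that case is separated at the end.\<close>
  have C: "C \<ge> 0" if "norm (v :: 'a) \<noteq> 0" for v
  proof (rule ccontr)
    assume "\<not> C \<ge> 0"
    hence "C * norm v < 0" using that by (intro mult_neg_pos) auto
    thus False using assms[of v] norm_ge_zero[of "B v"] by linarith
  qed
  have sq: "(norm (B v))\<^sup>2 \<le> C\<^sup>2 * (norm v)\<^sup>2" for v
    using power_mono[OF assms, of v 2] by (simp add: power_mult_distrib)
  have summ: "(\<lambda>x. (norm (B (ell2_apply f x)))\<^sup>2) summable_on UNIV"
    by (rule summable_on_comparison_test[where f = "\<lambda>x. C\<^sup>2 * (norm (ell2_apply f x))\<^sup>2"])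
      (auto intro: sq summable_on_cmult_right ell2_summable)
  thus app: "ell2_apply (ell2_map B f) x = B (ell2_apply f x)" for x
    by (simp add: ell2_map_def Abs_ell2_apply)
  have "(norm (ell2_map B f))\<^sup>2 \<le> (\<Sum>\<^sub>\<infinity>x. C\<^sup>2 * (norm (ell2_apply f x))\<^sup>2)"
    unfolding ell2_norm_square app
    by (rule infsum_mono) (auto intro: summ sq summable_on_cmult_right ell2_summable)
  also have "\<dots> = (C * norm f)\<^sup>2"
    by (simp add: infsum_cmult_right' power_mult_distrib ell2_norm_square)
  finally have *: "(norm (ell2_map B f))\<^sup>2 \<le> (C * norm f)\<^sup>2" .
  show "norm (ell2_map B f) \<le> C * norm f"
  proof (cases "\<exists>v :: 'a. norm v \<noteq> 0")
    case True
    thus ?thesis using * C by (meson mult_nonneg_nonneg norm_ge_zero power2_le_imp_le)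
  next
    case False
    hence "norm (ell2_apply f x) = 0" for x by blast
    hence "f = 0" by (intro ell2_eqI) simp
    thus ?thesis using * by simp
  qed
qed

lemma ell2_on_eqI:
  assumes "f \<in> ell2_on X" "g \<in> ell2_on X" "\<And>x. x \<in> X \<Longrightarrow> ell2_apply f x = ell2_apply g x"
  shows "f = g"
proof (rule ell2_eqI)
  fix x show "ell2_apply f x = ell2_apply g x"
    using assms by (cases "x \<in> X") (simp_all add: ell2_on_def)
qed

section \<open>Left-equivariant operators\<close>

text \<open>\<open>X\<close> commutes with the left translations \<open>\<lambda>(g) \<otimes> 1\<close>, expressed on the vectors \<open>\<delta>\<^sub>x \<otimes> l\<close>.\<close>

definition left_equivariant :: "('g, 'm) monoid_scheme \<Rightarrow> 'g set \<Rightarrow>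
    (('g, 'l::complex_inner) ell2 \<Rightarrow> ('g, 'l) ell2) \<Rightarrow> bool" where
  "left_equivariant G K X \<longleftrightarrow> X \<in> bop (ell2_on K) \<and>
     (\<forall>x\<in>K. \<forall>y\<in>K. \<forall>l. ell2_apply (X (single x l)) y = op_coeffs G X (inv\<^bsub>G\<^esub> x \<otimes>\<^bsub>G\<^esub> y) l)"

lemma left_equivariant_bop: "left_equivariant G K X \<Longrightarrow> X \<in> bop (ell2_on K)"
  by (simp add: left_equivariant_def)

text \<open>The subgroup is kept general because the theory is applied twice: to \<Gamma>, where
  \<open>p\<close> lives, and to the whole group, where the series live.\<close>

locale group_subgroup = group G + subgroup K G for G (structure) and K
begin

lemma one_K: "\<one> \<in> K"
  and inv_K: "x \<in> K \<Longrightarrow> inv x \<in> K"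
  and K_carrier: "x \<in> K \<Longrightarrow> x \<in> carrier G"
  by auto

lemma left_equivariantD:
  "left_equivariant G K X \<Longrightarrow> x \<in> K \<Longrightarrow> y \<in> K \<Longrightarrow>
    ell2_apply (X (single x l)) y = op_coeffs G X (inv x \<otimes> y) l"
  by (simp add: left_equivariant_def)

lemma left_equivariant_expand:
  assumes "left_equivariant G K X" "f \<in> ell2_on K" "y \<in> K"
  shows "((\<lambda>x. op_coeffs G X (inv x \<otimes> y) (ell2_apply f x)) has_sum ell2_apply (X f) y) K"
  using bop_expand_coord[OF left_equivariant_bop[OF assms(1)] assms(2), of y]
  by (rule has_sum_cong[THEN iffD1, rotated]) (simp add: left_equivariantD assms)

lemma left_equivariant_eqI:
  assumes "left_equivariant G K X" "left_equivariant G K Y"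
    and "\<And>g l. g \<in> K \<Longrightarrow> op_coeffs G X g l = op_coeffs G Y g l" and "f \<in> ell2_on K"
  shows "X f = Y f"
proof (rule bop_eqI[OF assms(1,2)[THEN left_equivariant_bop] _ assms(4)])
  fix x l assume x: "x \<in> K"
  show "X (single x l) = Y (single x l)"
  proof (rule ell2_on_eqI[where X = K])
    show "X (single x l) \<in> ell2_on K" "Y (single x l) \<in> ell2_on K"
      using x by (auto intro: bop_in[OF left_equivariant_bop] assms)
    fix y assume y: "y \<in> K"
    show "ell2_apply (X (single x l)) y = ell2_apply (Y (single x l)) y"
      using x y by (simp add: left_equivariantD[OF assms(1)] left_equivariantD[OF assms(2)] assms(3))
  qed
qed

text \<open>Expanding Y(\<delta>_e \<otimes> l) in coordinates produces exactly the coefficient sum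
  required by \<open>is_product\<close>; boundedness of \<open>X\<close> gives its
  convergence.\<close>

lemma op_coeffs_comp_has_sum:
  assumes "left_equivariant G K X" "left_equivariant G K Y" "k \<in> K"
  shows "((\<lambda>h. op_coeffs G X (inv h \<otimes> k) (op_coeffs G Y h l)) has_sum
    op_coeffs G (\<lambda>f. X (Y f)) k l) K"
  using left_equivariant_expand[OF assms(1) bop_in[OF left_equivariant_bop[OF assms(2)]
      single_in_ell2_on[OF one_K, of l]] assms(3)]
  by (simp add: op_coeffs_def)

lemma left_equivariant_comp:
  assumes "left_equivariant G K X" "left_equivariant G K Y"
  shows "left_equivariant G K (\<lambda>f. X (Y f))"
  unfolding left_equivariant_def
proof (intro conjI ballI allI)
  show "(\<lambda>f. X (Y f)) \<in> bop (ell2_on K)"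
    using assms left_equivariant_bop by (blast intro: bop_comp)
  fix x y l assume xy: "x \<in> K" "y \<in> K"
  have "((\<lambda>h. op_coeffs G X (inv h \<otimes> y) (op_coeffs G Y (inv x \<otimes> h) l)) has_sum
      ell2_apply (X (Y (single x l))) y) K"
    using left_equivariant_expand[OF assms(1) bop_in[OF left_equivariant_bop[OF assms(2)]
        single_in_ell2_on[OF xy(1), of l]] xy(2)]
    by (rule has_sum_cong[THEN iffD1, rotated]) (simp add: left_equivariantD assms xy)
  moreover have "((\<lambda>h. op_coeffs G X (inv h \<otimes> y) (op_coeffs G Y (inv x \<otimes> h) l)) has_sum
      op_coeffs G (\<lambda>f. X (Y f)) (inv x \<otimes> y) l) K"
  \<comment> \<open>Translating the summation variable by x removes x from the coefficient of
    \<open>Y\<close> and yields the coefficient sum at x^-1 y.\<close>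
  proof (rule has_sum_reindex_bij_witness[THEN iffD1, rotated -1])
    show "((\<lambda>h. op_coeffs G X (inv h \<otimes> (inv x \<otimes> y)) (op_coeffs G Y h l)) has_sum
        op_coeffs G (\<lambda>f. X (Y f)) (inv x \<otimes> y) l) K"
      by (rule op_coeffs_comp_has_sum[OF assms]) (simp add: xy)
    fix h assume h: "h \<in> K"
    have "inv (x \<otimes> h) \<otimes> y = inv h \<otimes> (inv x \<otimes> y)" "inv x \<otimes> (x \<otimes> h) = h" "x \<otimes> (inv x \<otimes> h) = h"
      using xy h by (simp_all add: m_assoc inv_mult_group flip: m_assoc)
    thus "op_coeffs G X (inv (x \<otimes> h) \<otimes> y) (op_coeffs G Y (inv x \<otimes> (x \<otimes> h)) l) =
        op_coeffs G X (inv h \<otimes> (inv x \<otimes> y)) (op_coeffs G Y h l)"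
      and "inv x \<otimes> (x \<otimes> h) = h" "x \<otimes> (inv x \<otimes> h) = h" by simp_all
    show "x \<otimes> h \<in> K" "inv x \<otimes> h \<in> K" using xy h by (simp_all)
  qed simp
  ultimately show "ell2_apply (X (Y (single x l))) y = op_coeffs G (\<lambda>f. X (Y f)) (inv x \<otimes> y) l"
    by (rule has_sum_unique)
qed

lemma left_equivariant_plus:
  assumes "left_equivariant G K X" "left_equivariant G K Y"
  shows "left_equivariant G K (\<lambda>f. X f + Y f)"
  unfolding left_equivariant_def
proof (intro conjI ballI allI)
  show "(\<lambda>f. X f + Y f) \<in> bop (ell2_on K)"
    using assms[THEN left_equivariant_bop] by (rule bop_plus) simp
  fix x y l assume "x \<in> K" "y \<in> K"
  thus "ell2_apply (X (single x l) + Y (single x l)) y = op_coeffs G (\<lambda>f. X f + Y f) (inv x \<otimes> y) l"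
    by (simp add: assms[THEN left_equivariantD]) (simp add: op_coeffs_def)
qed

lemma left_equivariant_scaleC:
  assumes "left_equivariant G K X"
  shows "left_equivariant G K (\<lambda>f. c *\<^sub>C X f)"
  unfolding left_equivariant_def
proof (intro conjI ballI allI)
  show "(\<lambda>f. c *\<^sub>C X f) \<in> bop (ell2_on K)"
    using assms[THEN left_equivariant_bop] by (rule bop_scale) simp
  fix x y l assume "x \<in> K" "y \<in> K"
  thus "ell2_apply (c *\<^sub>C X (single x l)) y = op_coeffs G (\<lambda>f. c *\<^sub>C X f) (inv x \<otimes> y) l"
    by (simp add: left_equivariantD[OF assms]) (simp add: op_coeffs_def)
qed

lemma left_equivariant_zero: "left_equivariant G K (\<lambda>f. 0)"
  unfolding left_equivariant_def op_coeffs_def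
  by (auto intro: bopI[where C = 0])

lemma left_equivariant_id: "left_equivariant G K id"
  unfolding left_equivariant_def op_coeffs_def
proof (intro conjI ballI allI bop_id)
  fix x y l assume "x \<in> K" "y \<in> K"
  hence "y = x \<longleftrightarrow> inv x \<otimes> y = \<one>"
    by (metis K_carrier inv_K inv_equality inv_inv l_inv)
  thus "ell2_apply (id (single x l)) y = ell2_apply (id (single \<one> l)) (inv x \<otimes> y)"
    by (simp add: ell2_apply_single)
qed

text \<open>The third hypothesis is the formal star on series, where the coefficient at g^-1 is the
  adjoint of the one at g. It gives the adjoint relation for f = \<delta>_x \<otimes> l coordinate
  by coordinate, and then for all f by expansion.\<close>

lemma left_equivariant_is_adjoint:
  assumes "left_equivariant G K X" "left_equivariant G K Y"
    and "\<And>g l l'. g \<in> K \<Longrightarrow> cinner (op_coeffs G X g l) l' = cinner l (op_coeffs G Y (inv g) l')"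
  shows "is_adjoint (ell2_on K) X Y"
  unfolding is_adjoint_def
proof (intro conjI ballI)
  show X: "X \<in> bop (ell2_on K)" and Y: "Y \<in> bop (ell2_on K)"
    using assms by (auto simp: left_equivariant_bop)
  fix f g :: "('a, 'c) ell2" assume f: "f \<in> ell2_on K" and g: "g \<in> ell2_on K"
  have eq: "cinner (X (single x l)) g = cinner l (ell2_apply (Y g) x)" if x: "x \<in> K" for x l
  proof -
    have "((\<lambda>y. cinner (ell2_apply (X (single x l)) y) (ell2_apply g y)) has_sum
        cinner (X (single x l)) g) K"
      by (rule has_sum_cinner[OF bop_in[OF X] g]) (simp add: x)
    hence "((\<lambda>y. cinner l (op_coeffs G Y (inv y \<otimes> x) (ell2_apply g y))) has_sum
        cinner (X (single x l)) g) K"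
    proof (rule has_sum_cong[THEN iffD1, rotated])
      fix y assume y: "y \<in> K"
      have "inv (inv x \<otimes> y) = inv y \<otimes> x" using x y by (simp add: inv_mult_group)
      thus "cinner (ell2_apply (X (single x l)) y) (ell2_apply g y) =
          cinner l (op_coeffs G Y (inv y \<otimes> x) (ell2_apply g y))"
        using x y by (simp add: left_equivariantD[OF assms(1)] assms(3))
    qed
    moreover have "((\<lambda>y. cinner l (op_coeffs G Y (inv y \<otimes> x) (ell2_apply g y))) has_sum
        cinner l (ell2_apply (Y g) x)) K"
      by (rule has_sum_bounded_linear[OF bounded_linear_cinner_right
            left_equivariant_expand[OF assms(2) g x]])
    ultimately show ?thesis by (rule has_sum_unique)
  qed
  have "((\<lambda>x. cinner (X (single x (ell2_apply f x))) g) has_sum cinner (X f) g) K"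
    by (rule has_sum_bounded_linear[OF bounded_linear_cinner_left bop_expand[OF X f]])
  hence "((\<lambda>x. cinner (ell2_apply f x) (ell2_apply (Y g) x)) has_sum cinner (X f) g) K"
    by (rule has_sum_cong[THEN iffD1, rotated]) (rule eq)
  thus "cinner (X f) g = cinner f (Y g)"
    using has_sum_cinner[OF f bop_in[OF Y g]] has_sum_unique by blast
qed

text \<open>The commutation theorem \<open>\<lambda>(K)' = \<rho>(K)''\<close>, tensored with \<open>B('l)\<close>: both \<open>X\<close> and \<open>Y\<close> are
  convolution operators, on opposite sides.\<close>

lemma left_equivariant_commute:
  assumes X: "left_equivariant G K X" and Y: "Y \<in> bop (ell2_on K)"
    and coeff: "\<And>x y l. x \<in> K \<Longrightarrow> y \<in> K \<Longrightarrow> ell2_apply (Y (single x l)) y = c x y *\<^sub>C l"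
    and invariant: "\<And>x y g. x \<in> K \<Longrightarrow> y \<in> K \<Longrightarrow> g \<in> K \<Longrightarrow> c (x \<otimes> g) (y \<otimes> g) = c x y"
    and "f \<in> ell2_on K"
  shows "X (Y f) = Y (X f)"
proof (rule bop_eqI[where S = "\<lambda>f. X (Y f)" and T = "\<lambda>f. Y (X f)", OF _ _ _ assms(5)])
  note Xb = left_equivariant_bop[OF X]
  show "(\<lambda>f. X (Y f)) \<in> bop (ell2_on K)" "(\<lambda>f. Y (X f)) \<in> bop (ell2_on K)"
    using Xb Y by (auto intro: bop_comp)
  fix a l assume a: "a \<in> K"
  have in_K: "X (Y (single a l)) \<in> ell2_on K" "Y (X (single a l)) \<in> ell2_on K"
    using a Xb Y by (auto intro!: bop_in[OF Xb] bop_in[OF Y])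
  have "ell2_apply (X (Y (single a l))) b = ell2_apply (Y (X (single a l))) b" if b: "b \<in> K" for b
  proof -
    have "((\<lambda>x. c a x *\<^sub>C op_coeffs G X (inv x \<otimes> b) l) has_sum ell2_apply (X (Y (single a l))) b) K"
    proof (rule has_sum_cong[THEN iffD1, OF _ bop_expand_coord[OF Xb bop_in[OF Y]]])
      fix x assume x: "x \<in> K"
      have "ell2_apply (X (single x (c a x *\<^sub>C l))) b = c a x *\<^sub>C ell2_apply (X (single x l)) b"
        using x by (simp add: single_scaleC bop_scaleC[OF Xb])
      thus "ell2_apply (X (single x (ell2_apply (Y (single a l)) x))) b =
          c a x *\<^sub>C op_coeffs G X (inv x \<otimes> b) l"
        using a b x by (simp add: coeff left_equivariantD[OF X])
    qed (simp add: a)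
    moreover have "((\<lambda>x. c x b *\<^sub>C op_coeffs G X (inv a \<otimes> x) l) has_sum
        ell2_apply (Y (X (single a l))) b) K"
    proof (rule has_sum_cong[THEN iffD1, OF _ bop_expand_coord[OF Y bop_in[OF Xb]]])
      fix x assume x: "x \<in> K"
      show "ell2_apply (Y (single x (ell2_apply (X (single a l)) x))) b =
          c x b *\<^sub>C op_coeffs G X (inv a \<otimes> x) l"
        using a b x by (simp add: coeff left_equivariantD[OF X])
    qed (simp add: a)
    hence "((\<lambda>x. c a x *\<^sub>C op_coeffs G X (inv x \<otimes> b) l) has_sum
        ell2_apply (Y (X (single a l))) b) K"
    proof (rule has_sum_reindex_bij_witness[THEN iffD1, rotated -1])
      fix x assume x: "x \<in> K"
      \<comment> \<open>Replacing x by b x^-1 a matches the two sums: the arguments of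
        \<open>op_coeffs\<close> become equal, and the scalars agree by invariance of
        \<open>c\<close> under right translation by a^-1 x.\<close>
      let ?y = "b \<otimes> inv x \<otimes> a"
      show y: "?y \<in> K" "a \<otimes> inv x \<otimes> b \<in> K" using a b x by simp_all
      have cancel: "u \<otimes> (inv u \<otimes> v) = v" "inv u \<otimes> (u \<otimes> v) = v" if "u \<in> K" "v \<in> K" for u v
        using that by (simp_all add: m_assoc[symmetric])
      have inv_y: "inv ?y = inv a \<otimes> (x \<otimes> inv b)"
        using a b x by (simp add: inv_mult_group)
      have "inv (a \<otimes> inv x \<otimes> b) = inv b \<otimes> (x \<otimes> inv a)"
        using a b x by (simp add: inv_mult_group)
      thus "a \<otimes> inv ?y \<otimes> b = x" "b \<otimes> inv (a \<otimes> inv x \<otimes> b) \<otimes> a = x"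
        using a b x unfolding inv_y by (simp_all add: m_assoc cancel)
      have "inv ?y \<otimes> b = inv a \<otimes> x"
        using a b x unfolding inv_y by (simp add: m_assoc)
      moreover have "c a ?y = c x b"
      proof -
        have "c a ?y = c (a \<otimes> (inv a \<otimes> x)) (?y \<otimes> (inv a \<otimes> x))"
          using a x y by (intro invariant[symmetric]) (simp_all)
        moreover have "a \<otimes> (inv a \<otimes> x) = x" using a x by (simp add: m_assoc[symmetric])
        moreover have "?y \<otimes> (inv a \<otimes> x) = b"
          using a b x by (simp add: m_assoc cancel)
        ultimately show ?thesis by simp
      qed
      ultimately show "c a ?y *\<^sub>C op_coeffs G X (inv ?y \<otimes> b) l =
          c x b *\<^sub>C op_coeffs G X (inv a \<otimes> x) l" by simp
    qed simp
    ultimately show ?thesis by (rule has_sum_unique)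
  qed
  thus "X (Y (single a l)) = Y (X (single a l))"
    using in_K by (intro ell2_on_eqI[where X = K])
qed

section \<open>Right translations, and membership of left-equivariant operators in the generated von
  Neumann algebras\<close>

lemma ell2_apply_right_reg_K:
  "g \<in> K \<Longrightarrow> ell2_apply (right_reg G K g f) x = (if x \<in> K then ell2_apply f (x \<otimes> inv g) else 0)"
  by (rule ell2_apply_right_reg) (auto simp: K_carrier is_group)

lemma right_reg_bop: "g \<in> K \<Longrightarrow> right_reg G K g \<in> bop (ell2_on K)"
proof (rule bopI[where C = 1])
  fix f :: "('a, 'c) ell2" assume g: "g \<in> K"
  have "inj_on (\<lambda>x. x \<otimes> inv g) K"
    using g by (auto intro!: inj_onI)
  thus "norm (right_reg G K g f) \<le> 1 * norm f"
    using norm_ell2_translate_le[of "\<lambda>x. x \<otimes> inv g" K "right_reg G K g f" f] g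
    by (simp add: ell2_apply_right_reg_K)
qed (auto intro!: ell2_eqI simp: ell2_on_def ell2_apply_right_reg_K)

lemma right_reg_R_vN: "g \<in> K \<Longrightarrow> right_reg G K g \<in> R_vN G K"
  by (auto simp: R_vN_def vN_generated_def commutant_def right_reg_bop)

lemma right_reg_tensor: "g \<in> K \<Longrightarrow> is_tensor_op K (right_reg G K g) id (right_reg G K g)"
  by (auto simp: is_tensor_op_def right_reg_bop ell2_apply_right_reg_K ell2_apply_tensor
      intro!: ell2_eqI)

text \<open>Commuting with right translations makes the matrix of \<open>Y\<close> invariant under
  simultaneous right translation of both indices, as \<open>left_equivariant_commute\<close>
  asks.\<close>

lemma right_reg_invariant:
  assumes Y: "Y \<in> bop (ell2_on K)"
    and comm: "\<And>f. f \<in> ell2_on K \<Longrightarrow> Y (right_reg G K g f) = right_reg G K g (Y f)"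
    and "x \<in> K" "y \<in> K" "g \<in> K"
  shows "ell2_apply (Y (single (x \<otimes> g) l)) (y \<otimes> g) = ell2_apply (Y (single x l)) y"
proof -
  have "Y (single (x \<otimes> g) l) = right_reg G K g (Y (single x l))"
    using assms comm[of "single x l"] right_reg_single[OF is_group subgroup_axioms, of g x l] by simp
  moreover have "y \<otimes> g \<otimes> inv g = y" using assms by (simp add: m_assoc)
  ultimately show ?thesis using assms by (simp add: ell2_apply_right_reg_K)
qed

text \<open>Over the complex numbers every matrix entry of a \<open>Y\<close> in the commutant is
  automatically multiplication by a scalar, so the commutation theorem applies once invariance is
  known.\<close>

lemma left_equivariant_R_vN:
  assumes "left_equivariant G K X"
  shows "X \<in> R_vN G K"
  unfolding R_vN_def vN_generated_def commutant_def[of _ "commutant _ _"]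
proof (safe intro!: left_equivariant_bop[OF assms])
  fix Y :: "('a, complex) ell2 \<Rightarrow> ('a, complex) ell2" and f :: "('a, complex) ell2"
  assume Y: "Y \<in> commutant (ell2_on K) (right_reg G K ` K)" and f: "f \<in> ell2_on K"
  hence Yb: "Y \<in> bop (ell2_on K)" by (simp add: commutant_def)
  show "X (Y f) = Y (X f)"
  proof (rule left_equivariant_commute[OF assms Yb _ _ f])
    fix x y and l :: complex assume xy: "x \<in> K" "y \<in> K"
    have "single x l = l *\<^sub>C single x 1" by (simp add: single_scaleC[symmetric] scaleC_complex_def)
    thus "ell2_apply (Y (single x l)) y = ell2_apply (Y (single x 1)) y *\<^sub>C l"
      using xy by (simp add: bop_scaleC[OF Yb]) (simp add: scaleC_complex_def mult.commute)
  next
    fix x y g assume "x \<in> K" "y \<in> K" "g \<in> K"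
    thus "ell2_apply (Y (single (x \<otimes> g) 1)) (y \<otimes> g) = ell2_apply (Y (single x 1)) y"
      by (rule right_reg_invariant[OF Yb, rotated]) (use Y \<open>g \<in> K\<close> in \<open>auto simp: commutant_def\<close>)
  qed
qed

end

lemma rank_one_bop: "(\<lambda>v. cinner v u *\<^sub>C l) \<in> bop (UNIV :: 'l::complex_inner set)"
proof -
  obtain C where C: "\<And>v. norm (cinner v u) \<le> norm v * C"
    using bounded_linear.bounded[OF bounded_linear_cinner_left[of u]] by blast
  show ?thesis
  proof (rule bopI[where C = "C * norm l"])
    fix v :: 'l
    show "norm (cinner v u *\<^sub>C l) \<le> C * norm l * norm v"
      using mult_right_mono[OF C, of "norm l" v] by (simp add: mult_ac)
  qed (auto simp: cinner_add_left scaleC_add_left cinner_scaleC_left scaleC_scaleC)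
qed

lemma ell2_map_bop:
  fixes B :: "'l::complex_inner \<Rightarrow> 'l"
  assumes "B \<in> bop UNIV"
  shows "ell2_map B \<in> bop (ell2_on X)"
    and "ell2_apply (ell2_map B f) x = B (ell2_apply f x)"
    and "is_tensor_op X id B (ell2_map B)"
proof -
  obtain C where C: "\<And>v. norm (B v) \<le> C * norm v" using bop_bound[OF assms] by auto
  note app = ell2_map_apply_norm[where B = B, OF C]
  show "ell2_apply (ell2_map B f) x = B (ell2_apply f x)" by (rule app)
  show *: "ell2_map B \<in> bop (ell2_on X)"
    by (rule bopI[OF _ _ _ app(2)])
      (auto intro!: ell2_eqI simp: ell2_on_def app(1) bop_add[OF assms] bop_scaleC[OF assms]
        bop_zero[OF assms])
  show "is_tensor_op X id B (ell2_map B)"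
    unfolding is_tensor_op_def
    by (auto intro!: * ell2_eqI simp: app(1) ell2_apply_tensor bop_scaleC[OF assms])
qed

context group_subgroup
begin

text \<open>An element \<open>Y\<close> of the commutant commutes with the amplification of every
  bounded operator of L. The rank-one operators taking a unit vector \<open>u\<close> to
  \<open>l\<close> force each matrix entry of \<open>Y\<close> to be scalar; commuting with right
  translations makes the scalars invariant.\<close>

lemma left_equivariant_R_vN_tensor:
  fixes X :: "('a, 'l::complex_inner) ell2 \<Rightarrow> ('a, 'l) ell2"
  assumes "left_equivariant G K X"
  shows "X \<in> R_vN_tensor G K"
  unfolding R_vN_tensor_def vN_generated_def commutant_def[of _ "commutant _ _"]
proof (safe intro!: left_equivariant_bop[OF assms])
  fix Y :: "('a, 'l) ell2 \<Rightarrow> ('a, 'l) ell2" and f :: "('a, 'l) ell2"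
  assume Y: "Y \<in> commutant (ell2_on K) {C. \<exists>A\<in>R_vN G K. \<exists>B\<in>bop UNIV. is_tensor_op K A B C}"
    and f: "f \<in> ell2_on K"
  hence Yb: "Y \<in> bop (ell2_on K)" by (simp add: commutant_def)
  have comm: "Y (C f) = C (Y f)" if "A \<in> R_vN G K" "B \<in> bop UNIV" "is_tensor_op K A B C" "f \<in> ell2_on K"
    for A B C and f :: "('a, 'l) ell2" using Y that unfolding commutant_def by blast
  have id: "id \<in> R_vN G K" by (rule left_equivariant_R_vN[OF left_equivariant_id])
  \<comment> \<open>Reading off the scalars needs a unit vector, so the zero space is treated
    first.\<close>
  show "X (Y f) = Y (X f)"
  proof (cases "\<exists>u :: 'l. u \<noteq> 0")
    case False
    hence "v = w" for v w :: "('a, 'l) ell2" by (metis ell2_eqI)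
    thus ?thesis .
  next
    case True
    then obtain w :: 'l where w: "w \<noteq> 0" by blast
    define u where "u = (1 / norm w) *\<^sub>R w"
    have u: "cinner u u = 1" using w by (simp add: cinner_self u_def)
    show ?thesis
    proof (rule left_equivariant_commute[OF assms Yb _ _ f])
      fix x y and l :: 'l assume xy: "x \<in> K" "y \<in> K"
      let ?B = "\<lambda>v. cinner v u *\<^sub>C l"
      note B = ell2_map_bop[OF rank_one_bop[of u l]]
      have "ell2_map ?B (single x u) = single x l"
        by (rule ell2_eqI) (simp add: B(2) ell2_apply_single u)
      hence "Y (single x l) = ell2_map ?B (Y (single x u))"
        using comm[OF id rank_one_bop B(3), of "single x u"] xy by simp
      thus "ell2_apply (Y (single x l)) y = cinner (ell2_apply (Y (single x u)) y) u *\<^sub>C l"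
        by (simp add: B(2))
    next
      fix x y g assume "x \<in> K" "y \<in> K" "g \<in> K"
      thus "cinner (ell2_apply (Y (single (x \<otimes> g) u)) (y \<otimes> g)) u =
          cinner (ell2_apply (Y (single x u)) y) u"
        by (subst right_reg_invariant[OF Yb comm[OF right_reg_R_vN bop_id right_reg_tensor]]) auto
    qed
  qed
qed

end

section \<open>From left-equivariant operators to formal series over the whole group\<close>

context group
begin

sublocale whole: group_subgroup G "carrier G"
  by (simp add: group_subgroup_def is_group subgroup_self)

text \<open>Slicing does it: embedding the scalars along \<open>l1\<close> before \<open>X\<close>
  and pairing with \<open>l2\<close> after \<open>X\<close> gives a scalar left-equivariant
  operator, hence an element of R(G), whose coefficients are the required matrix
  coefficients.\<close>

lemma left_equivariant_formal_space:
  fixes X :: "('a, 'l::complex_inner) ell2 \<Rightarrow> ('a, 'l) ell2"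
  assumes X: "left_equivariant G (carrier G) X"
  shows "op_coeffs G X \<in> formal_space G"
  unfolding formal_space_def mem_Collect_eq
proof (intro conjI allI ballI impI)
  note Xb = left_equivariant_bop[OF X]
  have single: "single \<one> l \<in> ell2_on (carrier G)" for l :: 'l by simp
  show "op_coeffs G X g = (\<lambda>l. 0)" if "g \<notin> carrier G" for g
    using bop_in[OF Xb single] that by (auto simp: op_coeffs_def ell2_on_def)
  show "op_coeffs G X g \<in> bop UNIV" for g
  proof -
    obtain C where C: "C \<ge> 0" "\<And>f. f \<in> ell2_on (carrier G) \<Longrightarrow> norm (X f) \<le> C * norm f"
      using bop_bound[OF Xb] by blast
    show ?thesis
    proof (rule bopI[where C = C])
      fix l
      have "norm (op_coeffs G X g l) \<le> norm (X (single \<one> l))"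
        unfolding op_coeffs_def by (rule ell2_apply_le)
      also have "\<dots> \<le> C * norm l" using C(2)[OF single, of l] by simp
      finally show "norm (op_coeffs G X g l) \<le> C * norm l" .
    qed (simp_all add: op_coeffs_def single_add single_scaleC bop_add[OF Xb] bop_scaleC[OF Xb])
  qed
  fix l1 l2 :: 'l
  obtain C where C: "\<And>v. norm (cinner v l2) \<le> norm v * C"
    using bounded_linear.bounded[OF bounded_linear_cinner_left[of l2]] by blast
  have n1: "norm (c *\<^sub>C l1) \<le> norm l1 * norm c" for c by simp
  have n2: "norm (cinner v l2) \<le> C * norm v" for v using C[of v] by (simp add: mult.commute)
  define J where "J = (ell2_map (\<lambda>c. c *\<^sub>C l1) :: ('a, complex) ell2 \<Rightarrow> _)"
  define Q where "Q = (ell2_map (\<lambda>v. cinner v l2) :: ('a, 'l) ell2 \<Rightarrow> _)"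
  have J: "ell2_apply (J \<xi>) x = ell2_apply \<xi> x *\<^sub>C l1" "norm (J \<xi>) \<le> norm l1 * norm \<xi>" for \<xi> x
    unfolding J_def by (rule ell2_map_apply_norm, rule n1)+
  have Q: "ell2_apply (Q f) x = cinner (ell2_apply f x) l2" "norm (Q f) \<le> C * norm f" for f x
    unfolding Q_def by (rule ell2_map_apply_norm, rule n2)+
  have J_in: "J \<xi> \<in> ell2_on (carrier G)" if "\<xi> \<in> ell2_on (carrier G)" for \<xi>
    using that by (simp add: ell2_on_def J(1))
  have J_add: "J (\<xi> + \<eta>) = J \<xi> + J \<eta>" and J_scale: "J (c *\<^sub>C \<xi>) = c *\<^sub>C J \<xi>" for c \<xi> \<eta>
    by (rule ell2_eqI, simp add: J(1) scaleC_add_left scaleC_scaleC scaleC_complex_def)+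
  have Q_add: "Q (f + g) = Q f + Q g" and Q_scale: "Q (c *\<^sub>C f) = c *\<^sub>C Q f" for c f g
    by (rule ell2_eqI, simp add: Q(1) cinner_add_left cinner_scaleC_left scaleC_complex_def)+
  have J_single: "J (single x c) = c *\<^sub>C single x l1" for x c
    by (rule ell2_eqI) (simp add: J(1) ell2_apply_single)
  have "left_equivariant G (carrier G) (\<lambda>\<xi>. Q (X (J \<xi>)))"
    unfolding left_equivariant_def
  proof (intro conjI ballI allI)
    obtain D where D: "D \<ge> 0" "\<And>f. f \<in> ell2_on (carrier G) \<Longrightarrow> norm (X f) \<le> D * norm f"
      using bop_bound[OF Xb] by blast
    show "(\<lambda>\<xi>. Q (X (J \<xi>))) \<in> bop (ell2_on (carrier G))"
    proof (rule bopI)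
      fix \<xi> :: "('a, complex) ell2" assume \<xi>: "\<xi> \<in> ell2_on (carrier G)"
      show "Q (X (J \<xi>)) \<in> ell2_on (carrier G)"
        using bop_in[OF Xb J_in[OF \<xi>]] by (simp add: ell2_on_def Q(1))
      have "norm (Q (X (J \<xi>))) \<le> \<bar>C\<bar> * norm (X (J \<xi>))"
        using Q(2)[of "X (J \<xi>)"] by (smt (verit) mult_right_mono norm_ge_zero)
      also have "\<dots> \<le> \<bar>C\<bar> * (D * (norm l1 * norm \<xi>))"
        using D(2)[OF J_in[OF \<xi>]] mult_left_mono[OF J(2)[of \<xi>] D(1)]
        by (intro mult_left_mono) auto
      finally show "norm (Q (X (J \<xi>))) \<le> (\<bar>C\<bar> * D * norm l1) * norm \<xi>" by (simp add: mult_ac)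
    next
      fix \<xi> :: "('a, complex) ell2" and c assume \<xi>: "\<xi> \<in> ell2_on (carrier G)"
      show "Q (X (J (c *\<^sub>C \<xi>))) = c *\<^sub>C Q (X (J \<xi>))"
        by (simp add: J_scale bop_scaleC[OF Xb J_in[OF \<xi>]] Q_scale)
    qed (simp add: J_add bop_add[OF Xb J_in J_in] Q_add)
    fix x y c assume xy: "x \<in> carrier G" "y \<in> carrier G"
    show "ell2_apply (Q (X (J (single x c)))) y = op_coeffs G (\<lambda>\<xi>. Q (X (J \<xi>))) (inv x \<otimes> y) c"
      using xy whole.left_equivariantD[OF X xy, of l1]
      by (simp add: op_coeffs_def J_single bop_scaleC[OF Xb] Q(1))
  qed
  hence "(\<lambda>\<xi>. Q (X (J \<xi>))) \<in> R_vN G (carrier G)" by (rule whole.left_equivariant_R_vN)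
  thus "\<exists>T\<in>R_vN G (carrier G). \<forall>g\<in>carrier G.
      ell2_apply (T (single \<one> 1)) g = cinner (op_coeffs G X g l1) l2"
  proof (rule bexI[rotated], intro ballI)
    fix g
    show "ell2_apply (Q (X (J (single \<one> 1)))) g = cinner (op_coeffs G X g l1) l2"
      by (simp only: op_coeffs_def J_single Q(1) scaleC_one)
  qed
qed

lemma is_product_op_coeffs:
  assumes "left_equivariant G (carrier G) X" "left_equivariant G (carrier G) Y"
  shows "is_product G (op_coeffs G X) (op_coeffs G Y) (op_coeffs G (\<lambda>f. X (Y f)))"
  unfolding is_product_def
proof (intro conjI ballI allI)
  show "op_coeffs G X \<in> formal_space G" "op_coeffs G Y \<in> formal_space G"
    by (rule left_equivariant_formal_space, rule assms)+
  show "op_coeffs G (\<lambda>f. X (Y f)) \<in> formal_space G"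
    by (rule left_equivariant_formal_space[OF whole.left_equivariant_comp[OF assms]])
qed (rule whole.op_coeffs_comp_has_sum[OF assms])

end

section \<open>The representation\<close>

lemma cinner_eqI:
  fixes a b :: "'a::complex_inner"
  assumes "\<And>l. cinner a l = cinner b l"
  shows "a = b"
proof -
  have "cinner (a - b) (a - b) = 0" using assms by (simp add: cinner_diff_left)
  thus ?thesis by (simp add: cinner_self)
qed

lemma cinner_single_left: "cinner (single x l) f = cinner l (ell2_apply f x)"
  by (metis cinner_commute cinner_single_right)

lemma finite_image_factor:
  assumes "finite (f ` A)" "\<And>x y. x \<in> A \<Longrightarrow> y \<in> A \<Longrightarrow> f x = f y \<Longrightarrow> g x = g y"
  shows "finite (g ` A)"
proof (rule finite_subset)
  show "g ` A \<subseteq> (\<lambda>c. g (SOME x. x \<in> A \<and> f x = c)) ` (f ` A)"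
  proof
    fix z assume "z \<in> g ` A"
    then obtain x where x: "x \<in> A" "z = g x" by blast
    hence "(SOME y. y \<in> A \<and> f y = f x) \<in> A \<and> f (SOME y. y \<in> A \<and> f y = f x) = f x"
      by (intro someI[of "\<lambda>y. y \<in> A \<and> f y = f x" x]) simp
    hence "z = g (SOME y. y \<in> A \<and> f y = f x)" using x assms(2) by metis
    thus "z \<in> (\<lambda>c. g (SOME x. x \<in> A \<and> f x = c)) ` (f ` A)" using x by blast
  qed
qed (use assms in simp)

locale almost_normal_rep = group_subgroup G \<Gamma> for G (structure) and \<Gamma> +
  fixes \<pi> :: "'a \<Rightarrow> ('a, 'l::chilbert_space) ell2 \<Rightarrow> ('a, 'l) ell2"
  assumes almost_normal: "almost_normal G \<Gamma>"
    and unitary_rep: "unitary_rep G (ell2_on \<Gamma>) \<pi>"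
    and restriction: "\<And>\<gamma>. \<gamma> \<in> \<Gamma> \<Longrightarrow> is_tensor_op \<Gamma> (left_reg G \<Gamma> \<gamma>) id (\<pi> \<gamma>)"
begin

abbreviation H :: "('a, 'l) ell2 set" where "H \<equiv> ell2_on \<Gamma>"

lemma pi_bop: "g \<in> carrier G \<Longrightarrow> \<pi> g \<in> bop H"
  and pi_one: "f \<in> H \<Longrightarrow> \<pi> \<one> f = f"
  and pi_mult: "g \<in> carrier G \<Longrightarrow> h \<in> carrier G \<Longrightarrow> f \<in> H \<Longrightarrow> \<pi> (g \<otimes> h) f = \<pi> g (\<pi> h f)"
  and cinner_pi_pi: "g \<in> carrier G \<Longrightarrow> f \<in> H \<Longrightarrow> f' \<in> H \<Longrightarrow> cinner (\<pi> g f) (\<pi> g f') = cinner f f'"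
  using unitary_rep by (auto simp: unitary_rep_def unitary_op_def)

lemma pi_in: "g \<in> carrier G \<Longrightarrow> f \<in> H \<Longrightarrow> \<pi> g f \<in> H"
  by (rule bop_in[OF pi_bop])

lemma pi_inv: "g \<in> carrier G \<Longrightarrow> f \<in> H \<Longrightarrow> \<pi> (inv g) (\<pi> g f) = f"
  "g \<in> carrier G \<Longrightarrow> f \<in> H \<Longrightarrow> \<pi> g (\<pi> (inv g) f) = f"
  using pi_mult[of "inv g" g f] pi_mult[of g "inv g" f] pi_one by auto

lemma cinner_pi: "g \<in> carrier G \<Longrightarrow> f \<in> H \<Longrightarrow> f' \<in> H \<Longrightarrow> cinner (\<pi> g f) f' = cinner f (\<pi> (inv g) f')"
  using cinner_pi_pi[of g f "\<pi> (inv g) f'"] pi_in[of "inv g" f'] pi_inv[of g f'] by simp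

lemma pi_single:
  assumes "\<gamma> \<in> \<Gamma>" "x \<in> \<Gamma>"
  shows "\<pi> \<gamma> (single x l) = single (\<gamma> \<otimes> x) l"
proof -
  have "\<pi> \<gamma> (single x 1 \<otimes>\<^sub>h l) = left_reg G \<Gamma> \<gamma> (single x 1) \<otimes>\<^sub>h id l"
    using restriction[OF assms(1)] assms(2) unfolding is_tensor_op_def by simp
  thus ?thesis
    using left_reg_single[OF is_group subgroup_axioms assms, of "1 :: complex"]
    by (simp add: single_tensor)
qed

text \<open>The hypothesis describes \<pi>(\<gamma>) on elementary tensors only. Unitarity moves it
  onto the test vectors \<delta>_y \<otimes> l, where it is known, and so gives the coordinates for
  arbitrary f.\<close>

lemma pi_apply:
  assumes "\<gamma> \<in> \<Gamma>" "f \<in> H" "y \<in> \<Gamma>"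
  shows "ell2_apply (\<pi> \<gamma> f) y = ell2_apply f (inv \<gamma> \<otimes> y)"
proof (rule cinner_eqI)
  fix l
  have "cinner (\<pi> \<gamma> f) (single y l) = cinner f (\<pi> (inv \<gamma>) (single y l))"
    using assms by (intro cinner_pi) auto
  also have "\<pi> (inv \<gamma>) (single y l) = single (inv \<gamma> \<otimes> y) l"
    using assms by (intro pi_single) auto
  finally show "cinner (ell2_apply (\<pi> \<gamma> f) y) l = cinner (ell2_apply f (inv \<gamma> \<otimes> y)) l"
    by (simp add: cinner_single_right)
qed

text \<open>With h = w \<gamma>, the summand \<pi>(h) P_L \<pi>(h)^-1 v is \<pi>(w) applied to the
  part of \<pi>(w)^-1 v supported at \<gamma>. The sum is therefore the coordinate expansion of
  \<pi>(w)^-1 v carried back by \<pi>(w).\<close>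

lemma pi_recover:
  assumes "v \<in> H" "w \<in> carrier G"
  shows "((\<lambda>h. \<pi> h (single \<one> (ell2_apply (\<pi> (inv h) v) \<one>))) has_sum v) (w <# \<Gamma>)"
proof -
  define v' where "v' = \<pi> (inv w) v"
  have v': "v' \<in> H" using assms by (simp add: v'_def pi_in)
  have "((\<lambda>\<gamma>. \<pi> w (single \<gamma> (ell2_apply v' \<gamma>))) has_sum \<pi> w v') \<Gamma>"
    by (rule bop_expand[OF pi_bop v']) (rule assms)
  hence "((\<lambda>\<gamma>. \<pi> w (single \<gamma> (ell2_apply v' \<gamma>))) has_sum v) \<Gamma>"
    using assms by (simp add: v'_def pi_inv)
  thus ?thesis
  proof (rule has_sum_reindex_bij_witness[THEN iffD1, rotated -1])
    fix \<gamma> assume \<gamma>: "\<gamma> \<in> \<Gamma>"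
    show "w \<otimes> \<gamma> \<in> w <# \<Gamma>" using \<gamma> by (auto simp: l_coset_def)
    show "inv w \<otimes> (w \<otimes> \<gamma>) = \<gamma>" using \<gamma> assms by (simp add: m_assoc[symmetric])
    have "\<pi> (w \<otimes> \<gamma>) (single \<one> l) = \<pi> w (single \<gamma> l)" for l
      using \<gamma> assms by (simp add: pi_mult pi_single)
    moreover have "ell2_apply (\<pi> (inv (w \<otimes> \<gamma>)) v) \<one> = ell2_apply v' \<gamma>"
      using \<gamma> assms v' by (simp add: inv_mult_group pi_mult v'_def[symmetric] pi_apply)
    ultimately show "\<pi> (w \<otimes> \<gamma>) (single \<one> (ell2_apply (\<pi> (inv (w \<otimes> \<gamma>)) v) \<one>)) =
        \<pi> w (single \<gamma> (ell2_apply v' \<gamma>))" by simp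
  next
    fix h assume "h \<in> w <# \<Gamma>"
    then obtain \<gamma> where "\<gamma> \<in> \<Gamma>" "h = w \<otimes> \<gamma>" by (auto simp: l_coset_def)
    thus "inv w \<otimes> h \<in> \<Gamma>" "w \<otimes> (inv w \<otimes> h) = h" using assms by (simp_all add: m_assoc[symmetric])
  qed simp
qed

definition intertwiner :: "(('a, 'l) ell2 \<Rightarrow> ('a, 'l) ell2) \<Rightarrow> bool" where
  "intertwiner q \<longleftrightarrow> q \<in> bop H \<and> (\<forall>g\<in>carrier G. \<forall>f\<in>H. q (\<pi> g f) = \<pi> g (q f))"

lemma intertwiner_bop: "intertwiner q \<Longrightarrow> q \<in> bop H"
  and intertwiner_pi: "intertwiner q \<Longrightarrow> g \<in> carrier G \<Longrightarrow> f \<in> H \<Longrightarrow> q (\<pi> g f) = \<pi> g (q f)"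
  by (auto simp: intertwiner_def)

lemma intertwiner_in: "intertwiner q \<Longrightarrow> f \<in> H \<Longrightarrow> q f \<in> H"
  by (rule bop_in[OF intertwiner_bop])

lemma intertwiner_id: "intertwiner id"
  by (simp add: intertwiner_def bop_id)

lemma intertwiner_comp:
  assumes "intertwiner q" "intertwiner r"
  shows "intertwiner (\<lambda>f. q (r f))"
  using assms bop_comp[OF assms[THEN intertwiner_bop]]
  by (simp add: intertwiner_def bop_in[OF intertwiner_bop[OF assms(2)]])

text \<open>For a finitely supported combination \<open>a\<close> of cosets this is
  \<open>\<Sum>\<^sub>\<theta> a(\<theta>) \<rho>(\<theta>\<inverse>) \<otimes> P\<^sub>L \<pi>(\<theta>) q P\<^sub>L\<close>; \<open>q = id\<close> gives \<open>S(a)\<close>, and \<open>q = p\<close> gives \<open>p S(a)\<close>.\<close>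

definition rep_series :: "(('a, 'l) ell2 \<Rightarrow> ('a, 'l) ell2) \<Rightarrow> ('a \<Rightarrow> complex) \<Rightarrow> ('a, 'l) series" where
  "rep_series q a = (\<lambda>g l. if g \<in> carrier G then a (inv g) *\<^sub>C compress G (\<lambda>f. \<pi> (inv g) (q f)) l else 0)"

lemma coset_series_eq: "coset_series G (\<lambda>g f. \<pi> g (q f)) A = rep_series q (indicator A)"
  by (intro ext) (simp add: coset_series_def rep_series_def indicator_def)

text \<open>These are the classes of the common refinement of the partitions of G into left cosets
  and into right cosets of \<Gamma>.\<close>

definition piece :: "'a \<Rightarrow> 'a set" where
  "piece z = (z <# \<Gamma>) \<inter> (\<Gamma> #> z)"

lemma mem_l_coset: "z \<in> carrier G \<Longrightarrow> g \<in> z <# \<Gamma> \<longleftrightarrow> g \<in> carrier G \<and> inv z \<otimes> g \<in> \<Gamma>"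
proof
  assume z: "z \<in> carrier G" and "g \<in> z <# \<Gamma>"
  then obtain h where "h \<in> \<Gamma>" "g = z \<otimes> h" by (auto simp: l_coset_def)
  thus "g \<in> carrier G \<and> inv z \<otimes> g \<in> \<Gamma>" using z by (simp add: m_assoc[symmetric])
next
  assume z: "z \<in> carrier G" and g: "g \<in> carrier G \<and> inv z \<otimes> g \<in> \<Gamma>"
  hence "g = z \<otimes> (inv z \<otimes> g)" by (simp add: m_assoc[symmetric])
  thus "g \<in> z <# \<Gamma>" using g by (force simp: l_coset_def)
qed

lemma mem_r_coset: "z \<in> carrier G \<Longrightarrow> g \<in> \<Gamma> #> z \<longleftrightarrow> g \<in> carrier G \<and> g \<otimes> inv z \<in> \<Gamma>"
proof
  assume z: "z \<in> carrier G" and "g \<in> \<Gamma> #> z"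
  then obtain h where "h \<in> \<Gamma>" "g = h \<otimes> z" by (auto simp: r_coset_def)
  thus "g \<in> carrier G \<and> g \<otimes> inv z \<in> \<Gamma>" using z by (simp add: m_assoc)
next
  assume z: "z \<in> carrier G" and g: "g \<in> carrier G \<and> g \<otimes> inv z \<in> \<Gamma>"
  hence "g = (g \<otimes> inv z) \<otimes> z" by (simp add: m_assoc)
  thus "g \<in> \<Gamma> #> z" using g by (force simp: r_coset_def)
qed

lemma mem_piece:
  "z \<in> carrier G \<Longrightarrow> g \<in> piece z \<longleftrightarrow> g \<in> carrier G \<and> inv z \<otimes> g \<in> \<Gamma> \<and> g \<otimes> inv z \<in> \<Gamma>"
  by (auto simp: piece_def mem_l_coset mem_r_coset)

text \<open>With \<open>\<Delta> = \<Gamma> \<inter> z\<inverse>\<Gamma>z\<close> the piece \<open>z\<Gamma> \<inter> \<Gamma>z\<close> is \<open>z\<Delta> = \<Delta>'z\<close>, where \<open>\<Delta>' = z\<Delta>z\<inverse> \<subseteq> \<Gamma>\<close>.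
  The operator sends the restriction of \<open>f\<close> to a coset \<open>yz\<Delta>\<close>, viewed as a vector of \<open>H\<close>, to the
  restriction of its image under \<open>\<pi>(z) q\<close> to \<open>\<Delta>'\<close>, placed on \<open>y\<Delta>'\<close>. Both families of cosets
  partition the group, so the norm of \<open>q\<close> is a bound.\<close>

lemma piece_operator:
  assumes z: "z \<in> carrier G" and q: "intertwiner q"
  shows "\<exists>X. left_equivariant G (carrier G) X \<and> op_coeffs G X = rep_series q (indicator (piece z))"
proof -
  define \<Delta> where "\<Delta> = {\<gamma>\<in>\<Gamma>. z \<otimes> \<gamma> \<otimes> inv z \<in> \<Gamma>}"
  have \<Delta>_\<Gamma>: "\<delta> \<in> \<Gamma>" "z \<otimes> \<delta> \<otimes> inv z \<in> \<Gamma>" if "\<delta> \<in> \<Delta>" for \<delta> using that by (simp_all add: \<Delta>_def)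
  have \<Delta>_carrier: "\<delta> \<in> carrier G" if "\<delta> \<in> \<Delta>" for \<delta> using \<Delta>_\<Gamma>[OF that] by simp
  have cancel: "inv x \<otimes> (x \<otimes> y) = y" "x \<otimes> (inv x \<otimes> y) = y" if "x \<in> carrier G" "y \<in> carrier G" for x y
    using that by (simp_all add: m_assoc[symmetric])
  have \<Delta>_mult: "\<delta> \<otimes> \<delta>' \<in> \<Delta>" if "\<delta> \<in> \<Delta>" "\<delta>' \<in> \<Delta>" for \<delta> \<delta>'
  proof -
    have "z \<otimes> (\<delta> \<otimes> \<delta>') \<otimes> inv z = (z \<otimes> \<delta> \<otimes> inv z) \<otimes> (z \<otimes> \<delta>' \<otimes> inv z)"
      using that[THEN \<Delta>_carrier] z by (simp add: m_assoc cancel)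
    thus ?thesis using that by (auto simp: \<Delta>_def)
  qed
  have \<Delta>_inv: "inv \<delta> \<in> \<Delta>" if "\<delta> \<in> \<Delta>" for \<delta>
  proof -
    have "z \<otimes> inv \<delta> \<otimes> inv z = inv (z \<otimes> \<delta> \<otimes> inv z)"
      using that[THEN \<Delta>_carrier] z by (simp add: inv_mult_group m_assoc)
    thus ?thesis using that by (auto simp: \<Delta>_def)
  qed
  have \<Delta>_one: "\<one> \<in> \<Delta>" using z by (simp add: \<Delta>_def)
  have \<Delta>_sub: "subgroup \<Delta> G"
    using \<Delta>_mult \<Delta>_inv \<Delta>_one \<Delta>_carrier by (intro subgroup.intro) auto
  \<comment> \<open>\<open>t y\<close> parametrises the coset y z \<Delta> by \<Delta>, and
    \<open>u f y\<close> is the restriction of f to that coset, pulled back to a vector of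
    \<open>H\<close>.\<close>
  define t where "t y = (\<lambda>\<gamma>. y \<otimes> z \<otimes> \<gamma>)" for y
  have t_inj: "inj_on (t y) \<Delta>" if "y \<in> carrier G" for y
    using that z \<Delta>_carrier by (auto intro!: inj_onI simp: t_def m_assoc)
  define u where "u f y = Abs_ell2 (\<lambda>\<gamma>. if \<gamma> \<in> \<Delta> then ell2_apply f (t y \<gamma>) else 0)"
    for f :: "('a, 'l) ell2" and y
  have u_apply: "ell2_apply (u f y) \<gamma> = (if \<gamma> \<in> \<Delta> then ell2_apply f (t y \<gamma>) else 0)"
    if "y \<in> carrier G" for f y \<gamma>
    unfolding u_def by (subst Abs_ell2_apply[OF summable_on_restrict_translate[OF t_inj[OF that]]]) simp
  have u_H: "u f y \<in> H" if "y \<in> carrier G" for f y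
    using \<Delta>_\<Gamma> by (auto simp: ell2_on_def u_apply[OF that])
  have u_add: "u (f + g) y = u f y + u g y" and u_scale: "u (c *\<^sub>C f) y = c *\<^sub>C u f y"
    if "y \<in> carrier G" for f g c y
    by (rule ell2_eqI, simp add: u_apply[OF that])+
  define Z where "Z v = \<pi> z (q v)" for v
  have Z_bop: "Z \<in> bop H"
    unfolding Z_def by (rule bop_comp[OF pi_bop[OF z] intertwiner_bop[OF q]])
  obtain c where c: "c \<ge> 0" "\<And>v. v \<in> H \<Longrightarrow> norm (Z v) \<le> c * norm v" using bop_bound[OF Z_bop] by blast
  \<comment> \<open>The value placed at y. Every y serves as its own coset representative, so
    nothing is chosen; \<open>N_translate\<close> then shows that all points of one coset y
    \<Delta>' read coordinates of a single vector.\<close>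
  define N where "N f y = ell2_apply (Z (u f y)) \<one>" for f y
  have N_add: "N (f + g) y = N f y + N g y" and N_scale: "N (d *\<^sub>C f) y = d *\<^sub>C N f y"
    if "y \<in> carrier G" for f g d y
    by (simp_all add: N_def u_add[OF that] u_scale[OF that] bop_add[OF Z_bop u_H[OF that] u_H[OF that]]
        bop_scaleC[OF Z_bop u_H[OF that]])
  \<comment> \<open>Moving y by z \<delta> z^-1 changes \<open>u f y\<close> by \<pi>(\<delta>^-1).
    Pulled through \<open>Z\<close>, this becomes the inverse of \<pi>(z \<delta> z^-1), which is a
    left translation on \<open>H\<close> because z \<delta> z^-1 lies in \<Gamma>.\<close>
  have N_translate: "N f (y \<otimes> (z \<otimes> \<delta> \<otimes> inv z)) = ell2_apply (Z (u f y)) (z \<otimes> \<delta> \<otimes> inv z)"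
    if y: "y \<in> carrier G" and \<delta>: "\<delta> \<in> \<Delta>" for f y \<delta>
  proof -
    let ?y' = "y \<otimes> (z \<otimes> \<delta> \<otimes> inv z)"
    note \<delta>' = \<Delta>_\<Gamma>[OF \<delta>]
    have y': "?y' \<in> carrier G" using y \<delta>' by simp
    have "u f ?y' = \<pi> (inv \<delta>) (u f y)"
    proof (rule ell2_on_eqI[OF u_H[OF y']])
      show "\<pi> (inv \<delta>) (u f y) \<in> H" using \<delta>' by (intro pi_in u_H y) simp
      fix \<gamma> assume \<gamma>: "\<gamma> \<in> \<Gamma>"
      have "\<delta> \<otimes> \<gamma> \<in> \<Delta> \<longleftrightarrow> \<gamma> \<in> \<Delta>"
        using \<Delta>_mult[OF \<Delta>_inv[OF \<delta>], of "\<delta> \<otimes> \<gamma>"] \<Delta>_mult[OF \<delta>, of \<gamma>] cancel(1)[of \<delta> \<gamma>] \<delta>' \<gamma> by auto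
      moreover have "t ?y' \<gamma> = t y (\<delta> \<otimes> \<gamma>)"
        using y z \<gamma> \<Delta>_carrier[OF \<delta>] by (simp add: t_def m_assoc cancel)
      ultimately show "ell2_apply (u f ?y') \<gamma> = ell2_apply (\<pi> (inv \<delta>) (u f y)) \<gamma>"
        using \<delta>' \<gamma> by (simp add: pi_apply u_H[OF y] u_apply[OF y] u_apply[OF y'])
    qed
    hence "Z (u f ?y') = \<pi> (z \<otimes> inv \<delta>) (q (u f y))"
      using z \<delta>' by (simp add: Z_def intertwiner_pi[OF q] u_H[OF y] pi_mult intertwiner_in[OF q])
    also have "z \<otimes> inv \<delta> = inv (z \<otimes> \<delta> \<otimes> inv z) \<otimes> z"
      using z \<Delta>_carrier[OF \<delta>] by (simp add: inv_mult_group m_assoc)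
    also have "\<pi> (inv (z \<otimes> \<delta> \<otimes> inv z) \<otimes> z) (q (u f y)) = \<pi> (inv (z \<otimes> \<delta> \<otimes> inv z)) (Z (u f y))"
      using z \<delta>' by (simp add: Z_def pi_mult intertwiner_in[OF q] u_H[OF y])
    finally have "N f ?y' = ell2_apply (\<pi> (inv (z \<otimes> \<delta> \<otimes> inv z)) (Z (u f y))) \<one>"
      by (simp add: N_def)
    also have "\<dots> = ell2_apply (Z (u f y)) (inv (inv (z \<otimes> \<delta> \<otimes> inv z)) \<otimes> \<one>)"
      using \<delta>' by (intro pi_apply bop_in[OF Z_bop] u_H y) simp_all
    also have "inv (inv (z \<otimes> \<delta> \<otimes> inv z)) \<otimes> \<one> = z \<otimes> \<delta> \<otimes> inv z"
      using K_carrier[OF \<delta>'(2)] by (metis inv_inv r_one)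
    finally show ?thesis .
  qed
  define \<kappa> where "\<kappa> y = (y \<otimes> z) <# \<Delta>" for y
  have t_image: "t y ` \<Delta> = \<kappa> y" for y
    by (auto simp: t_def \<kappa>_def l_coset_def)
  \<comment> \<open>The values at points with the same coset are distinct coordinates of the one
    vector \<open>Z (u f y)\<close>, so their squares sum to at most the square of
    \<open>c * norm (u f y)\<close>.\<close>
  have N_coset: "(\<Sum>y'\<in>{y'\<in>F. \<kappa> y' = C}. (norm (N f y'))\<^sup>2) \<le> c\<^sup>2 * (\<Sum>\<^sub>\<infinity>x\<in>C. (norm (ell2_apply f x))\<^sup>2)"
    if F: "finite F" "F \<subseteq> carrier G" and C: "C \<in> \<kappa> ` F" for F f C
  proof -
    obtain y where y: "y \<in> F" "C = \<kappa> y" using C by blast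
    hence y_carrier: "y \<in> carrier G" using F by blast
    let ?F = "{y'\<in>F. \<kappa> y' = C}"
    let ?s = "\<lambda>y'. inv y \<otimes> y'"
    have F_eq: "\<exists>\<delta>\<in>\<Delta>. y' = y \<otimes> (z \<otimes> \<delta> \<otimes> inv z)" if "y' \<in> ?F" for y'
    proof -
      have y': "y' \<in> carrier G" using that F by blast
      have "y' \<otimes> z \<in> \<kappa> y'" using \<Delta>_one y' z by (force simp: \<kappa>_def l_coset_def)
      hence "y' \<otimes> z \<in> \<kappa> y" using that y by simp
      then obtain \<delta> where \<delta>: "\<delta> \<in> \<Delta>" "y' \<otimes> z = y \<otimes> z \<otimes> \<delta>"
        by (auto simp: \<kappa>_def l_coset_def)
      have "y' = y' \<otimes> z \<otimes> inv z" using y' z by (simp add: m_assoc)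
      hence "y' = y \<otimes> (z \<otimes> \<delta> \<otimes> inv z)"
        unfolding \<delta>(2) using y_carrier z \<Delta>_carrier[OF \<delta>(1)] by (simp add: m_assoc)
      thus ?thesis using \<delta>(1) by blast
    qed
    have N_s: "N f y' = ell2_apply (Z (u f y)) (?s y')" if y': "y' \<in> ?F" for y'
    proof -
      obtain \<delta> where \<delta>: "\<delta> \<in> \<Delta>" "y' = y \<otimes> (z \<otimes> \<delta> \<otimes> inv z)" using F_eq[OF y'] by blast
      thus ?thesis
        using N_translate[OF y_carrier \<delta>(1), of f] y_carrier K_carrier[OF \<Delta>_\<Gamma>(2)[OF \<delta>(1)]]
        by (simp add: cancel)
    qed
    have "inj_on ?s ?F"
      using F y_carrier by (intro inj_onI) (metis (no_types, lifting) cancel(2) mem_Collect_eq subsetD inv_closed)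
    hence "(\<Sum>y'\<in>?F. (norm (N f y'))\<^sup>2) = (\<Sum>x\<in>?s ` ?F. (norm (ell2_apply (Z (u f y)) x))\<^sup>2)"
      by (subst sum.reindex) (simp_all add: N_s)
    also have "\<dots> \<le> (norm (Z (u f y)))\<^sup>2"
      using F by (intro ell2_sum_le) simp
    also have "\<dots> \<le> (c * norm (u f y))\<^sup>2"
      using c(2)[OF u_H[OF y_carrier]] by (intro power_mono) auto
    also have "\<dots> = c\<^sup>2 * (\<Sum>\<^sub>\<infinity>x\<in>C. (norm (ell2_apply f x))\<^sup>2)"
      unfolding y(2) t_image[symmetric]
      by (simp add: power_mult_distrib
          norm_ell2_square_translate[OF t_inj[OF y_carrier] u_apply[OF y_carrier]])
    finally show ?thesis .
  qed
  have N_bound: "(\<Sum>y\<in>F. (norm (N f y))\<^sup>2) \<le> (c * norm f)\<^sup>2" if F: "finite F" "F \<subseteq> carrier G" for F f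
  proof -
    have "(\<Sum>y\<in>F. (norm (N f y))\<^sup>2) = (\<Sum>C\<in>\<kappa> ` F. \<Sum>y'\<in>{y'\<in>F. \<kappa> y' = C}. (norm (N f y'))\<^sup>2)"
      by (rule sum.image_gen[OF F(1)])
    also have "\<dots> \<le> (\<Sum>C\<in>\<kappa> ` F. c\<^sup>2 * (\<Sum>\<^sub>\<infinity>x\<in>C. (norm (ell2_apply f x))\<^sup>2))"
      by (intro sum_mono N_coset F)
    also have "\<dots> = c\<^sup>2 * (\<Sum>C\<in>\<kappa> ` F. \<Sum>\<^sub>\<infinity>x\<in>C. (norm (ell2_apply f x))\<^sup>2)"
      by (simp add: sum_distrib_left)
    also have "(\<Sum>C\<in>\<kappa> ` F. \<Sum>\<^sub>\<infinity>x\<in>C. (norm (ell2_apply f x))\<^sup>2) =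
        (\<Sum>\<^sub>\<infinity>x\<in>(\<Union>C\<in>\<kappa> ` F. C). (norm (ell2_apply f x))\<^sup>2)"
    proof (rule sum_infsum)
      show "finite (\<kappa> ` F)" using F by simp
      show "(\<lambda>x. (norm (ell2_apply f x))\<^sup>2) summable_on C" for C by (rule ell2_summable_on)
      fix C C' assume C: "C \<in> \<kappa> ` F" "C' \<in> \<kappa> ` F" "C \<noteq> C'"
      then obtain y y' where y: "y \<in> carrier G" "y' \<in> carrier G" "C = \<kappa> y" "C' = \<kappa> y'" using F by blast
      show "C \<inter> C' = {}"
      proof (rule ccontr)
        assume "C \<inter> C' \<noteq> {}"
        then obtain x where "x \<in> \<kappa> y" "x \<in> \<kappa> y'" using y by blast
        hence "x <# \<Delta> = \<kappa> y" "x <# \<Delta> = \<kappa> y'"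
          unfolding \<kappa>_def by (auto intro!: l_repr_independence[OF _ _ \<Delta>_sub, symmetric] simp: y z)
        thus False using C y by simp
      qed
    qed
    also have "c\<^sup>2 * \<dots> \<le> c\<^sup>2 * (norm f)\<^sup>2"
      by (intro mult_left_mono infsum_ell2_le_norm) simp
    finally show ?thesis by (simp add: power_mult_distrib)
  qed
  define X where "X f = Abs_ell2 (\<lambda>y. if y \<in> carrier G then N f y else 0)" for f
  have N_bound': "(\<Sum>y\<in>F. (norm (if y \<in> carrier G then N f y else 0))\<^sup>2) \<le> (c * norm f)\<^sup>2" if "finite F" for F f
  proof -
    have "(\<Sum>y\<in>F. (norm (if y \<in> carrier G then N f y else 0))\<^sup>2) = (\<Sum>y\<in>F \<inter> carrier G. (norm (N f y))\<^sup>2)"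
      using that by (intro sum.mono_neutral_cong_right) auto
    also have "\<dots> \<le> (c * norm f)\<^sup>2" using that by (intro N_bound) auto
    finally show ?thesis .
  qed
  have X_summable: "(\<lambda>y. (norm (if y \<in> carrier G then N f y else 0))\<^sup>2) summable_on UNIV" for f
    by (rule nonneg_bdd_above_summable_on) (auto simp: bdd_above_def intro: N_bound')
  have X_apply: "ell2_apply (X f) y = (if y \<in> carrier G then N f y else 0)" for f y
    unfolding X_def by (subst Abs_ell2_apply[OF X_summable]) simp
  have X_norm: "norm (X f) \<le> c * norm f" for f
  proof -
    have "(norm (X f))\<^sup>2 \<le> (c * norm f)\<^sup>2"
      unfolding ell2_norm_square X_apply by (rule infsum_le_finite_sums[OF X_summable N_bound'])
    thus ?thesis by (rule power2_le_imp_le) (simp add: c(1))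
  qed
  have X_bop: "X \<in> bop (ell2_on (carrier G))"
  proof (rule bopI[OF _ _ _ X_norm])
    fix f show "X f \<in> ell2_on (carrier G)" by (simp add: ell2_on_def X_apply)
    show "X (f + g) = X f + X g" for g by (rule ell2_eqI) (simp add: X_apply N_add)
    show "X (d *\<^sub>C f) = d *\<^sub>C X f" for d by (rule ell2_eqI) (simp add: X_apply N_scale)
  qed
  have X_single: "ell2_apply (X (single x l)) y = rep_series q (indicator (piece z)) (inv x \<otimes> y) l"
    if x: "x \<in> carrier G" and y: "y \<in> carrier G" for x y l
  proof -
    \<comment> \<open>The coefficient at g = x^-1 y belongs to the group element g^-1 = w. The point
      x lies in y z \<Delta> exactly when w lies in the piece, and then
      \<open>u (single x l) y\<close> is \<pi>(z^-1 w) applied to \<delta>_e \<otimes> l, which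
      \<open>Z\<close> sends to \<pi>(w) q (\<delta>_e \<otimes> l).\<close>
    define w where "w = inv y \<otimes> x"
    have w: "w \<in> carrier G" "inv (inv x \<otimes> y) = w" using x y by (simp_all add: w_def inv_mult_group)
    have t_x: "t y \<gamma> = x \<longleftrightarrow> \<gamma> = inv z \<otimes> w" if "\<gamma> \<in> carrier G" for \<gamma>
    proof
      assume "t y \<gamma> = x"
      thus "\<gamma> = inv z \<otimes> w" using that y z by (auto simp: t_def w_def m_assoc cancel)
    next
      assume "\<gamma> = inv z \<otimes> w"
      thus "t y \<gamma> = x" using x y z by (simp add: t_def w_def m_assoc cancel)
    qed
    have "w \<otimes> inv z = z \<otimes> (inv z \<otimes> w) \<otimes> inv z" using z w by (simp add: m_assoc cancel)
    hence piece: "w \<in> piece z \<longleftrightarrow> inv z \<otimes> w \<in> \<Delta>"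
      using w z by (simp add: mem_piece \<Delta>_def)
    show ?thesis
    proof (cases "w \<in> piece z")
      case True
      hence zw: "inv z \<otimes> w \<in> \<Delta>" using piece by simp
      have "u (single x l) y = single (inv z \<otimes> w) l"
        using t_x[OF \<Delta>_carrier] zw by (intro ell2_eqI) (auto simp: u_apply[OF y] ell2_apply_single)
      also have "\<dots> = \<pi> (inv z \<otimes> w) (single \<one> l)"
        using \<Delta>_\<Gamma>(1)[OF zw] z w by (subst pi_single) auto
      also have "Z \<dots> = \<pi> w (q (single \<one> l))"
        using w z by (simp add: Z_def intertwiner_pi[OF q] intertwiner_in[OF q] pi_mult pi_inv pi_in)
      finally show ?thesis
        using True x y w by (simp add: X_apply N_def rep_series_def compress_def)
    next
      case False
      hence "u (single x l) y = 0"
        using t_x[OF \<Delta>_carrier] piece by (intro ell2_eqI) (auto simp: u_apply[OF y] ell2_apply_single)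
      thus ?thesis
        using False x y w by (simp add: X_apply N_def rep_series_def bop_zero[OF Z_bop])
    qed
  qed
  have coeffs: "op_coeffs G X = rep_series q (indicator (piece z))"
  proof (intro ext)
    fix g l
    show "op_coeffs G X g l = rep_series q (indicator (piece z)) g l"
    proof (cases "g \<in> carrier G")
      case True
      thus ?thesis using X_single[of \<one> g l] by (simp add: op_coeffs_def)
    qed (simp add: op_coeffs_def X_apply rep_series_def)
  qed
  have "left_equivariant G (carrier G) X"
    unfolding left_equivariant_def coeffs using X_bop X_single by blast
  thus ?thesis using coeffs by blast
qed

end

section \<open>Combinations of cosets\<close>

text \<open>Adding one scaled generator at a time lets each later \<open>_step\<close> lemma express
  additivity and homogeneity in a single identity.\<close>

lemma cspan_induct [consumes 1, case_names zero step]: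
  assumes "f \<in> cspan B" "P (\<lambda>x. 0)"
    and "\<And>a b c. P a \<Longrightarrow> b \<in> B \<Longrightarrow> P (\<lambda>x. a x + c * b x)"
  shows "P f"
proof -
  obtain F c where F: "finite F" "F \<subseteq> B" "f = (\<lambda>x. \<Sum>b\<in>F. c b * b x)"
    using assms(1) by (auto simp: cspan_def)
  have "P (\<lambda>x. \<Sum>b\<in>F. c b * b x)"
    using F(1,2)
  proof induction
    case empty
    thus ?case using assms(2) by simp
  next
    case (insert b F)
    have eq: "(\<lambda>x. \<Sum>b\<in>insert b F. c b * b x) = (\<lambda>x. (\<Sum>b\<in>F. c b * b x) + c b * b x)"
      using insert.hyps by (simp add: add.commute)
    show ?case unfolding eq using insert by (intro assms(3)) auto
  qed
  thus ?thesis using F(3) by simp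
qed

lemma cspan_zero: "(\<lambda>x. 0) \<in> cspan B"
  unfolding cspan_def by (rule CollectI, rule exI[of _ "{}"]) simp

lemma cspan_step:
  assumes "a \<in> cspan B" "b \<in> B"
  shows "(\<lambda>x. a x + c * b x) \<in> cspan B"
proof -
  obtain F d where F: "finite F" "F \<subseteq> B" "a = (\<lambda>x. \<Sum>b\<in>F. d b * b x)"
    using assms(1) by (auto simp: cspan_def)
  \<comment> \<open>\<open>b\<close> may already occur in \<open>F\<close>, so its coefficient is
    increased by \<open>c\<close> instead of being set to \<open>c\<close>.\<close>
  define d' where "d' b' = (if b' \<in> F then d b' else 0) + (if b' = b then c else 0)" for b'
  have "a x + c * b x = (\<Sum>b'\<in>insert b F. d' b' * b' x)" for x
  proof -
    have "(\<Sum>b'\<in>insert b F. d' b' * b' x) =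
        (\<Sum>b'\<in>insert b F. if b' \<in> F then d b' * b' x else 0) + (\<Sum>b'\<in>insert b F. if b' = b then c * b' x else 0)"
      unfolding d'_def sum.distrib[symmetric] by (intro sum.cong) (auto simp: distrib_right)
    also have "(\<Sum>b'\<in>insert b F. if b' \<in> F then d b' * b' x else 0) = a x"
      unfolding F(3) using F(1) by (intro sum.mono_neutral_cong_right) auto
    also have "(\<Sum>b'\<in>insert b F. if b' = b then c * b' x else 0) = c * b x"
      using F(1) by (simp add: sum.delta)
    finally show ?thesis by simp
  qed
  thus ?thesis
    unfolding cspan_def using F assms(2)
    by (intro CollectI exI[of _ "insert b F"] exI[of _ d']) auto
qed

lemma cspan_base:
  assumes "b \<in> B"
  shows "b \<in> cspan B"
  using cspan_step[OF cspan_zero assms, of 1] by simp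

lemma cspan_subset:
  assumes "f \<in> cspan B" "\<And>b. b \<in> B \<Longrightarrow> b \<in> cspan B'"
  shows "f \<in> cspan B'"
  using assms(1)
proof (induction rule: cspan_induct)
  case zero
  show ?case by (rule cspan_zero)
next
  case (step a b c)
  have add: "(\<lambda>x. a x + c * b' x) \<in> cspan B'" if "b' \<in> cspan B'" for b'
    using that
  proof (induction arbitrary: c rule: cspan_induct)
    case zero
    thus ?case using step by simp
  next
    case (step a' b' c')
    have "(\<lambda>x. (a x + c * a' x) + (c * c') * b' x) \<in> cspan B'"
      by (rule cspan_step[OF step.IH]) (rule step.hyps)
    thus ?case by (simp add: algebra_simps)
  qed
  show ?case by (rule add) (rule assms(2)[OF step.hyps])
qed

lemma indicator_Union_cspan:
  fixes \<C> :: "'a set set" and B :: "('a \<Rightarrow> complex) set"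
  assumes "finite \<C>" "disjoint \<C>" "\<And>C. C \<in> \<C> \<Longrightarrow> indicator C \<in> B"
  shows "indicator (\<Union>\<C>) \<in> cspan B"
  using assms
proof (induction rule: finite_induct)
  case empty
  have "indicator (\<Union>{}) = (\<lambda>x :: 'a. 0 :: complex)" by auto
  thus ?case by (simp add: cspan_zero)
next
  case (insert C \<C>)
  have "C \<inter> \<Union>\<C> = {}" using insert.hyps insert.prems(1) by (auto simp: disjoint_def)
  hence "indicator (\<Union>(insert C \<C>)) = (\<lambda>x. indicator (\<Union>\<C>) x + 1 * (indicator C x :: complex))"
    by (auto simp: indicator_def fun_eq_iff)
  moreover have "indicator (\<Union>\<C>) \<in> cspan B"
    using insert.prems by (intro insert.IH) (auto simp: disjoint_def)
  ultimately show ?case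
    using insert.prems(2)[of C] by (simp only:) (intro cspan_step, auto)
qed

lemma coset_star_step:
  "coset_star G (\<lambda>x. a x + c * b x) = (\<lambda>x. coset_star G a x + cnj c * coset_star G b x)"
  by (auto simp: coset_star_def)

context almost_normal_rep
begin

definition K0_star :: "('a \<Rightarrow> complex) set" where
  "K0_star = cspan {indicator (\<sigma> <# \<Gamma>) | \<sigma>. \<sigma> \<in> carrier G}"

section \<open>Finite decompositions of one-sided and double cosets\<close>

lemma l_coset_eq: "z \<in> x <# \<Gamma> \<Longrightarrow> x \<in> carrier G \<Longrightarrow> x <# \<Gamma> = z <# \<Gamma>"
  by (rule l_repr_independence[OF _ _ subgroup_axioms])

lemma r_coset_eq: "z \<in> \<Gamma> #> x \<Longrightarrow> x \<in> carrier G \<Longrightarrow> \<Gamma> #> x = \<Gamma> #> z"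
  by (rule repr_independence[OF _ _ subgroup_axioms])

lemma self_l_coset: "z \<in> carrier G \<Longrightarrow> z \<in> z <# \<Gamma>"
  and self_r_coset: "z \<in> carrier G \<Longrightarrow> z \<in> \<Gamma> #> z"
  by (simp_all add: mem_l_coset mem_r_coset)

lemma l_coset_carrier: "z \<in> carrier G \<Longrightarrow> x \<in> z <# \<Gamma> \<Longrightarrow> x \<in> carrier G"
  and r_coset_carrier: "z \<in> carrier G \<Longrightarrow> x \<in> \<Gamma> #> z \<Longrightarrow> x \<in> carrier G"
  by (simp_all add: mem_l_coset mem_r_coset)

text \<open>The right coset of \<sigma> \<gamma> depends only on the class of \<gamma> modulo the
  intersection of \<Gamma> with \<sigma>^-1 \<Gamma> \<sigma>, a subgroup of finite index in
  \<Gamma>.\<close>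

lemma finite_r_cosets_in_l_coset:
  assumes \<sigma>: "\<sigma> \<in> carrier G"
  shows "finite ((\<lambda>z. \<Gamma> #> z) ` (\<sigma> <# \<Gamma>))"
proof -
  \<comment> \<open>Almost normality is stated for conjugates \<tau> \<Gamma> \<tau>^-1, so it is
    used at the inverse of \<sigma>.\<close>
  define \<tau> where "\<tau> = inv \<sigma>"
  have \<tau>: "\<tau> \<in> carrier G" "inv \<tau> = \<sigma>" using \<sigma> by (simp_all add: \<tau>_def)
  define D where "D = (\<tau> <# \<Gamma> #> inv \<tau>) \<inter> \<Gamma>"
  have "finite (rcosets\<^bsub>G\<lparr>carrier := \<Gamma>\<rparr>\<^esub> D)"
    using almost_normal \<tau>(1) unfolding almost_normal_def D_def by blast
  moreover have "rcosets\<^bsub>G\<lparr>carrier := \<Gamma>\<rparr>\<^esub> D = (\<lambda>\<gamma>. D #> \<gamma>) ` \<Gamma>"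
    by (auto simp: RCOSETS_def r_coset_def)
  ultimately have "finite ((\<lambda>\<gamma>. D #> \<gamma>) ` \<Gamma>)" by simp
  hence "finite ((\<lambda>\<gamma>. \<Gamma> #> (\<sigma> \<otimes> \<gamma>)) ` \<Gamma>)"
  proof (rule finite_image_factor)
    fix \<gamma> \<gamma>' assume \<gamma>: "\<gamma> \<in> \<Gamma>" "\<gamma>' \<in> \<Gamma>" and eq: "D #> \<gamma> = D #> \<gamma>'"
    have "\<tau> \<otimes> \<one> \<otimes> inv \<tau> \<in> \<tau> <# \<Gamma> #> inv \<tau>"
      unfolding l_coset_def r_coset_def using one_K by blast
    moreover have "\<tau> \<otimes> \<one> \<otimes> inv \<tau> = \<one>" using \<tau>(1) by simp
    ultimately have "\<one> \<in> D" unfolding D_def using one_K by (metis IntI)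
    hence "\<one> \<otimes> \<gamma>' \<in> D #> \<gamma>'" by (auto simp: r_coset_def)
    hence "\<gamma>' \<in> D #> \<gamma>" using \<gamma>(2) by (simp only: eq l_one K_carrier)
    then obtain d where d: "d \<in> D" "\<gamma>' = d \<otimes> \<gamma>" by (auto simp: r_coset_def)
    then obtain k where k: "k \<in> \<Gamma>" "d = \<tau> \<otimes> k \<otimes> inv \<tau>"
      by (auto simp: D_def l_coset_def r_coset_def)
    have "\<sigma> \<otimes> \<gamma>' = \<sigma> \<otimes> (inv \<sigma> \<otimes> (k \<otimes> (\<sigma> \<otimes> \<gamma>)))"
      using d k \<sigma> \<tau> \<gamma> by (simp add: \<tau>_def m_assoc)
    also have "\<dots> = k \<otimes> (\<sigma> \<otimes> \<gamma>)"
      using k \<sigma> \<gamma> by (simp flip: m_assoc[of \<sigma> "inv \<sigma>"])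
    finally have "\<sigma> \<otimes> \<gamma>' \<in> \<Gamma> #> (\<sigma> \<otimes> \<gamma>)" using k by (auto simp: r_coset_def)
    thus "\<Gamma> #> (\<sigma> \<otimes> \<gamma>) = \<Gamma> #> (\<sigma> \<otimes> \<gamma>')"
      using \<sigma> \<gamma> by (intro r_coset_eq) auto
  qed
  moreover have "\<sigma> <# \<Gamma> = (\<lambda>\<gamma>. \<sigma> \<otimes> \<gamma>) ` \<Gamma>" by (auto simp: l_coset_def)
  ultimately show ?thesis by (simp add: image_image)
qed

lemma inv_mem_l_coset:
  assumes "\<sigma> \<in> carrier G" "x \<in> carrier G"
  shows "inv x \<in> \<sigma> <# \<Gamma> \<longleftrightarrow> x \<in> \<Gamma> #> inv \<sigma>"
proof -
  have "inv \<sigma> \<otimes> inv x = inv (x \<otimes> \<sigma>)" using assms by (simp add: inv_mult_group)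
  moreover have "inv y \<in> \<Gamma> \<longleftrightarrow> y \<in> \<Gamma>" if "y \<in> carrier G" for y
    using that by (metis inv_K inv_inv)
  ultimately show ?thesis using assms by (simp add: mem_l_coset mem_r_coset)
qed

lemma inv_mem_r_coset:
  assumes "\<sigma> \<in> carrier G" "x \<in> carrier G"
  shows "inv x \<in> \<Gamma> #> \<sigma> \<longleftrightarrow> x \<in> inv \<sigma> <# \<Gamma>"
  using inv_mem_l_coset[of "inv \<sigma>" "inv x"] assms by simp

text \<open>Inversion exchanges left and right cosets and reduces this to the previous
  finiteness.\<close>

lemma finite_l_cosets_in_r_coset:
  assumes \<sigma>: "\<sigma> \<in> carrier G"
  shows "finite ((\<lambda>z. z <# \<Gamma>) ` (\<Gamma> #> \<sigma>))"
proof (rule finite_image_factor)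
  have "(\<lambda>z. \<Gamma> #> inv z) ` (\<Gamma> #> \<sigma>) \<subseteq> (\<lambda>z. \<Gamma> #> z) ` (inv \<sigma> <# \<Gamma>)"
    using \<sigma> inv_mem_l_coset[of "inv \<sigma>"] r_coset_carrier[OF \<sigma>] by auto
  thus "finite ((\<lambda>z. \<Gamma> #> inv z) ` (\<Gamma> #> \<sigma>))"
    using finite_r_cosets_in_l_coset[of "inv \<sigma>"] \<sigma> by (auto intro: finite_subset)
  fix x y assume xy: "x \<in> \<Gamma> #> \<sigma>" "y \<in> \<Gamma> #> \<sigma>" and eq: "\<Gamma> #> inv x = \<Gamma> #> inv y"
  have c: "x \<in> carrier G" "y \<in> carrier G" using xy r_coset_carrier[OF \<sigma>] by auto
  have "inv y \<in> \<Gamma> #> inv x" unfolding eq using c by (simp add: self_r_coset)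
  hence "y \<in> x <# \<Gamma>" using c inv_mem_r_coset[of "inv x" y] by simp
  thus "x <# \<Gamma> = y <# \<Gamma>" using c by (intro l_coset_eq)
qed

lemma indicator_piece_cspan:
  assumes "A \<subseteq> carrier G" "\<And>z. z \<in> A \<Longrightarrow> piece z \<subseteq> A" "finite (piece ` A)"
  shows "indicator A \<in> cspan {indicator (piece z) | z. z \<in> carrier G}"
proof -
  have "A = \<Union>(piece ` A)"
  proof (intro subset_antisym subsetI)
    fix z assume "z \<in> A"
    moreover have "z \<in> piece z" using \<open>z \<in> A\<close> assms(1) by (auto simp: piece_def self_l_coset self_r_coset)
    ultimately show "z \<in> \<Union>(piece ` A)" by blast
  qed (use assms(2) in blast)
  moreover have "disjoint (piece ` A)"
  proof (rule disjointI)
    fix C C' assume "C \<in> piece ` A" "C' \<in> piece ` A" "C \<noteq> C'"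
    then obtain z z' where z: "z \<in> carrier G" "z' \<in> carrier G" "C = piece z" "C' = piece z'" "piece z \<noteq> piece z'"
      using assms(1) by blast
    have "piece x = piece y" if "y \<in> piece x" "x \<in> carrier G" for x y
      using that l_coset_eq[of y x] r_coset_eq[of y x] by (auto simp: piece_def)
    thus "C \<inter> C' = {}" using z by (metis disjoint_iff)
  qed
  moreover have "indicator (\<Union>(piece ` A)) \<in> cspan {indicator (piece z) | z. z \<in> carrier G}" if "disjoint (piece ` A)"
    using assms(1) by (intro indicator_Union_cspan that assms(3)) auto
  ultimately show ?thesis by metis
qed

text \<open>Inside \<sigma> \<Gamma> each piece is the intersection of \<sigma> \<Gamma> with a
  right coset, and only finitely many right cosets meet \<sigma> \<Gamma>.\<close>

lemma indicator_l_coset_pieces: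
  assumes "\<sigma> \<in> carrier G"
  shows "indicator (\<sigma> <# \<Gamma>) \<in> cspan {indicator (piece z) | z. z \<in> carrier G}"
proof (rule indicator_piece_cspan)
  show "\<sigma> <# \<Gamma> \<subseteq> carrier G" using l_coset_carrier[OF assms] by blast
  show "piece z \<subseteq> \<sigma> <# \<Gamma>" if "z \<in> \<sigma> <# \<Gamma>" for z
    using l_coset_eq[OF that assms] by (auto simp: piece_def)
  have "piece ` (\<sigma> <# \<Gamma>) = (\<lambda>C. (\<sigma> <# \<Gamma>) \<inter> C) ` ((\<lambda>z. \<Gamma> #> z) ` (\<sigma> <# \<Gamma>))"
    unfolding image_image
  proof (rule image_cong[OF refl])
    show "piece z = (\<sigma> <# \<Gamma>) \<inter> (\<Gamma> #> z)" if "z \<in> \<sigma> <# \<Gamma>" for z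
      unfolding piece_def l_coset_eq[OF that assms] ..
  qed
  thus "finite (piece ` (\<sigma> <# \<Gamma>))" using finite_r_cosets_in_l_coset[OF assms] by simp
qed

lemma indicator_r_coset_pieces:
  assumes "\<sigma> \<in> carrier G"
  shows "indicator (\<Gamma> #> \<sigma>) \<in> cspan {indicator (piece z) | z. z \<in> carrier G}"
proof (rule indicator_piece_cspan)
  show "\<Gamma> #> \<sigma> \<subseteq> carrier G" using r_coset_carrier[OF assms] by blast
  show "piece z \<subseteq> \<Gamma> #> \<sigma>" if "z \<in> \<Gamma> #> \<sigma>" for z
    using r_coset_eq[OF that assms] by (auto simp: piece_def)
  have "piece ` (\<Gamma> #> \<sigma>) = (\<lambda>C. C \<inter> (\<Gamma> #> \<sigma>)) ` ((\<lambda>z. z <# \<Gamma>) ` (\<Gamma> #> \<sigma>))"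
    unfolding image_image
  proof (rule image_cong[OF refl])
    show "piece z = (z <# \<Gamma>) \<inter> (\<Gamma> #> \<sigma>)" if "z \<in> \<Gamma> #> \<sigma>" for z
      unfolding piece_def r_coset_eq[OF that assms] ..
  qed
  thus "finite (piece ` (\<Gamma> #> \<sigma>))" using finite_l_cosets_in_r_coset[OF assms] by simp
qed

lemma mem_double_coset:
  "x \<in> double_coset G \<Gamma> \<sigma> \<longleftrightarrow> (\<exists>a\<in>\<Gamma>. \<exists>b\<in>\<Gamma>. x = a \<otimes> \<sigma> \<otimes> b)"
  by (auto simp: double_coset_def set_mult_def r_coset_def)

text \<open>The double coset is the disjoint union of the finitely many right cosets that meet
  \<sigma> \<Gamma>.\<close>

lemma double_coset_K0:
  assumes \<sigma>: "\<sigma> \<in> carrier G"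
  shows "indicator (double_coset G \<Gamma> \<sigma>) \<in> K0 G \<Gamma>"
proof -
  let ?\<C> = "(\<lambda>z. \<Gamma> #> z) ` (\<sigma> <# \<Gamma>)"
  have "double_coset G \<Gamma> \<sigma> = \<Union>?\<C>"
  proof (intro subset_antisym subsetI)
    fix x assume "x \<in> double_coset G \<Gamma> \<sigma>"
    then obtain a b where "a \<in> \<Gamma>" "b \<in> \<Gamma>" "x = a \<otimes> (\<sigma> \<otimes> b)"
      using \<sigma> by (auto simp: mem_double_coset m_assoc)
    thus "x \<in> \<Union>?\<C>" by (auto simp: l_coset_def r_coset_def)
  next
    fix x assume "x \<in> \<Union>?\<C>"
    then obtain a b where "a \<in> \<Gamma>" "b \<in> \<Gamma>" "x = a \<otimes> (\<sigma> \<otimes> b)"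
      by (auto simp: l_coset_def r_coset_def)
    thus "x \<in> double_coset G \<Gamma> \<sigma>" using \<sigma> by (auto simp: mem_double_coset m_assoc)
  qed
  moreover have "disjoint ?\<C>"
  proof (rule disjointI)
    fix C C' assume "C \<in> ?\<C>" "C' \<in> ?\<C>" "C \<noteq> C'"
    then obtain z z' where z: "z \<in> carrier G" "z' \<in> carrier G" "C = \<Gamma> #> z" "C' = \<Gamma> #> z'" "C \<noteq> C'"
      using l_coset_carrier[OF \<sigma>] by blast
    thus "C \<inter> C' = {}" using r_coset_eq[of _ z] r_coset_eq[of _ z'] by (metis disjoint_iff)
  qed
  ultimately show ?thesis
    unfolding K0_def using l_coset_carrier[OF \<sigma>]
    by (simp only:) (intro indicator_Union_cspan finite_r_cosets_in_l_coset \<sigma>, auto)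
qed

lemma inv_mem_double_coset:
  assumes "\<sigma> \<in> carrier G" "x \<in> carrier G"
  shows "inv x \<in> double_coset G \<Gamma> \<sigma> \<longleftrightarrow> x \<in> double_coset G \<Gamma> (inv \<sigma>)"
proof -
  have *: "inv x \<in> double_coset G \<Gamma> (inv \<sigma>)" if x: "x \<in> double_coset G \<Gamma> \<sigma>" "\<sigma> \<in> carrier G" for x \<sigma>
  proof -
    obtain a b where ab: "a \<in> \<Gamma>" "b \<in> \<Gamma>" "x = a \<otimes> \<sigma> \<otimes> b" using x by (auto simp: mem_double_coset)
    have "inv x = inv b \<otimes> inv \<sigma> \<otimes> inv a" using ab x(2) by (simp add: inv_mult_group m_assoc)
    thus ?thesis unfolding mem_double_coset using ab by blast
  qed
  show ?thesis using *[of x "inv \<sigma>"] *[of "inv x" \<sigma>] assms by auto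
qed

lemma coset_star_indicator:
  assumes "\<And>x. x \<in> carrier G \<Longrightarrow> inv x \<in> A \<longleftrightarrow> x \<in> B" "B \<subseteq> carrier G"
  shows "coset_star G (indicator A) = indicator B"
  using assms by (auto simp: coset_star_def indicator_def fun_eq_iff)

lemma coset_star_r_coset:
  assumes "\<sigma> \<in> carrier G"
  shows "coset_star G (indicator (\<Gamma> #> \<sigma>)) = indicator (inv \<sigma> <# \<Gamma>)"
proof (rule coset_star_indicator)
  show "inv \<sigma> <# \<Gamma> \<subseteq> carrier G" using l_coset_carrier[OF inv_closed[OF assms]] by blast
qed (rule inv_mem_r_coset[OF assms])

lemma coset_star_double_coset:
  assumes "\<sigma> \<in> carrier G"
  shows "coset_star G (indicator (double_coset G \<Gamma> \<sigma>)) = indicator (double_coset G \<Gamma> (inv \<sigma>))"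
proof (rule coset_star_indicator)
  show "double_coset G \<Gamma> (inv \<sigma>) \<subseteq> carrier G" using assms by (auto simp: mem_double_coset)
qed (rule inv_mem_double_coset[OF assms])

lemma coset_star_K0:
  assumes "a \<in> K0 G \<Gamma>"
  shows "coset_star G a \<in> K0_star"
  using assms unfolding K0_def
proof (induction rule: cspan_induct)
  case zero
  have "coset_star G (\<lambda>x. 0) = (\<lambda>x. 0)" by (auto simp: coset_star_def)
  thus ?case unfolding K0_star_def using cspan_zero by metis
next
  case (step a b c)
  then obtain \<sigma> where \<sigma>: "\<sigma> \<in> carrier G" "b = indicator (\<Gamma> #> \<sigma>)" by blast
  hence "coset_star G b = indicator (inv \<sigma> <# \<Gamma>)" by (simp add: coset_star_r_coset)
  thus ?case
    unfolding coset_star_step using step.IH \<sigma>(1) unfolding K0_star_def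
    by (intro cspan_step) auto
qed

text \<open>The star turns the right-coset decomposition of the inverse double coset into a
  left-coset decomposition. Hecke elements can thus stand on either side of a product.\<close>

lemma double_coset_K0_star:
  assumes "\<sigma> \<in> carrier G"
  shows "indicator (double_coset G \<Gamma> \<sigma>) \<in> K0_star"
  using coset_star_K0[OF double_coset_K0[of "inv \<sigma>"]] coset_star_double_coset[of "inv \<sigma>"] assms by simp

lemma Hecke_K0: "a \<in> Hecke G \<Gamma> \<Longrightarrow> a \<in> K0 G \<Gamma>"
  unfolding Hecke_def K0_def
  by (erule cspan_subset) (use double_coset_K0 in \<open>auto simp: K0_def\<close>)

lemma Hecke_K0_star: "a \<in> Hecke G \<Gamma> \<Longrightarrow> a \<in> K0_star"
  unfolding Hecke_def K0_star_def
  by (erule cspan_subset) (use double_coset_K0_star in \<open>auto simp: K0_star_def\<close>)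

lemma one_l_coset: "\<one> <# \<Gamma> = \<Gamma>"
  by (auto simp: l_coset_def)

lemma r_coset_one: "\<Gamma> #> \<one> = \<Gamma>"
  by (auto simp: r_coset_def)

lemma l_coset_one: "\<sigma> \<in> carrier G \<Longrightarrow> \<sigma> <# \<Gamma> #> \<one> = \<sigma> <# \<Gamma>"
  by (auto simp: r_coset_def l_coset_def)

lemma K0_base: "\<sigma> \<in> carrier G \<Longrightarrow> indicator (\<Gamma> #> \<sigma>) \<in> K0 G \<Gamma>"
  unfolding K0_def by (rule cspan_base) auto

lemma K0_star_base: "\<sigma> \<in> carrier G \<Longrightarrow> indicator (\<sigma> <# \<Gamma>) \<in> K0_star"
  unfolding K0_star_def by (rule cspan_base) auto

lemma K0K0_base:
  "\<sigma>\<^sub>1 \<in> carrier G \<Longrightarrow> \<sigma>\<^sub>2 \<in> carrier G \<Longrightarrow> indicator (\<sigma>\<^sub>1 <# \<Gamma> #> \<sigma>\<^sub>2) \<in> K0K0 G \<Gamma>"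
  unfolding K0K0_def by (rule cspan_base) auto

end

section \<open>Products of series\<close>

lemma has_sum_scaleC:
  fixes f :: "'i \<Rightarrow> 'b::complex_inner"
  shows "(f has_sum s) A \<Longrightarrow> ((\<lambda>i. c *\<^sub>C f i) has_sum c *\<^sub>C s) A"
  by (rule has_sum_bounded_linear[OF bounded_linear_scaleC])

context almost_normal_rep
begin

lemma single_one_H: "single \<one> l \<in> H"
  by simp

lemma rep_series_vector_step:
  assumes q: "intertwiner q"
  shows "rep_series q a g (v + c *\<^sub>C w) = rep_series q a g v + c *\<^sub>C rep_series q a g w"
proof (cases "g \<in> carrier G")
  case True
  have b: "(\<lambda>f. \<pi> (inv g) (q f)) \<in> bop H"
    by (rule bop_comp[OF pi_bop intertwiner_bop[OF q]]) (simp add: True)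
  show ?thesis
    using True
    by (simp add: rep_series_def compress_def single_add single_scaleC bop_add[OF b] bop_scaleC[OF b]
        scaleC_add_right scaleC_scaleC mult.commute)
qed (simp add: rep_series_def)

lemma rep_series_vector_zero: "intertwiner q \<Longrightarrow> rep_series q a g 0 = 0"
  using rep_series_vector_step[of q a g 0 1 0] by simp

lemma rep_series_step:
  "rep_series q (\<lambda>x. a x + c * b x) g l = rep_series q a g l + c *\<^sub>C rep_series q b g l"
  by (simp add: rep_series_def scaleC_add_left scaleC_scaleC)

lemma rep_series_zero: "rep_series q (\<lambda>x. 0) g l = 0"
  by (simp add: rep_series_def)

text \<open>Both intertwiners are universally quantified, so one bilinear statement covers the four
  ways of inserting \<open>id\<close> or \<open>p\<close> into the factors.\<close>

definition has_series_product :: "('a \<Rightarrow> complex) \<Rightarrow> ('a \<Rightarrow> complex) \<Rightarrow> ('a \<Rightarrow> complex) \<Rightarrow> bool" where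
  "has_series_product c b d \<longleftrightarrow> (\<forall>q r. intertwiner q \<longrightarrow> intertwiner r \<longrightarrow> (\<forall>k\<in>carrier G. \<forall>l.
     ((\<lambda>h. rep_series q c (inv h \<otimes> k) (rep_series r b h l)) has_sum
       rep_series (\<lambda>f. q (r f)) d k l) (carrier G)))"

lemma has_series_productD:
  "has_series_product c b d \<Longrightarrow> intertwiner q \<Longrightarrow> intertwiner r \<Longrightarrow> k \<in> carrier G \<Longrightarrow>
     ((\<lambda>h. rep_series q c (inv h \<otimes> k) (rep_series r b h l)) has_sum
       rep_series (\<lambda>f. q (r f)) d k l) (carrier G)"
  by (simp add: has_series_product_def)

text \<open>Only \<open>h \<in> \<sigma>\<^sub>2\<inverse>\<Gamma> \<inter> k\<sigma>\<^sub>1\<Gamma>\<close> contribute to the coefficient at \<open>k\<close>. The intersection is empty or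
  a whole coset, and in the latter case \<open>\<Sum>\<^sub>h \<pi>(h) P\<^sub>L \<pi>(h)\<inverse> = 1\<close> over it.\<close>

lemma has_series_product_cosets:
  assumes \<sigma>: "\<sigma>\<^sub>1 \<in> carrier G" "\<sigma>\<^sub>2 \<in> carrier G"
  shows "has_series_product (indicator (\<sigma>\<^sub>1 <# \<Gamma>)) (indicator (\<Gamma> #> \<sigma>\<^sub>2)) (indicator (\<sigma>\<^sub>1 <# \<Gamma> #> \<sigma>\<^sub>2))"
  unfolding has_series_product_def
proof (intro allI impI ballI)
  fix q r k l assume q: "intertwiner q" and r: "intertwiner r" and k: "k \<in> carrier G"
  define v where "v = r (single \<one> l)"
  have v: "v \<in> H" unfolding v_def by (intro intertwiner_in[OF r] single_one_H)
  let ?W = "(inv \<sigma>\<^sub>2) <# \<Gamma>"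
  let ?t = "\<lambda>h. rep_series q (indicator (\<sigma>\<^sub>1 <# \<Gamma>)) (inv h \<otimes> k) (rep_series r (indicator (\<Gamma> #> \<sigma>\<^sub>2)) h l)"
  have W: "inv h \<in> \<Gamma> #> \<sigma>\<^sub>2 \<longleftrightarrow> h \<in> ?W" if "h \<in> carrier G" for h
    by (rule inv_mem_r_coset[OF \<sigma>(2) that])
  have W_carrier: "?W \<subseteq> carrier G"
    using l_coset_carrier[OF inv_closed[OF \<sigma>(2)]] by blast
  have inv_hk: "inv (inv h \<otimes> k) = inv k \<otimes> h" if "h \<in> carrier G" for h
    using that k by (simp add: inv_mult_group)
  have cancel: "inv x \<otimes> (x \<otimes> y) = y" "x \<otimes> (inv x \<otimes> y) = y" if "x \<in> carrier G" "y \<in> carrier G" for x y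
    using that by (simp_all add: m_assoc[symmetric])
  note q_zero = rep_series_vector_zero[OF q]
  have zero: "?t h = 0" if "h \<in> carrier G" "h \<notin> ?W" for h
    using that W by (simp add: rep_series_def[of r] q_zero)
  show "(?t has_sum rep_series (\<lambda>f. q (r f)) (indicator (\<sigma>\<^sub>1 <# \<Gamma> #> \<sigma>\<^sub>2)) k l) (carrier G)"
  proof (cases "inv k \<in> \<sigma>\<^sub>1 <# \<Gamma> #> \<sigma>\<^sub>2")
    case True
    then obtain \<gamma> where \<gamma>: "\<gamma> \<in> \<Gamma>" "inv k = \<sigma>\<^sub>1 \<otimes> \<gamma> \<otimes> \<sigma>\<^sub>2" by (auto simp: l_coset_def r_coset_def)
    \<comment> \<open>Splitting \<pi>(k^-1 h) and moving \<open>q\<close> past \<pi>(h) exhibits the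
      summand as the fixed operator \<pi>(k^-1) q applied to \<pi>(h) P_L \<pi>(h)^-1 v, ready for
      \<open>pi_recover\<close>.\<close>
    have summand: "?t h = ell2_apply (\<pi> (inv k) (q (\<pi> h (single \<one> (ell2_apply (\<pi> (inv h) v) \<one>))))) \<one>"
      if h: "h \<in> ?W" for h
    proof -
      have hc: "h \<in> carrier G" using h W_carrier by blast
      obtain \<gamma>' where \<gamma>': "\<gamma>' \<in> \<Gamma>" "h = inv \<sigma>\<^sub>2 \<otimes> \<gamma>'" using h by (auto simp: l_coset_def)
      have "inv k \<otimes> h = \<sigma>\<^sub>1 \<otimes> (\<gamma> \<otimes> \<gamma>')"
        unfolding \<gamma>(2) \<gamma>'(2) using \<gamma>(1) \<gamma>'(1) \<sigma> by (simp add: m_assoc cancel)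
      hence "inv k \<otimes> h \<in> \<sigma>\<^sub>1 <# \<Gamma>" using \<gamma>(1) \<gamma>'(1) by (auto simp: l_coset_def)
      hence "?t h = ell2_apply (\<pi> (inv k \<otimes> h) (q (single \<one> (ell2_apply (\<pi> (inv h) v) \<one>)))) \<one>"
        using hc k W h by (simp add: rep_series_def compress_def inv_hk v_def)
      also have "\<pi> (inv k \<otimes> h) (q (single \<one> m)) = \<pi> (inv k) (q (\<pi> h (single \<one> m)))" for m
        using hc k by (simp add: pi_mult intertwiner_in[OF q] intertwiner_pi[OF q])
      finally show ?thesis .
    qed
    have b: "(\<lambda>f. \<pi> (inv k) (q f)) \<in> bop H"
      by (rule bop_comp[OF pi_bop intertwiner_bop[OF q]]) (simp add: k)
    have "((\<lambda>h. \<pi> (inv k) (q (\<pi> h (single \<one> (ell2_apply (\<pi> (inv h) v) \<one>))))) has_sum \<pi> (inv k) (q v)) ?W"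
    proof (rule bop_has_sum[OF b _ v pi_recover[OF v inv_closed[OF \<sigma>(2)]]])
      fix h assume "h \<in> ?W"
      thus "\<pi> h (single \<one> (ell2_apply (\<pi> (inv h) v) \<one>)) \<in> H"
        using W_carrier by (intro pi_in single_one_H) blast
    qed
    hence "((\<lambda>h. ell2_apply (\<pi> (inv k) (q (\<pi> h (single \<one> (ell2_apply (\<pi> (inv h) v) \<one>))))) \<one>) has_sum
        ell2_apply (\<pi> (inv k) (q v)) \<one>) ?W"
      by (rule has_sum_bounded_linear[OF bounded_linear_ell2_apply])
    hence "(?t has_sum ell2_apply (\<pi> (inv k) (q v)) \<one>) (carrier G)"
      by (rule has_sum_cong_neutral[THEN iffD1, rotated -1]) (use W_carrier zero summand in auto)
    moreover have "rep_series (\<lambda>f. q (r f)) (indicator (\<sigma>\<^sub>1 <# \<Gamma> #> \<sigma>\<^sub>2)) k l = ell2_apply (\<pi> (inv k) (q v)) \<one>"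
      using True k by (simp add: rep_series_def compress_def v_def)
    ultimately show ?thesis by simp
  next
    case False
    have "?t h = 0" if h: "h \<in> carrier G" for h
    proof (cases "h \<in> ?W")
      case True
      then obtain \<gamma>' where \<gamma>': "\<gamma>' \<in> \<Gamma>" "h = inv \<sigma>\<^sub>2 \<otimes> \<gamma>'" by (auto simp: l_coset_def)
      have "inv k \<otimes> h \<notin> \<sigma>\<^sub>1 <# \<Gamma>"
      proof
        assume "inv k \<otimes> h \<in> \<sigma>\<^sub>1 <# \<Gamma>"
        then obtain \<gamma> where \<gamma>: "\<gamma> \<in> \<Gamma>" "inv k \<otimes> h = \<sigma>\<^sub>1 \<otimes> \<gamma>" by (auto simp: l_coset_def)
        have "inv k = (inv k \<otimes> h) \<otimes> inv h" using h k by (simp add: m_assoc)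
        also have "\<dots> = \<sigma>\<^sub>1 \<otimes> (\<gamma> \<otimes> inv \<gamma>') \<otimes> \<sigma>\<^sub>2"
          unfolding \<gamma>(2) using \<gamma>(1) \<gamma>' \<sigma> by (simp add: inv_mult_group m_assoc)
        finally show False using False \<gamma>(1) \<gamma>'(1) by (auto simp: l_coset_def r_coset_def)
      qed
      thus ?thesis using h k by (simp add: rep_series_def[of q] inv_hk)
    qed (use zero h in simp)
    moreover have "rep_series (\<lambda>f. q (r f)) (indicator (\<sigma>\<^sub>1 <# \<Gamma> #> \<sigma>\<^sub>2)) k l = 0"
      using False by (simp add: rep_series_def)
    ultimately show ?thesis by (simp add: has_sum_0)
  qed
qed

section \<open>Bilinear extension of the product formula, and the unit of coset
  multiplication\<close>

lemma has_series_product_zero: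
  "has_series_product (\<lambda>x. 0) b (\<lambda>x. 0)"
  by (auto simp: has_series_product_def rep_series_zero intro!: has_sum_0)

lemma has_series_product_zero_right:
  "has_series_product a (\<lambda>x. 0) (\<lambda>x. 0)"
  unfolding has_series_product_def
proof (intro allI impI ballI)
  fix q r k l assume q: "intertwiner q"
  show "((\<lambda>h. rep_series q a (inv h \<otimes> k) (rep_series r (\<lambda>x. 0) h l)) has_sum
      rep_series (\<lambda>f. q (r f)) (\<lambda>x. 0) k l) (carrier G)"
    by (simp add: rep_series_zero rep_series_vector_zero[OF q])
qed

lemma has_series_product_step_left:
  assumes "has_series_product a b d" "has_series_product a' b d'"
  shows "has_series_product (\<lambda>x. a x + c * a' x) b (\<lambda>x. d x + c * d' x)"
  unfolding has_series_product_def rep_series_step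
  by (intro allI impI ballI has_sum_add has_sum_scaleC has_series_productD assms)

lemma has_series_product_step_right:
  assumes "has_series_product a b d" "has_series_product a b' d'"
  shows "has_series_product a (\<lambda>x. b x + c * b' x) (\<lambda>x. d x + c * d' x)"
  unfolding has_series_product_def
proof (intro allI impI ballI)
  fix q r k l assume q: "intertwiner q" and "intertwiner r" "k \<in> carrier G"
  thus "((\<lambda>h. rep_series q a (inv h \<otimes> k) (rep_series r (\<lambda>x. b x + c * b' x) h l)) has_sum
      rep_series (\<lambda>f. q (r f)) (\<lambda>x. d x + c * d' x) k l) (carrier G)"
    unfolding rep_series_step rep_series_vector_step[OF q]
    by (intro has_sum_add has_sum_scaleC has_series_productD assms)
qed

text \<open>Stated through the very representatives that \<open>coset_mult\<close> chooses, so its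
  summands vanish off a finite set whatever the second factor is. This summability makes the
  infinite sum additive.\<close>

definition finite_coset_support :: "('a \<Rightarrow> complex) \<Rightarrow> bool" where
  "finite_coset_support a \<longleftrightarrow> finite {C \<in> lcosets\<^bsub>G\<^esub> \<Gamma>. a (SOME x. x \<in> C) \<noteq> 0}"

lemma finite_coset_support_step:
  assumes "finite_coset_support a" "finite_coset_support b"
  shows "finite_coset_support (\<lambda>x. a x + c * b x)"
  unfolding finite_coset_support_def
  by (rule finite_subset[OF _ finite_UnI[OF assms[unfolded finite_coset_support_def]]]) auto

lemma finite_coset_support_indicator:
  assumes "\<sigma> \<in> carrier G"
  shows "finite_coset_support (indicator (\<sigma> <# \<Gamma>))"
  unfolding finite_coset_support_def
proof (rule finite_subset)
  show "{C \<in> lcosets\<^bsub>G\<^esub> \<Gamma>. indicator (\<sigma> <# \<Gamma>) (SOME x. x \<in> C) \<noteq> (0 :: complex)} \<subseteq> {\<sigma> <# \<Gamma>}"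
  proof
    fix C assume "C \<in> {C \<in> lcosets\<^bsub>G\<^esub> \<Gamma>. indicator (\<sigma> <# \<Gamma>) (SOME x. x \<in> C) \<noteq> (0 :: complex)}"
    hence C: "C \<in> lcosets\<^bsub>G\<^esub> \<Gamma>" "(SOME x. x \<in> C) \<in> \<sigma> <# \<Gamma>"
      by (auto simp: indicator_def split: if_splits)
    then obtain a where a: "a \<in> carrier G" "C = a <# \<Gamma>" by (auto simp: LCOSETS_def)
    have "(SOME x. x \<in> C) \<in> C" using self_l_coset[OF a(1)] unfolding a(2) by (rule someI)
    hence "C = (SOME x. x \<in> C) <# \<Gamma>" using l_coset_eq[OF _ a(1)] unfolding a(2) by blast
    thus "C \<in> {\<sigma> <# \<Gamma>}" using l_coset_eq[OF C(2) assms] by simp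
  qed
qed simp

lemma coset_mult_summable:
  assumes "finite_coset_support a"
  shows "(\<lambda>C. a (SOME x. x \<in> C) * b C :: complex) summable_on (lcosets\<^bsub>G\<^esub> \<Gamma>)"
  by (rule finite_nonzero_values_imp_summable_on)
    (rule finite_subset[OF _ assms[unfolded finite_coset_support_def]], auto)

lemma coset_mult_step_left:
  assumes "finite_coset_support a" "finite_coset_support a'"
  shows "coset_mult G \<Gamma> (\<lambda>x. a x + c * a' x) b = (\<lambda>x. coset_mult G \<Gamma> a b x + c * coset_mult G \<Gamma> a' b x)"
proof
  fix \<theta>
  have "(\<Sum>\<^sub>\<infinity>C\<in>lcosets\<^bsub>G\<^esub> \<Gamma>. (a (SOME x. x \<in> C) + c * a' (SOME x. x \<in> C)) * b (inv (SOME x. x \<in> C) \<otimes> \<theta>)) =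
      (\<Sum>\<^sub>\<infinity>C\<in>lcosets\<^bsub>G\<^esub> \<Gamma>. a (SOME x. x \<in> C) * b (inv (SOME x. x \<in> C) \<otimes> \<theta>) +
         c * (a' (SOME x. x \<in> C) * b (inv (SOME x. x \<in> C) \<otimes> \<theta>)))"
    by (rule infsum_cong) (simp add: algebra_simps)
  also have "\<dots> = (\<Sum>\<^sub>\<infinity>C\<in>lcosets\<^bsub>G\<^esub> \<Gamma>. a (SOME x. x \<in> C) * b (inv (SOME x. x \<in> C) \<otimes> \<theta>)) +
      c * (\<Sum>\<^sub>\<infinity>C\<in>lcosets\<^bsub>G\<^esub> \<Gamma>. a' (SOME x. x \<in> C) * b (inv (SOME x. x \<in> C) \<otimes> \<theta>))"
    by (subst infsum_add)
      (intro summable_on_cmult_right coset_mult_summable assms, intro summable_on_cmult_right coset_mult_summable assms,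
        simp add: infsum_cmult_right')
  finally show "coset_mult G \<Gamma> (\<lambda>x. a x + c * a' x) b \<theta> = coset_mult G \<Gamma> a b \<theta> + c * coset_mult G \<Gamma> a' b \<theta>"
    by (simp add: coset_mult_def Let_def)
qed

lemma coset_mult_step_right:
  assumes "finite_coset_support a"
  shows "coset_mult G \<Gamma> a (\<lambda>x. b x + c * b' x) = (\<lambda>x. coset_mult G \<Gamma> a b x + c * coset_mult G \<Gamma> a b' x)"
proof
  fix \<theta>
  have "(\<Sum>\<^sub>\<infinity>C\<in>lcosets\<^bsub>G\<^esub> \<Gamma>. a (SOME x. x \<in> C) * (b (inv (SOME x. x \<in> C) \<otimes> \<theta>) + c * b' (inv (SOME x. x \<in> C) \<otimes> \<theta>))) =
      (\<Sum>\<^sub>\<infinity>C\<in>lcosets\<^bsub>G\<^esub> \<Gamma>. a (SOME x. x \<in> C) * b (inv (SOME x. x \<in> C) \<otimes> \<theta>) +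
         c * (a (SOME x. x \<in> C) * b' (inv (SOME x. x \<in> C) \<otimes> \<theta>)))"
    by (rule infsum_cong) (simp add: algebra_simps)
  also have "\<dots> = (\<Sum>\<^sub>\<infinity>C\<in>lcosets\<^bsub>G\<^esub> \<Gamma>. a (SOME x. x \<in> C) * b (inv (SOME x. x \<in> C) \<otimes> \<theta>)) +
      c * (\<Sum>\<^sub>\<infinity>C\<in>lcosets\<^bsub>G\<^esub> \<Gamma>. a (SOME x. x \<in> C) * b' (inv (SOME x. x \<in> C) \<otimes> \<theta>))"
    by (subst infsum_add)
      (intro summable_on_cmult_right coset_mult_summable assms, intro summable_on_cmult_right coset_mult_summable assms,
        simp add: infsum_cmult_right')
  finally show "coset_mult G \<Gamma> a (\<lambda>x. b x + c * b' x) \<theta> = coset_mult G \<Gamma> a b \<theta> + c * coset_mult G \<Gamma> a b' \<theta>"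
    by (simp add: coset_mult_def Let_def)
qed

lemma coset_mult_zero: "coset_mult G \<Gamma> (\<lambda>x. 0) b = (\<lambda>x. 0)" "coset_mult G \<Gamma> a (\<lambda>x. 0) = (\<lambda>x. 0)"
  by (auto simp: coset_mult_def)

lemma K0_star_support:
  assumes "a \<in> K0_star"
  shows "finite_coset_support a"
  using assms unfolding K0_star_def
proof (induction rule: cspan_induct)
  case zero
  show ?case by (simp add: finite_coset_support_def)
next
  case (step a b c)
  then obtain \<sigma> where \<sigma>: "\<sigma> \<in> carrier G" "b = indicator (\<sigma> <# \<Gamma>)" by blast
  show ?case
    unfolding \<sigma>(2) by (rule finite_coset_support_step[OF step.IH finite_coset_support_indicator[OF \<sigma>(1)]])
qed

lemma has_series_product_coset_mult:
  assumes "a \<in> K0_star" "b \<in> K0 G \<Gamma>"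
  shows "has_series_product a b (coset_mult G \<Gamma> a b)"
  using assms(2) unfolding K0_def
proof (induction rule: cspan_induct)
  case zero
  show ?case by (simp add: coset_mult_zero has_series_product_zero_right)
next
  case (step b b' c)
  then obtain \<sigma> where \<sigma>: "\<sigma> \<in> carrier G" "b' = indicator (\<Gamma> #> \<sigma>)" by blast
  \<comment> \<open>Membership in \<open>K0_star\<close> is carried through the induction because
    additivity in the left factor needs finite support of the partial combination.\<close>
  have "has_series_product a (indicator (\<Gamma> #> \<sigma>)) (coset_mult G \<Gamma> a (indicator (\<Gamma> #> \<sigma>)))
      \<and> a \<in> K0_star"
    using assms(1) unfolding K0_star_def
  proof (induction rule: cspan_induct)
    case zero
    show ?case by (simp add: coset_mult_zero has_series_product_zero cspan_zero)
  next
    case (step a a' d)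
    then obtain \<tau> where \<tau>: "\<tau> \<in> carrier G" "a' = indicator (\<tau> <# \<Gamma>)" by blast
    have a: "finite_coset_support a" using step.IH by (intro K0_star_support) (simp add: K0_star_def)
    show ?case
    proof
      show "has_series_product (\<lambda>x. a x + d * a' x) (indicator (\<Gamma> #> \<sigma>))
          (coset_mult G \<Gamma> (\<lambda>x. a x + d * a' x) (indicator (\<Gamma> #> \<sigma>)))"
        unfolding \<tau>(2) coset_mult_step_left[OF a finite_coset_support_indicator[OF \<tau>(1)]]
          coset_mult_indicator[OF is_group subgroup_axioms \<tau>(1) \<sigma>(1)]
        by (rule has_series_product_step_left[OF conjunct1[OF step.IH] has_series_product_cosets[OF \<tau>(1) \<sigma>(1)]])
      show "(\<lambda>x. a x + d * a' x) \<in> cspan {indicator (\<sigma> <# \<Gamma>) |\<sigma>. \<sigma> \<in> carrier G}"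
        using step.IH step.hyps by (intro cspan_step) auto
    qed
  qed
  thus ?case
    unfolding \<sigma>(2) coset_mult_step_right[OF K0_star_support[OF assms(1)]]
    using step.IH by (intro has_series_product_step_right) auto
qed

text \<open>\<Gamma> is both a left and a right coset. By \<open>p_coeffs\<close> below its series
  with intertwiner \<open>p\<close> is \<open>p\<close> itself, so the unit laws turn the product
  formula into formulas for multiplication by \<open>p\<close>.\<close>

lemma coset_mult_unit_left:
  assumes "b \<in> K0 G \<Gamma>"
  shows "coset_mult G \<Gamma> (indicator \<Gamma>) b = b"
  using assms unfolding K0_def
proof (induction rule: cspan_induct)
  case zero
  show ?case by (rule coset_mult_zero)
next
  case (step b b' c)
  then obtain \<sigma> where \<sigma>: "\<sigma> \<in> carrier G" "b' = indicator (\<Gamma> #> \<sigma>)" by blast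
  have "finite_coset_support (indicator \<Gamma>)"
    using finite_coset_support_indicator[of \<one>] by (simp add: one_l_coset)
  moreover have "coset_mult G \<Gamma> (indicator \<Gamma>) (indicator (\<Gamma> #> \<sigma>)) = indicator (\<Gamma> #> \<sigma>)"
    using coset_mult_indicator[OF is_group subgroup_axioms _ \<sigma>(1), of \<one>] by (simp add: one_l_coset)
  ultimately show ?case
    unfolding \<sigma>(2) using step.IH by (subst coset_mult_step_right) simp_all
qed

lemma coset_mult_unit_right:
  assumes "a \<in> K0_star"
  shows "coset_mult G \<Gamma> a (indicator \<Gamma>) = a"
proof -
  have "coset_mult G \<Gamma> a (indicator \<Gamma>) = a \<and> a \<in> K0_star"
    using assms unfolding K0_star_def
  proof (induction rule: cspan_induct)
    case zero
    show ?case by (simp add: coset_mult_zero cspan_zero)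
  next
    case (step a a' c)
    then obtain \<sigma> where \<sigma>: "\<sigma> \<in> carrier G" "a' = indicator (\<sigma> <# \<Gamma>)" by blast
    have "coset_mult G \<Gamma> (indicator (\<sigma> <# \<Gamma>)) (indicator \<Gamma>) = indicator (\<sigma> <# \<Gamma>)"
      using coset_mult_indicator[OF is_group subgroup_axioms \<sigma>(1), of \<one>]
      by (simp add: r_coset_one l_coset_one \<sigma>(1))
    moreover have "finite_coset_support a" using step.IH by (intro K0_star_support) (simp add: K0_star_def)
    moreover have "(\<lambda>x. a x + c * a' x) \<in> cspan {indicator (\<sigma> <# \<Gamma>) |\<sigma>. \<sigma> \<in> carrier G}"
      using step.IH step.hyps by (intro cspan_step) auto
    ultimately show ?case
      using step.IH unfolding \<sigma>(2)
      by (subst coset_mult_step_left[OF _ finite_coset_support_indicator[OF \<sigma>(1)]]) simp_all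
  qed
  thus ?thesis ..
qed

section \<open>The operators\<close>

text \<open>Boundedness is required for all intertwiners at once, since the same combination is
  later used with \<open>id\<close> and with \<open>p\<close>.\<close>

definition admissible :: "('a \<Rightarrow> complex) \<Rightarrow> bool" where
  "admissible a \<longleftrightarrow> (\<forall>q. intertwiner q \<longrightarrow>
     (\<exists>X. left_equivariant G (carrier G) X \<and> op_coeffs G X = rep_series q a))"

text \<open>Coefficients determine the operator on \<open>ell2_on (carrier G)\<close> only; the
  choice fixes arbitrary values elsewhere, which is why identities are stated for vectors of that
  space.\<close>

definition rep_op :: "(('a, 'l) ell2 \<Rightarrow> ('a, 'l) ell2) \<Rightarrow> ('a \<Rightarrow> complex) \<Rightarrow> ('a, 'l) ell2 \<Rightarrow> ('a, 'l) ell2" where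
  "rep_op q a = (SOME X. left_equivariant G (carrier G) X \<and> op_coeffs G X = rep_series q a)"

lemma rep_op:
  assumes "admissible a" "intertwiner q"
  shows "left_equivariant G (carrier G) (rep_op q a)" "op_coeffs G (rep_op q a) = rep_series q a"
  using someI_ex[of "\<lambda>X. left_equivariant G (carrier G) X \<and> op_coeffs G X = rep_series q a"] assms
  unfolding rep_op_def admissible_def by blast+

lemma admissibleI:
  assumes "\<And>q. intertwiner q \<Longrightarrow> left_equivariant G (carrier G) (X q)"
    and "\<And>q. intertwiner q \<Longrightarrow> op_coeffs G (X q) = rep_series q a"
  shows "admissible a"
  using assms unfolding admissible_def by blast

lemma rep_op_eqI:
  assumes "admissible a" "intertwiner q" "left_equivariant G (carrier G) X"
    and "op_coeffs G X = rep_series q a" "f \<in> ell2_on (carrier G)"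
  shows "rep_op q a f = X f"
  by (rule whole.left_equivariant_eqI[OF rep_op(1)[OF assms(1,2)] assms(3) _ assms(5)])
    (simp add: rep_op(2)[OF assms(1,2)] assms(4))

lemma step_op:
  assumes "admissible a" "admissible b" "intertwiner q"
  shows "left_equivariant G (carrier G) (\<lambda>f. rep_op q a f + c *\<^sub>C rep_op q b f)"
    and "op_coeffs G (\<lambda>f. rep_op q a f + c *\<^sub>C rep_op q b f) = rep_series q (\<lambda>x. a x + c * b x)"
proof -
  show "left_equivariant G (carrier G) (\<lambda>f. rep_op q a f + c *\<^sub>C rep_op q b f)"
    by (rule whole.left_equivariant_plus[OF rep_op(1)[OF assms(1,3)]
          whole.left_equivariant_scaleC[OF rep_op(1)[OF assms(2,3)]]])
  have "op_coeffs G (\<lambda>f. rep_op q a f + c *\<^sub>C rep_op q b f) g l =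
      op_coeffs G (rep_op q a) g l + c *\<^sub>C op_coeffs G (rep_op q b) g l" for g l
    by (simp add: op_coeffs_def)
  thus "op_coeffs G (\<lambda>f. rep_op q a f + c *\<^sub>C rep_op q b f) = rep_series q (\<lambda>x. a x + c * b x)"
    by (intro ext) (simp add: rep_series_step rep_op(2)[OF assms(1,3)] rep_op(2)[OF assms(2,3)])
qed

lemma admissible_step:
  assumes "admissible a" "admissible b"
  shows "admissible (\<lambda>x. a x + c * b x)"
  by (rule admissibleI[OF step_op[OF assms]])

lemma rep_op_step:
  assumes "admissible a" "admissible b" "intertwiner q" "f \<in> ell2_on (carrier G)"
  shows "rep_op q (\<lambda>x. a x + c * b x) f = rep_op q a f + c *\<^sub>C rep_op q b f"
  by (rule rep_op_eqI[OF admissible_step[OF assms(1,2)] assms(3) step_op[OF assms(1-3)] assms(4)])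

lemma admissible_zero: "admissible (\<lambda>x. 0)"
proof (rule admissibleI[where X = "\<lambda>q f. 0"])
  show "op_coeffs G (\<lambda>f. 0) = rep_series q (\<lambda>x. 0)" for q
    by (intro ext) (simp add: op_coeffs_def rep_series_zero)
qed (rule whole.left_equivariant_zero)

lemma admissible_cspan:
  assumes "a \<in> cspan B" "\<And>b. b \<in> B \<Longrightarrow> admissible b"
  shows "admissible a"
  using assms(1)
proof (induction rule: cspan_induct)
  case (step a b c)
  show ?case by (rule admissible_step[OF step.IH assms(2)[OF step.hyps]])
qed (rule admissible_zero)

lemma admissible_pieces:
  assumes "a \<in> cspan {indicator (piece z) | z. z \<in> carrier G}"
  shows "admissible a"
  using assms by (rule admissible_cspan) (use piece_operator in \<open>auto simp: admissible_def\<close>)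

lemma admissible_K0: "a \<in> K0 G \<Gamma> \<Longrightarrow> admissible a"
  unfolding K0_def by (erule admissible_cspan) (use admissible_pieces indicator_r_coset_pieces in blast)

lemma admissible_K0_star: "a \<in> K0_star \<Longrightarrow> admissible a"
  unfolding K0_star_def by (erule admissible_cspan) (use admissible_pieces indicator_l_coset_pieces in blast)

text \<open>The coefficient sum of the composed operators and the sum in
  \<open>has_series_product\<close> are the same sum, so their limits agree.\<close>

lemma mult_op:
  assumes a: "a \<in> K0_star" and b: "b \<in> K0 G \<Gamma>" and q: "intertwiner q" and r: "intertwiner r"
  shows "left_equivariant G (carrier G) (\<lambda>f. rep_op q a (rep_op r b f))"
    and "op_coeffs G (\<lambda>f. rep_op q a (rep_op r b f)) = rep_series (\<lambda>f. q (r f)) (coset_mult G \<Gamma> a b)"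
proof -
  note A = rep_op[OF admissible_K0_star[OF a] q] and B = rep_op[OF admissible_K0[OF b] r]
  show eq: "left_equivariant G (carrier G) (\<lambda>f. rep_op q a (rep_op r b f))"
    by (rule whole.left_equivariant_comp[OF A(1) B(1)])
  show "op_coeffs G (\<lambda>f. rep_op q a (rep_op r b f)) = rep_series (\<lambda>f. q (r f)) (coset_mult G \<Gamma> a b)"
  proof (intro ext)
    fix k l
    show "op_coeffs G (\<lambda>f. rep_op q a (rep_op r b f)) k l = rep_series (\<lambda>f. q (r f)) (coset_mult G \<Gamma> a b) k l"
    proof (cases "k \<in> carrier G")
      case True
      show ?thesis
        by (rule has_sum_unique[OF whole.op_coeffs_comp_has_sum[OF A(1) B(1) True, unfolded A(2) B(2)]
            has_series_productD[OF has_series_product_coset_mult[OF a b] q r True]])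
    next
      case False
      thus ?thesis
        using bop_in[OF left_equivariant_bop[OF eq], of "single \<one> l"]
        by (simp add: op_coeffs_def rep_series_def ell2_on_def ell2_apply_single)
    qed
  qed
qed

lemma admissible_coset_mult:
  assumes "a \<in> K0_star" "b \<in> K0 G \<Gamma>"
  shows "admissible (coset_mult G \<Gamma> a b)"
proof (rule admissibleI)
  fix q assume q: "intertwiner q"
  \<comment> \<open>The whole intertwiner is placed in the left factor and the identity in the right
    one.\<close>
  show "left_equivariant G (carrier G) (\<lambda>f. rep_op q a (rep_op id b f))"
    by (rule mult_op[OF assms q intertwiner_id])
  show "op_coeffs G (\<lambda>f. rep_op q a (rep_op id b f)) = rep_series q (coset_mult G \<Gamma> a b)"
    using mult_op(2)[OF assms q intertwiner_id] by simp
qed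

lemma rep_op_coset_mult:
  assumes "a \<in> K0_star" "b \<in> K0 G \<Gamma>" "intertwiner q" "intertwiner r" "f \<in> ell2_on (carrier G)"
  shows "rep_op (\<lambda>f. q (r f)) (coset_mult G \<Gamma> a b) f = rep_op q a (rep_op r b f)"
  by (rule rep_op_eqI[OF admissible_coset_mult[OF assms(1,2)] intertwiner_comp[OF assms(3,4)]
        mult_op[OF assms(1-4)] assms(5)])

lemma is_product_rep_series:
  assumes "a \<in> K0_star" "b \<in> K0 G \<Gamma>" "intertwiner q" "intertwiner r"
  shows "is_product G (rep_series q a) (rep_series r b) (rep_series (\<lambda>f. q (r f)) (coset_mult G \<Gamma> a b))"
  using is_product_op_coeffs[OF rep_op(1)[OF admissible_K0_star[OF assms(1)] assms(3)]
      rep_op(1)[OF admissible_K0[OF assms(2)] assms(4)]]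
  by (simp only: mult_op(2)[OF assms] rep_op(2)[OF admissible_K0_star[OF assms(1)] assms(3)]
      rep_op(2)[OF admissible_K0[OF assms(2)] assms(4)])

lemma admissible_K0K0:
  assumes "a \<in> K0K0 G \<Gamma>"
  shows "admissible a"
  using assms unfolding K0K0_def
proof (rule admissible_cspan)
  fix b :: "'a \<Rightarrow> complex"
  assume "b \<in> {indicator (\<sigma>\<^sub>1 <# \<Gamma> #> \<sigma>\<^sub>2) | \<sigma>\<^sub>1 \<sigma>\<^sub>2. \<sigma>\<^sub>1 \<in> carrier G \<and> \<sigma>\<^sub>2 \<in> carrier G}"
  then obtain \<sigma>\<^sub>1 \<sigma>\<^sub>2 where \<sigma>: "\<sigma>\<^sub>1 \<in> carrier G" "\<sigma>\<^sub>2 \<in> carrier G" "b = indicator (\<sigma>\<^sub>1 <# \<Gamma> #> \<sigma>\<^sub>2)"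
    by blast
  show "admissible b"
    using admissible_coset_mult[OF K0_star_base[OF \<sigma>(1)] K0_base[OF \<sigma>(2)]]
    unfolding \<sigma>(3) coset_mult_indicator[OF is_group subgroup_axioms \<sigma>(1,2)] .
qed

text \<open>Since \<pi>(g) is unitary and \<open>q\<close> is self-adjoint and commutes with it, the
  adjoint of P_L \<pi>(g^-1) q P_L is P_L \<pi>(g) q P_L, the coefficient at the inverse
  element.\<close>

lemma rep_op_adjoint:
  assumes "admissible a" "admissible (coset_star G a)" "intertwiner q"
    and self: "\<And>f g. f \<in> H \<Longrightarrow> g \<in> H \<Longrightarrow> cinner (q f) g = cinner f (q g)"
  shows "is_adjoint (ell2_on (carrier G)) (rep_op q a) (rep_op q (coset_star G a))"
proof (rule whole.left_equivariant_is_adjoint)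
  show "left_equivariant G (carrier G) (rep_op q a)" "left_equivariant G (carrier G) (rep_op q (coset_star G a))"
    by (rule rep_op, rule assms, rule assms)+
  fix g and l l' :: 'l assume g: "g \<in> carrier G"
  let ?u = "single \<one> l" and ?u' = "single \<one> l'"
  note q = assms(3)
  have "cinner (\<pi> (inv g) (q ?u)) ?u' = cinner (q ?u) (\<pi> g ?u')"
    using g cinner_pi[of "inv g" "q ?u" ?u'] by (simp add: intertwiner_in[OF q])
  also have "\<dots> = cinner ?u (\<pi> g (q ?u'))"
    using g by (simp add: self pi_in intertwiner_pi[OF q])
  finally have "cinner (ell2_apply (\<pi> (inv g) (q ?u)) \<one>) l' = cinner l (ell2_apply (\<pi> g (q ?u')) \<one>)"
    by (simp add: cinner_single_left cinner_single_right)
  thus "cinner (op_coeffs G (rep_op q a) g l) l' = cinner l (op_coeffs G (rep_op q (coset_star G a)) (inv g) l')"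
    unfolding rep_op(2)[OF assms(1) q] rep_op(2)[OF assms(2) q]
    using g by (simp add: rep_series_def compress_def cinner_scaleC_left cinner_scaleC_right coset_star_def)
qed

end


section \<open>The projection\<close>

locale projected_rep = almost_normal_rep G \<Gamma> \<pi>
  for G (structure) and \<Gamma> and \<pi> :: "'a \<Rightarrow> ('a, 'l::chilbert_space) ell2 \<Rightarrow> ('a, 'l) ell2" +
  fixes p :: "('a, 'l) ell2 \<Rightarrow> ('a, 'l) ell2"
  assumes projection: "orth_projection H p"
    and commutes: "\<And>g f. g \<in> carrier G \<Longrightarrow> f \<in> H \<Longrightarrow> p (\<pi> g f) = \<pi> g (p f)"
begin

lemma p_bop: "p \<in> bop H"
  and p_idem: "f \<in> H \<Longrightarrow> p (p f) = p f"
  and p_self_adjoint: "f \<in> H \<Longrightarrow> g \<in> H \<Longrightarrow> cinner (p f) g = cinner f (p g)"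
  using projection by (simp_all add: orth_projection_def is_adjoint_def)

lemma intertwiner_p: "intertwiner p"
  by (simp add: intertwiner_def p_bop commutes)

lemma rep_series_pp: "rep_series (\<lambda>f. p (p f)) a = rep_series p a"
  by (intro ext) (simp add: rep_series_def compress_def p_idem)

lemma coset_series_id: "coset_series G \<pi> A = rep_series id (indicator A)"
  using coset_series_eq[of id A] by simp

lemma p_coeff:
  assumes "\<gamma> \<in> \<Gamma>"
  shows "ell2_apply (p (single \<one> l)) \<gamma> = compress G (\<lambda>f. \<pi> (inv \<gamma>) (p f)) l"
  using assms pi_apply[OF inv_K[OF assms] bop_in[OF p_bop single_one_H] one_K]
  by (simp add: compress_def)

text \<open>On \<Gamma> the coordinate at \<gamma> is the coordinate at the identity after applying
  \<pi>(\<gamma>^-1); off \<Gamma> it vanishes because \<open>p\<close> preserves \<open>H\<close>.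
  This is how \<open>p\<close> enters the series over G.\<close>

lemma p_coeffs: "op_coeffs G p = rep_series p (indicator \<Gamma>)"
proof (intro ext)
  fix g l
  have "ell2_apply (p (single \<one> l)) g = 0" if "g \<notin> \<Gamma>"
    using bop_in[OF p_bop single_one_H, of l] that by (simp add: ell2_on_def)
  moreover have "inv g \<in> \<Gamma> \<longleftrightarrow> g \<in> \<Gamma>" if "g \<in> carrier G"
    using that by (metis inv_K inv_inv)
  ultimately show "op_coeffs G p g l = rep_series p (indicator \<Gamma>) g l"
    by (cases "g \<in> \<Gamma>") (auto simp: op_coeffs_def rep_series_def p_coeff)
qed

text \<open>\<pi>(\<Gamma>) is left translation on \<open>H\<close>, so commuting with it is left
  equivariance.\<close>

lemma p_left_equivariant: "left_equivariant G \<Gamma> p"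
  unfolding left_equivariant_def
proof (intro conjI ballI allI p_bop)
  fix x y l assume xy: "x \<in> \<Gamma>" "y \<in> \<Gamma>"
  have "p (single x l) = \<pi> x (p (single \<one> l))"
    using xy pi_single[OF xy(1) one_K, of l] commutes[of x "single \<one> l"] by simp
  thus "ell2_apply (p (single x l)) y = op_coeffs G p (inv x \<otimes> y) l"
    using xy by (simp add: pi_apply bop_in[OF p_bop] op_coeffs_def)
qed

lemma p_R_vN_tensor: "p \<in> R_vN_tensor G \<Gamma>"
  by (rule left_equivariant_R_vN_tensor[OF p_left_equivariant])

lemma p_expansion: "has_expansion G \<Gamma> p (\<lambda>\<gamma>. compress G (\<lambda>f. \<pi> (inv \<gamma>) (p f)))"
  unfolding has_expansion_def
proof (intro ballI)
  fix f x assume f: "f \<in> H" and x: "x \<in> \<Gamma>"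
  from left_equivariant_expand[OF p_left_equivariant f x]
  show "((\<lambda>\<gamma>. compress G (\<lambda>f. \<pi> (inv \<gamma>) (p f)) (ell2_apply (right_reg G \<Gamma> \<gamma> f) x)) has_sum
      ell2_apply (p f) x) \<Gamma>"
  \<comment> \<open>The substitution is \<gamma> = h^-1 x: right translation by \<gamma> reads f at
    x \<gamma>^-1 = h.\<close>
  proof (rule has_sum_reindex_bij_witness[THEN iffD1, rotated -1])
    fix h assume h: "h \<in> \<Gamma>"
    show "inv h \<otimes> x \<in> \<Gamma>" "x \<otimes> inv h \<in> \<Gamma>" using h x by simp_all
    have eq: "x \<otimes> inv (inv h \<otimes> x) = h" "inv (x \<otimes> inv h) \<otimes> x = h"
      using h x by (simp_all add: inv_mult_group m_assoc[symmetric]) (simp add: m_assoc)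
    thus "x \<otimes> inv (inv h \<otimes> x) = h" "inv (x \<otimes> inv h) \<otimes> x = h" by blast+
    show "compress G (\<lambda>f. \<pi> (inv (inv h \<otimes> x)) (p f)) (ell2_apply (right_reg G \<Gamma> (inv h \<otimes> x) f) x) =
        op_coeffs G p (inv h \<otimes> x) (ell2_apply f h)"
      using h x eq(1) p_coeff[of "inv h \<otimes> x"] by (simp add: ell2_apply_right_reg_K op_coeffs_def)
  qed simp
qed

text \<open>Apply \<open>p\<close> to the recovery formula over \<Gamma> and move it past
  \<pi>(\<gamma>). The second formula is the first one at the vector \<open>p f\<close>, with
  idempotence.\<close>

lemma p_conditional_expectation:
  "has_E G \<Gamma> H \<pi> (\<lambda>f. p (P_L G f)) p"
  "has_E G \<Gamma> H \<pi> (\<lambda>f. p (P_L G (p f))) p"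
proof -
  have *: "((\<lambda>\<gamma>. p (\<pi> \<gamma> (single \<one> (ell2_apply (\<pi> (inv \<gamma>) v) \<one>)))) has_sum p v) \<Gamma>" if v: "v \<in> H" for v
  proof (rule bop_has_sum[OF p_bop _ v])
    show "((\<lambda>\<gamma>. \<pi> \<gamma> (single \<one> (ell2_apply (\<pi> (inv \<gamma>) v) \<one>))) has_sum v) \<Gamma>"
      using pi_recover[OF v, of \<one>] by (simp add: one_l_coset)
    show "\<pi> \<gamma> (single \<one> (ell2_apply (\<pi> (inv \<gamma>) v) \<one>)) \<in> H" if "\<gamma> \<in> \<Gamma>" for \<gamma>
      using that by (intro pi_in single_one_H) simp
  qed
  show "has_E G \<Gamma> H \<pi> (\<lambda>f. p (P_L G f)) p"
    unfolding has_E_def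
  proof
    fix f assume f: "f \<in> H"
    show "((\<lambda>\<gamma>. \<pi> \<gamma> (p (P_L G (\<pi> (inv \<gamma>) f)))) has_sum p f) \<Gamma>"
      using *[OF f] by (rule has_sum_cong[THEN iffD1, rotated]) (simp add: P_L_def commutes)
  qed
  show "has_E G \<Gamma> H \<pi> (\<lambda>f. p (P_L G (p f))) p"
    unfolding has_E_def
  proof
    fix f assume f: "f \<in> H"
    have "((\<lambda>\<gamma>. p (\<pi> \<gamma> (single \<one> (ell2_apply (\<pi> (inv \<gamma>) (p f)) \<one>)))) has_sum p f) \<Gamma>"
      using *[OF bop_in[OF p_bop f]] f by (simp add: p_idem)
    thus "((\<lambda>\<gamma>. \<pi> \<gamma> (p (P_L G (p (\<pi> (inv \<gamma>) f))))) has_sum p f) \<Gamma>"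
      by (rule has_sum_cong[THEN iffD1, rotated]) (simp add: P_L_def commutes f)
  qed
qed

lemma indicator_K0: "indicator \<Gamma> \<in> K0 G \<Gamma>"
  and indicator_K0_star: "indicator \<Gamma> \<in> K0_star"
  using K0_base[of \<one>] K0_star_base[of \<one>] by (simp_all add: one_l_coset r_coset_one)

section \<open>Products with \<open>p\<close> and the compressed representations\<close>

lemma p_S_product:
  assumes "b \<in> K0 G \<Gamma>"
  shows "is_product G (op_coeffs G p) (rep_series id b) (rep_series p b)"
  using is_product_rep_series[OF indicator_K0_star assms intertwiner_p intertwiner_id]
  by (simp add: p_coeffs coset_mult_unit_left[OF assms])

lemma S_p_product:
  assumes "a \<in> K0_star"
  shows "is_product G (rep_series id a) (op_coeffs G p) (rep_series p a)"
  using is_product_rep_series[OF assms indicator_K0 intertwiner_id intertwiner_p]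
  by (simp add: p_coeffs coset_mult_unit_right[OF assms])

text \<open>The intermediate products in the two bracketings are the series of \<open>a\<close> and
  of \<open>b\<close> with intertwiner \<open>p\<close>.\<close>

lemma S_p_S_product:
  assumes "a \<in> K0_star" "b \<in> K0 G \<Gamma>"
  shows "is_product3 G (rep_series id a) (op_coeffs G p) (rep_series id b) (rep_series p (coset_mult G \<Gamma> a b))"
  unfolding is_product3_def
proof (intro conjI exI)
  show "is_product G (rep_series id a) (op_coeffs G p) (rep_series p a)"
    by (rule S_p_product[OF assms(1)])
  show "is_product G (rep_series p a) (rep_series id b) (rep_series p (coset_mult G \<Gamma> a b))"
    using is_product_rep_series[OF assms intertwiner_p intertwiner_id] by simp
  show "is_product G (op_coeffs G p) (rep_series id b) (rep_series p b)"
    by (rule p_S_product[OF assms(2)])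
  show "is_product G (rep_series id a) (rep_series p b) (rep_series p (coset_mult G \<Gamma> a b))"
    using is_product_rep_series[OF assms intertwiner_id intertwiner_p] by simp
qed

text \<open>Here \<open>a\<close> is a right factor next to one \<open>p\<close> and a left factor
  next to the other, so it must lie in both spans; idempotence of \<open>p\<close> collapses the
  result.\<close>

lemma p_S_p_product:
  assumes "a \<in> K0_star" "a \<in> K0 G \<Gamma>"
  shows "is_product3 G (op_coeffs G p) (rep_series id a) (op_coeffs G p) (rep_series p a)"
  unfolding is_product3_def
proof (intro conjI exI)
  show "is_product G (op_coeffs G p) (rep_series id a) (rep_series p a)"
    by (rule p_S_product[OF assms(2)])
  show "is_product G (rep_series p a) (op_coeffs G p) (rep_series p a)"
    using is_product_rep_series[OF assms(1) indicator_K0 intertwiner_p intertwiner_p]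
    by (simp add: p_coeffs coset_mult_unit_right[OF assms(1)] rep_series_pp)
  show "is_product G (rep_series id a) (op_coeffs G p) (rep_series p a)"
    by (rule S_p_product[OF assms(1)])
  show "is_product G (op_coeffs G p) (rep_series p a) (rep_series p a)"
    using is_product_rep_series[OF indicator_K0_star assms(2) intertwiner_p intertwiner_p]
    by (simp add: p_coeffs coset_mult_unit_left[OF assms(2)] rep_series_pp)
qed

lemma rep_op_p_mult:
  assumes "a \<in> K0_star" "b \<in> K0 G \<Gamma>" "f \<in> ell2_on (carrier G)"
  shows "rep_op p (coset_mult G \<Gamma> a b) f = rep_op p a (rep_op p b f)"
proof -
  \<comment> \<open>The two series coincide, so both operators are chosen from the same predicate
    and are literally equal.\<close>
  have "rep_op (\<lambda>f. p (p f)) = rep_op p" by (simp add: rep_op_def fun_eq_iff rep_series_pp)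
  thus ?thesis using rep_op_coset_mult[OF assms(1,2) intertwiner_p intertwiner_p assms(3)] by simp
qed

lemma rep_op_p_adjoint:
  assumes "admissible a" "admissible (coset_star G a)"
  shows "is_adjoint (ell2_on (carrier G)) (rep_op p a) (rep_op p (coset_star G a))"
  by (rule rep_op_adjoint[OF assms intertwiner_p p_self_adjoint])

lemma rep_op_p_R_vN_tensor: "admissible a \<Longrightarrow> rep_op p a \<in> R_vN_tensor G (carrier G)"
  by (rule whole.left_equivariant_R_vN_tensor[OF rep_op(1)[OF _ intertwiner_p]])

lemma rep_op_p_linear:
  assumes "\<And>a. a \<in> D \<Longrightarrow> admissible a"
  shows "linear_op_valued (ell2_on (carrier G)) D (rep_op p)"
  unfolding linear_op_valued_def
proof (intro conjI ballI allI)
  fix a b and f :: "('a, 'l) ell2" assume "a \<in> D" "b \<in> D" and f: "f \<in> ell2_on (carrier G)"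
  thus "rep_op p (\<lambda>x. a x + b x) f = rep_op p a f + rep_op p b f"
    using rep_op_step[OF assms assms intertwiner_p f, of a b 1] by simp
next
  fix c a and f :: "('a, 'l) ell2" assume a: "a \<in> D" and f: "f \<in> ell2_on (carrier G)"
  \<comment> \<open>Homogeneity is the step rule starting from the zero combination, whose operator
    must first be identified.\<close>
  have "rep_op p (\<lambda>x. 0) f = (\<lambda>f. 0) f"
    by (rule rep_op_eqI[OF admissible_zero intertwiner_p whole.left_equivariant_zero _ f])
      (intro ext, simp add: op_coeffs_def rep_series_zero)
  thus "rep_op p (\<lambda>x. c * a x) f = c *\<^sub>C rep_op p a f"
    using rep_op_step[OF admissible_zero assms[OF a] intertwiner_p f, of c] by simp
qed

lemma Hecke_rep_p: "Hecke_rep G \<Gamma> (rep_op p)"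
  unfolding Hecke_rep_def
proof (intro conjI ballI)
  show "rep_op p a \<in> R_vN_tensor G (carrier G)" if "a \<in> Hecke G \<Gamma>" for a
    by (rule rep_op_p_R_vN_tensor[OF admissible_K0[OF Hecke_K0[OF that]]])
  show "linear_op_valued (ell2_on (carrier G)) (Hecke G \<Gamma>) (rep_op p)"
    by (rule rep_op_p_linear[OF admissible_K0[OF Hecke_K0]])
  show "rep_op p (coset_mult G \<Gamma> a b) f = rep_op p a (rep_op p b f)"
    if "a \<in> Hecke G \<Gamma>" "b \<in> Hecke G \<Gamma>" "f \<in> ell2_on (carrier G)" for a b f
    by (rule rep_op_p_mult[OF Hecke_K0_star[OF that(1)] Hecke_K0[OF that(2)] that(3)])
  show "is_adjoint (ell2_on (carrier G)) (rep_op p a) (rep_op p (coset_star G a))" if "a \<in> Hecke G \<Gamma>" for a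
    using Hecke_K0[OF that] by (intro rep_op_p_adjoint admissible_K0 admissible_K0_star[OF coset_star_K0])
qed

text \<open>The adjoint is the operator of the starred combination, which lies in
  \<open>K0_star\<close> and so may be the left factor.\<close>

lemma op_system_rep_p: "op_system_rep G \<Gamma> (rep_op p)"
  unfolding op_system_rep_def
proof (intro conjI ballI)
  show "rep_op p a \<in> R_vN_tensor G (carrier G)" if "a \<in> K0K0 G \<Gamma>" for a
    by (rule rep_op_p_R_vN_tensor[OF admissible_K0K0[OF that]])
  show "linear_op_valued (ell2_on (carrier G)) (K0K0 G \<Gamma>) (rep_op p)"
    by (rule rep_op_p_linear[OF admissible_K0K0])
  fix a b assume a: "a \<in> K0 G \<Gamma>" and b: "b \<in> K0 G \<Gamma>"
  note a' = coset_star_K0[OF a]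
  show "\<exists>W. is_adjoint (ell2_on (carrier G)) (rep_op p a) W \<and>
      (\<forall>f\<in>ell2_on (carrier G). rep_op p (coset_mult G \<Gamma> (coset_star G a) b) f = W (rep_op p b f))"
  proof (intro exI conjI ballI)
    show "is_adjoint (ell2_on (carrier G)) (rep_op p a) (rep_op p (coset_star G a))"
      by (rule rep_op_p_adjoint[OF admissible_K0[OF a] admissible_K0_star[OF a']])
  qed (rule rep_op_p_mult[OF a' b])
qed

end

section \<open>Assembly of statements (a), (b) and (c)\<close>

theorem mainTheorem3:
  fixes G :: "('g, 'm) monoid_scheme"
    and \<Gamma> :: "'g set"
    and \<pi> :: "'g \<Rightarrow> ('g, 'l::chilbert_space) ell2 \<Rightarrow> ('g, 'l) ell2"
    and p :: "('g, 'l) ell2 \<Rightarrow> ('g, 'l) ell2"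
  defines "H \<equiv> ell2_on \<Gamma>"
  assumes "group G"
    and "countable (carrier G)"
    and "subgroup \<Gamma> G"
    and "almost_normal G \<Gamma>"
    and "icc G"
    and "icc (G\<lparr>carrier := \<Gamma>\<rparr>)"
    and "unitary_rep G H \<pi>"
    and "\<forall>\<gamma>\<in>\<Gamma>. is_tensor_op \<Gamma> (left_reg G \<Gamma> \<gamma>) id (\<pi> \<gamma>)"
    and "orth_projection H p"
    and "\<forall>g\<in>carrier G. \<forall>f\<in>H. p (\<pi> g f) = \<pi> g (p f)"
    and "trace_class H (\<lambda>f. p (P_L G f))"
  defines "\<pi>\<^sub>0 \<equiv> \<lambda>g f. \<pi> g (p f)"
    and "S \<equiv> coset_series G \<pi>"
  shows
    "((\<forall>\<sigma>\<in>carrier G. \<exists>C. is_product G (op_coeffs G p) (S (double_coset G \<Gamma> \<sigma>)) C \<and>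
          is_product G (S (double_coset G \<Gamma> \<sigma>)) (op_coeffs G p) C) \<and>
      p \<in> R_vN_tensor G \<Gamma> \<and>
      has_expansion G \<Gamma> p (\<lambda>\<gamma>. compress G (\<pi>\<^sub>0 (inv\<^bsub>G\<^esub> \<gamma>))) \<and>
      has_E G \<Gamma> H \<pi> (\<lambda>f. p (P_L G f)) p \<and>
      has_E G \<Gamma> H \<pi> (\<lambda>f. p (P_L G (p f))) p) \<and>
     (\<forall>\<sigma>\<in>carrier G.
        is_product G (op_coeffs G p) (S (\<Gamma> #>\<^bsub>G\<^esub> \<sigma>)) (coset_series G \<pi>\<^sub>0 (\<Gamma> #>\<^bsub>G\<^esub> \<sigma>)) \<and>
        (\<exists>X\<in>R_vN_tensor G (carrier G).
           is_product G (op_coeffs G p) (op_coeffs G X) (coset_series G \<pi>\<^sub>0 (\<Gamma> #>\<^bsub>G\<^esub> \<sigma>))) \<and>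
        is_product G (op_coeffs G p) (S (double_coset G \<Gamma> \<sigma>)) (coset_series G \<pi>\<^sub>0 (double_coset G \<Gamma> \<sigma>)) \<and>
        is_product G (S (double_coset G \<Gamma> \<sigma>)) (op_coeffs G p) (coset_series G \<pi>\<^sub>0 (double_coset G \<Gamma> \<sigma>))) \<and>
     (\<exists>S\<^sub>p. Hecke_rep G \<Gamma> S\<^sub>p \<and>
        op_coeffs G (S\<^sub>p (indicator \<Gamma>)) = op_coeffs G p \<and>
        (\<forall>\<sigma>\<in>carrier G.
           is_product3 G (op_coeffs G p) (S (double_coset G \<Gamma> \<sigma>)) (op_coeffs G p)
             (op_coeffs G (S\<^sub>p (indicator (double_coset G \<Gamma> \<sigma>)))) \<and>
           is_product G (op_coeffs G p) (S (double_coset G \<Gamma> \<sigma>))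
             (op_coeffs G (S\<^sub>p (indicator (double_coset G \<Gamma> \<sigma>)))))) \<and>
     (\<exists>V. op_system_rep G \<Gamma> V \<and>
        (\<forall>\<sigma>\<in>carrier G.
           is_product G (op_coeffs G p) (S (\<Gamma> #>\<^bsub>G\<^esub> \<sigma>)) (op_coeffs G (V (indicator (\<Gamma> #>\<^bsub>G\<^esub> \<sigma>)))) \<and>
           (\<exists>W. is_adjoint (ell2_on (carrier G)) (V (indicator (\<Gamma> #>\<^bsub>G\<^esub> \<sigma>))) W \<and>
              is_product G (S (inv\<^bsub>G\<^esub> \<sigma> <#\<^bsub>G\<^esub> \<Gamma>)) (op_coeffs G p) (op_coeffs G W))) \<and>
        (\<forall>\<sigma>\<^sub>1\<in>carrier G. \<forall>\<sigma>\<^sub>2\<in>carrier G.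
           is_product3 G (S (\<sigma>\<^sub>1 <#\<^bsub>G\<^esub> \<Gamma>)) (op_coeffs G p) (S (\<Gamma> #>\<^bsub>G\<^esub> \<sigma>\<^sub>2))
             (coset_series G \<pi>\<^sub>0 (\<sigma>\<^sub>1 <#\<^bsub>G\<^esub> \<Gamma> #>\<^bsub>G\<^esub> \<sigma>\<^sub>2)) \<and>
           op_coeffs G (V (indicator (\<sigma>\<^sub>1 <#\<^bsub>G\<^esub> \<Gamma> #>\<^bsub>G\<^esub> \<sigma>\<^sub>2))) =
             coset_series G \<pi>\<^sub>0 (\<sigma>\<^sub>1 <#\<^bsub>G\<^esub> \<Gamma> #>\<^bsub>G\<^esub> \<sigma>\<^sub>2)))"
proof -
  interpret projected_rep G \<Gamma> \<pi> p
    using assms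
    by (intro projected_rep.intro projected_rep_axioms.intro almost_normal_rep.intro
        almost_normal_rep_axioms.intro group_subgroup.intro) auto
  note coeffs = rep_op(2)[OF admissible_K0 intertwiner_p]
  have S: "S A = rep_series id (indicator A)" for A
    unfolding S_def by (rule coset_series_id)
  have S_p: "coset_series G \<pi>\<^sub>0 A = rep_series p (indicator A)" for A
    unfolding \<pi>\<^sub>0_def by (rule coset_series_eq)
  have a: "\<exists>C. is_product G (op_coeffs G p) (S (double_coset G \<Gamma> \<sigma>)) C \<and>
      is_product G (S (double_coset G \<Gamma> \<sigma>)) (op_coeffs G p) C" if "\<sigma> \<in> carrier G" for \<sigma>
    unfolding S using p_S_product[OF double_coset_K0[OF that]] S_p_product[OF double_coset_K0_star[OF that]]
    by blast
  have expansion: "has_expansion G \<Gamma> p (\<lambda>\<gamma>. compress G (\<pi>\<^sub>0 (inv\<^bsub>G\<^esub> \<gamma>)))"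
    unfolding \<pi>\<^sub>0_def by (rule p_expansion)
  have b: "is_product G (op_coeffs G p) (S (\<Gamma> #>\<^bsub>G\<^esub> \<sigma>)) (coset_series G \<pi>\<^sub>0 (\<Gamma> #>\<^bsub>G\<^esub> \<sigma>)) \<and>
      (\<exists>X\<in>R_vN_tensor G (carrier G).
         is_product G (op_coeffs G p) (op_coeffs G X) (coset_series G \<pi>\<^sub>0 (\<Gamma> #>\<^bsub>G\<^esub> \<sigma>))) \<and>
      is_product G (op_coeffs G p) (S (double_coset G \<Gamma> \<sigma>)) (coset_series G \<pi>\<^sub>0 (double_coset G \<Gamma> \<sigma>)) \<and>
      is_product G (S (double_coset G \<Gamma> \<sigma>)) (op_coeffs G p) (coset_series G \<pi>\<^sub>0 (double_coset G \<Gamma> \<sigma>))"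
    if \<sigma>: "\<sigma> \<in> carrier G" for \<sigma>
    unfolding S S_p
  proof (intro conjI bexI)
    \<comment> \<open>The witness for membership in p(R(G) \<otimes> B(L)) is the bounded operator
      of S(\<Gamma>\<sigma>) itself.\<close>
    note X = rep_op[OF admissible_K0[OF K0_base[OF \<sigma>]] intertwiner_id]
    show "rep_op id (indicator (\<Gamma> #>\<^bsub>G\<^esub> \<sigma>)) \<in> R_vN_tensor G (carrier G)"
      by (rule whole.left_equivariant_R_vN_tensor[OF X(1)])
    show "is_product G (op_coeffs G p) (op_coeffs G (rep_op id (indicator (\<Gamma> #>\<^bsub>G\<^esub> \<sigma>))))
        (rep_series p (indicator (\<Gamma> #>\<^bsub>G\<^esub> \<sigma>)))"
      unfolding X(2) by (rule p_S_product[OF K0_base[OF \<sigma>]])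
  qed (rule p_S_product[OF K0_base[OF \<sigma>]] p_S_product[OF double_coset_K0[OF \<sigma>]]
      S_p_product[OF double_coset_K0_star[OF \<sigma>]])+
  have c: "is_product3 G (op_coeffs G p) (S (double_coset G \<Gamma> \<sigma>)) (op_coeffs G p)
        (op_coeffs G (rep_op p (indicator (double_coset G \<Gamma> \<sigma>)))) \<and>
      is_product G (op_coeffs G p) (S (double_coset G \<Gamma> \<sigma>))
        (op_coeffs G (rep_op p (indicator (double_coset G \<Gamma> \<sigma>))))" if \<sigma>: "\<sigma> \<in> carrier G" for \<sigma>
    unfolding S coeffs[OF double_coset_K0[OF \<sigma>]]
    using p_S_p_product[OF double_coset_K0_star[OF \<sigma>] double_coset_K0[OF \<sigma>]]
      p_S_product[OF double_coset_K0[OF \<sigma>]] by blast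
  \<comment> \<open>The unit of the Hecke algebra goes to \<open>p\<close>, the unit of the
    compressed algebra.\<close>
  have c_unit: "op_coeffs G (rep_op p (indicator \<Gamma>)) = op_coeffs G p"
    unfolding coeffs[OF indicator_K0] p_coeffs ..
  have d: "is_product G (op_coeffs G p) (S (\<Gamma> #>\<^bsub>G\<^esub> \<sigma>)) (op_coeffs G (rep_op p (indicator (\<Gamma> #>\<^bsub>G\<^esub> \<sigma>)))) \<and>
      (\<exists>W. is_adjoint (ell2_on (carrier G)) (rep_op p (indicator (\<Gamma> #>\<^bsub>G\<^esub> \<sigma>))) W \<and>
         is_product G (S (inv\<^bsub>G\<^esub> \<sigma> <#\<^bsub>G\<^esub> \<Gamma>)) (op_coeffs G p) (op_coeffs G W))"
    if \<sigma>: "\<sigma> \<in> carrier G" for \<sigma>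
  proof (intro conjI exI)
    note K = K0_base[OF \<sigma>] and K' = K0_star_base[OF inv_closed[OF \<sigma>]]
    show "is_product G (op_coeffs G p) (S (\<Gamma> #>\<^bsub>G\<^esub> \<sigma>)) (op_coeffs G (rep_op p (indicator (\<Gamma> #>\<^bsub>G\<^esub> \<sigma>))))"
      unfolding S coeffs[OF K] by (rule p_S_product[OF K])
    show "is_adjoint (ell2_on (carrier G)) (rep_op p (indicator (\<Gamma> #>\<^bsub>G\<^esub> \<sigma>)))
        (rep_op p (indicator (inv\<^bsub>G\<^esub> \<sigma> <#\<^bsub>G\<^esub> \<Gamma>)))"
      using rep_op_p_adjoint[OF admissible_K0[OF K]] admissible_K0_star[OF K']
      unfolding coset_star_r_coset[OF \<sigma>] by blast
    show "is_product G (S (inv\<^bsub>G\<^esub> \<sigma> <#\<^bsub>G\<^esub> \<Gamma>)) (op_coeffs G p)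
        (op_coeffs G (rep_op p (indicator (inv\<^bsub>G\<^esub> \<sigma> <#\<^bsub>G\<^esub> \<Gamma>))))"
      unfolding S rep_op(2)[OF admissible_K0_star[OF K'] intertwiner_p] by (rule S_p_product[OF K'])
  qed
  have e: "is_product3 G (S (\<sigma>\<^sub>1 <#\<^bsub>G\<^esub> \<Gamma>)) (op_coeffs G p) (S (\<Gamma> #>\<^bsub>G\<^esub> \<sigma>\<^sub>2))
        (coset_series G \<pi>\<^sub>0 (\<sigma>\<^sub>1 <#\<^bsub>G\<^esub> \<Gamma> #>\<^bsub>G\<^esub> \<sigma>\<^sub>2)) \<and>
      op_coeffs G (rep_op p (indicator (\<sigma>\<^sub>1 <#\<^bsub>G\<^esub> \<Gamma> #>\<^bsub>G\<^esub> \<sigma>\<^sub>2))) =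
        coset_series G \<pi>\<^sub>0 (\<sigma>\<^sub>1 <#\<^bsub>G\<^esub> \<Gamma> #>\<^bsub>G\<^esub> \<sigma>\<^sub>2)"
    if \<sigma>: "\<sigma>\<^sub>1 \<in> carrier G" "\<sigma>\<^sub>2 \<in> carrier G" for \<sigma>\<^sub>1 \<sigma>\<^sub>2
    using S_p_S_product[OF K0_star_base[OF \<sigma>(1)] K0_base[OF \<sigma>(2)]]
      rep_op(2)[OF admissible_K0K0[OF K0K0_base[OF \<sigma>]] intertwiner_p]
    unfolding S S_p coset_mult_indicator[OF is_group subgroup_axioms \<sigma>] by blast
  show ?thesis
    unfolding H_def
    by (intro conjI ballI exI[of _ "rep_op p"] a p_R_vN_tensor expansion p_conditional_expectation
        Hecke_rep_p c_unit op_system_rep_p)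
      (use b c d e in blast)+
qed

end
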